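(* Let $A,B$ be $C^*$-algebras and let $E\subset A$, $F\subset B$ be exact operator spaces with exactness constants $ex(E)$ and $ex(F)$. Let $C=ex(E)\,ex(F)$. Then every jointly completely bounded bilinear form $U\colon E\times F\to\mathbb{C}$ satisfies the following: for every finite sequence $(a_i,b_i)$ in $E\times F$ and all real numbers $\lambda_i>0$, $$\Big|\sum_i U(a_i,b_i)\Big|\le C\|U\|_{jcb}\Big[\Big\|\sum_i\lambda_i a_i^*a_i\Big\|^{1/2}+\Big\|\sum_i\lambda_i^{-1}a_ia_i^*\Big\|^{1/2}\Big]\Big[\Big\|\sum_i\lambda_i b_i^*b_i\Big\|^{1/2}+\Big\|\sum_i\lambda_i^{-1}b_ib_i^*\Big\|^{1/2}\Big],$$ and consequently $$\Big|\sum_i U(a_i,b_i)\Big|\le 2C\|U\|_{jcb}\Big[\Big\|\sum_i a_ia_i^*\Big\|^{1/2}\Big\|\sum_i b_i^*b_i\Big\|^{1/2}+\Big\|\sum_i a_i^*a_i\Big\|^{1/2}\Big\|\sum_i b_ib_i^*\Big\|^{1/2}\Big].$$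
   Context: Operator spaces $E\subset A$ carry the matrix norms inherited from the $C^*$-algebra $A$. An operator space $E$ is exact if there is a constant $C'$ such that for every finite dimensional subspace $G\subset E$ there are an integer $N$, a subspace $\widetilde G\subset M_N$ and a linear isomorphism $v\colon G\to\widetilde G$ with $\|v\|_{cb}\|v^{-1}\|_{cb}\le C'$; $ex(E)$ denotes the smallest such $C'$. The dual $F^*$ is an operator space via $M_n(F^* )=CB(F,M_n)$ isometrically. A bilinear form $U\colon E\times F\to\mathbb{C}$ is jointly completely bounded (j.c.b.) if the associated linear map $\widetilde U\colon E\to F^*$, $\widetilde U(a)(b)=U(a,b)$, is completely bounded, and $\|U\|_{jcb}=\|\widetilde U\|_{cb}$. *)

theory Defs
  imports Complex_Main "Jordan_Normal_Form.Matrix"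
begin

(* Not necessarily unital; the product and the complete norm come from the
   real_normed_algebra and banach superclasses. *)
class cstar_algebra = real_normed_algebra + banach +
  fixes scaleC :: "complex \<Rightarrow> 'a \<Rightarrow> 'a" (infixr "*\<^sub>C" 75)
    and star :: "'a \<Rightarrow> 'a"
  assumes scaleC_add_right: "c *\<^sub>C (x + y) = c *\<^sub>C x + c *\<^sub>C y"
    and scaleC_add_left: "(c + d) *\<^sub>C x = c *\<^sub>C x + d *\<^sub>C x"
    and scaleC_scaleC: "c *\<^sub>C (d *\<^sub>C x) = (c * d) *\<^sub>C x"
    and scaleC_of_real: "complex_of_real r *\<^sub>C x = r *\<^sub>R x"
    and mult_scaleC_left: "(c *\<^sub>C x) * y = c *\<^sub>C (x * y)"
    and mult_scaleC_right: "x * (c *\<^sub>C y) = c *\<^sub>C (x * y)"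
    and norm_scaleC: "norm (c *\<^sub>C x) = cmod c * norm x"
    and star_add: "star (x + y) = star x + star y"
    and star_scaleC: "star (c *\<^sub>C x) = cnj c *\<^sub>C star x"
    and star_mult: "star (x * y) = star y * star x"
    and star_star: "star (star x) = x"
    and cstar_identity: "norm (star x * x) = (norm x)\<^sup>2"

global_interpretation cvs: vector_space "scaleC :: complex \<Rightarrow> 'a \<Rightarrow> 'a::cstar_algebra"
proof
  fix c d :: complex and x y :: 'a
  show "c *\<^sub>C (x + y) = c *\<^sub>C x + c *\<^sub>C y" by (rule scaleC_add_right)
  show "(c + d) *\<^sub>C x = c *\<^sub>C x + d *\<^sub>C x" by (rule scaleC_add_left)
  show "c *\<^sub>C d *\<^sub>C x = (c * d) *\<^sub>C x" by (rule scaleC_scaleC)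
  show "1 *\<^sub>C x = x" using scaleC_of_real[of 1 x] by simp
qed


(* C*-norms on the *-algebra M_n(A) = carrier_mat n n that restrict to the norm of A
   on each diagonal corner.  There is exactly one such norm.  Completeness need not be
   required: the axioms make the norm equivalent to the maximum of the entry norms. *)
definition cstar_matrix_norm :: "nat \<Rightarrow> ('a::cstar_algebra mat \<Rightarrow> real) \<Rightarrow> bool" where
  "cstar_matrix_norm n N \<longleftrightarrow>
     (\<forall>X\<in>carrier_mat n n. N X = 0 \<longleftrightarrow> X = 0\<^sub>m n n) \<and>
     (\<forall>X\<in>carrier_mat n n. \<forall>Y\<in>carrier_mat n n. N (X + Y) \<le> N X + N Y) \<and>
     (\<forall>X\<in>carrier_mat n n. \<forall>c. N (map_mat (scaleC c) X) = cmod c * N X) \<and>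
     (\<forall>X\<in>carrier_mat n n. \<forall>Y\<in>carrier_mat n n. N (X * Y) \<le> N X * N Y) \<and>
     (\<forall>X\<in>carrier_mat n n. N (transpose_mat (map_mat star X) * X) = (N X)\<^sup>2) \<and>
     (\<forall>k<n. \<forall>a. N (mat n n (\<lambda>(i,j). if i = k \<and> j = k then a else 0)) = norm a)"

(* Only meaningful for square matrices, and only used for them. *)
definition mat_norm :: "'a::cstar_algebra mat \<Rightarrow> real" where
  "mat_norm X = (THE r. \<exists>N. cstar_matrix_norm (dim_row X) N \<and> r = N X)"


definition l2_norm :: "complex vec \<Rightarrow> real" where
  "l2_norm x = sqrt (\<Sum>i<dim_vec x. (cmod (x $ i))\<^sup>2)"

definition op_norm :: "complex mat \<Rightarrow> real" where
  "op_norm M = Sup {l2_norm (M *\<^sub>v x) | x. x \<in> carrier_vec (dim_col M) \<and> l2_norm x \<le> 1}"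

(* The identification of M_n(M_N) with M_{nN}. *)
definition flatten_blocks :: "nat \<Rightarrow> complex mat mat \<Rightarrow> complex mat" where
  "flatten_blocks N X = mat (dim_row X * N) (dim_col X * N)
     (\<lambda>(p,q). (X $$ (p div N, q div N)) $$ (p mod N, q mod N))"

definition block_norm :: "nat \<Rightarrow> complex mat mat \<Rightarrow> real" where
  "block_norm N X = op_norm (flatten_blocks N X)"


(* A map f defined on the space S is measured with respect to matrix norms p (domain) and
   q (codomain); map_mat f is the amplification of f to matrices.  Linearity is stated
   separately. *)
definition completely_bounded ::
    "'x set \<Rightarrow> ('x mat \<Rightarrow> real) \<Rightarrow> ('y mat \<Rightarrow> real) \<Rightarrow> ('x \<Rightarrow> 'y) \<Rightarrow> bool" where
  "completely_bounded S p q f \<longleftrightarrow>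
     (\<exists>K. \<forall>n. \<forall>X\<in>carrier_mat n n. elements_mat X \<subseteq> S \<longrightarrow> q (map_mat f X) \<le> K * p X)"

definition cb_norm ::
    "'x set \<Rightarrow> ('x mat \<Rightarrow> real) \<Rightarrow> ('y mat \<Rightarrow> real) \<Rightarrow> ('x \<Rightarrow> 'y) \<Rightarrow> real" where
  "cb_norm S p q f =
     Sup {q (map_mat f X) | n X. X \<in> carrier_mat n n \<and> elements_mat X \<subseteq> S \<and> p X \<le> 1}"


(* The matrices in Gt form a subspace of M_N because v is linear and onto Gt.
   The explicit requirement of complete boundedness (automatic in finite dimension) ensures
   that the suprema in cb_norm are those of bounded sets. *)
definition exact_with :: "'a::cstar_algebra set \<Rightarrow> real \<Rightarrow> bool" where
  "exact_with E C' \<longleftrightarrow>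
     (\<forall>G. cvs.subspace G \<and> G \<subseteq> E \<and> (\<exists>B. finite B \<and> G = cvs.span B) \<longrightarrow>
       (\<exists>N Gt v. Gt \<subseteq> carrier_mat N N \<and> bij_betw v G Gt \<and>
          (\<forall>x\<in>G. \<forall>y\<in>G. v (x + y) = v x + v y) \<and>
          (\<forall>x\<in>G. \<forall>c. v (c *\<^sub>C x) = c \<cdot>\<^sub>m v x) \<and>
          completely_bounded G mat_norm (block_norm N) v \<and>
          completely_bounded Gt (block_norm N) mat_norm (inv_into G v) \<and>
          cb_norm G mat_norm (block_norm N) v
            * cb_norm Gt (block_norm N) mat_norm (inv_into G v) \<le> C'))"

definition exact :: "'a::cstar_algebra set \<Rightarrow> bool" where
  "exact E \<longleftrightarrow> (\<exists>C'. exact_with E C')"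

(* The smallest constant is understood as an infimum, which need not be attained. *)
definition ex_const :: "'a::cstar_algebra set \<Rightarrow> real" where
  "ex_const E = Inf {C'. exact_with E C'}"


(* Functionals on F are represented by functions on the ambient algebra; their values
   outside F are irrelevant. *)
definition dual_space :: "'b::cstar_algebra set \<Rightarrow> ('b \<Rightarrow> complex) set" where
  "dual_space F = {\<phi>.
     (\<forall>x\<in>F. \<forall>y\<in>F. \<phi> (x + y) = \<phi> x + \<phi> y) \<and>
     (\<forall>x\<in>F. \<forall>c. \<phi> (c *\<^sub>C x) = c * \<phi> x) \<and>
     (\<exists>K. \<forall>x\<in>F. cmod (\<phi> x) \<le> K * norm x)}"

(* M_n(F^* ) = CB(F, M_n): the matrix (phi_ij) acts by b \<mapsto> (phi_ij(b)). *)
definition dual_mat_norm :: "'b::cstar_algebra set \<Rightarrow> ('b \<Rightarrow> complex) mat \<Rightarrow> real" where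
  "dual_mat_norm F \<Phi> =
     cb_norm F mat_norm (block_norm (dim_row \<Phi>)) (\<lambda>b. map_mat (\<lambda>\<phi>. \<phi> b) \<Phi>)"

definition bilinear_form ::
    "'a::cstar_algebra set \<Rightarrow> 'b::cstar_algebra set \<Rightarrow> ('a \<Rightarrow> 'b \<Rightarrow> complex) \<Rightarrow> bool" where
  "bilinear_form E F U \<longleftrightarrow>
     (\<forall>x\<in>E. \<forall>y\<in>E. \<forall>b\<in>F. U (x + y) b = U x b + U y b) \<and>
     (\<forall>x\<in>E. \<forall>b\<in>F. \<forall>c. U (c *\<^sub>C x) b = c * U x b) \<and>
     (\<forall>a\<in>E. \<forall>x\<in>F. \<forall>y\<in>F. U a (x + y) = U a x + U a y) \<and>
     (\<forall>a\<in>E. \<forall>x\<in>F. \<forall>c. U a (c *\<^sub>C x) = c * U a x)"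

(* Currying: the function U itself is the associated map from E to the dual of F. *)
definition jointly_cb ::
    "'a::cstar_algebra set \<Rightarrow> 'b::cstar_algebra set \<Rightarrow> ('a \<Rightarrow> 'b \<Rightarrow> complex) \<Rightarrow> bool" where
  "jointly_cb E F U \<longleftrightarrow> bilinear_form E F U \<and> (\<forall>a\<in>E. U a \<in> dual_space F) \<and>
     completely_bounded E mat_norm (dual_mat_norm F) U"

definition jcb_norm ::
    "'a::cstar_algebra set \<Rightarrow> 'b::cstar_algebra set \<Rightarrow> ('a \<Rightarrow> 'b \<Rightarrow> complex) \<Rightarrow> real" where
  "jcb_norm E F U = cb_norm E mat_norm (dual_mat_norm F) U"

end

theory Submission
  imports Defs "HOL-Analysis.Operator_Norm" "HOL-Analysis.L2_Norm" "HOL-Combinatorics.Permutations"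
    "Jordan_Normal_Form.Determinant"
begin

text \<open>Exactness replaces the \<open>a\<^sub>i\<close> and \<open>b\<^sub>i\<close>, up to the factor \<open>ex(E) ex(F)\<close>, by complex matrices
  \<open>X\<^sub>i\<close>, \<open>W\<^sub>i\<close> of a fixed size \<open>N\<close>. One then looks for finite matrices \<open>Y\<^sub>i\<close> and a unit vector \<open>\<xi>\<close> such
  that \<open>\<parallel>\<Sum> X\<^sub>i \<otimes> Y\<^sub>i\<parallel>\<close> is nearly bounded by \<open>\<parallel>\<Sum> \<lambda>\<^sub>i X\<^sub>i\<^sup>* X\<^sub>i\<parallel>\<^sup>1\<^sup>/\<^sup>2 + \<parallel>\<Sum> \<lambda>\<^sub>i\<^sup>-\<^sup>1 X\<^sub>i X\<^sub>i\<^sup>*\<parallel>\<^sup>1\<^sup>/\<^sup>2\<close>, likewise for the \<open>W\<^sub>i\<close>,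
  and \<open>\<langle>(Y\<^sub>i \<otimes> Y\<^sub>j) \<xi>, \<xi>\<rangle>\<close> is nearly \<open>\<delta>\<^sub>i\<^sub>j\<close>; the joint complete boundedness of \<open>U\<close>, applied to
  \<open>\<Sum> a\<^sub>i \<otimes> Y\<^sub>i\<close> and \<open>\<Sum> b\<^sub>j \<otimes> Y\<^sub>j\<close>, gives the first inequality. For \<open>\<lambda>\<^sub>i = 1\<close> the \<open>Y\<^sub>i\<close> come from
  permutation involutions without short relations: near each point their graph is a tree, where
  \<open>\<Sum> X\<^sub>i \<otimes> Y\<^sub>i\<close> splits into a creation and an annihilation part with the two norms above. Hence the
  high moments of \<open>\<Sum> X\<^sub>i \<otimes> Y\<^sub>i\<close> are bounded as required, and since \<open>N\<close> is fixed, the part of the operator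
  exceeding the bound can be cut off by compressing the \<open>Y\<^sub>i\<close> to a subspace of small codimension, up
  to a smooth cutoff. General weights \<open>\<lambda>\<^sub>i\<close> are produced by replacing \<open>X\<^sub>i\<close> with the family
  \<open>X\<^sub>i \<otimes> \<surd>p\<^sub>i(j,k) e\<^sub>k\<^sub>j\<close>, where \<open>p\<^sub>i\<close> transports the harmonic weights \<open>1 / j\<close> along \<open>j \<mapsto> \<lambda>\<^sub>i\<^sup>2 j\<close>
  (an embezzlement state). The second inequality is the case of constant \<open>\<lambda>\<close>, optimised over that constant.\<close>

section \<open>Positivity in C*-algebras\<close>

text \<open>Some cut is unavoidable: permutation matrices fix the constant vector, so with uncut
  \<open>Y_i\<close> the norm of \<open>\<Sum> X_i \<otimes> Y_i\<close> is at least that of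
  \<open>\<Sum> X_i\<close>, which can be far above the desired bound (\<open>n\<close> against
  \<open>2 * sqrt n\<close> for \<open>X_i = 1\<close>). The cut is affordable because of the order
  of choices: \<open>n\<close>, \<open>N\<close> and the number \<open>D\<close> of embezzlement
  levels come first and fix \<open>card J = N * D\<close>; the moment \<open>2 ^ k\<close>, the
  radius \<open>R\<close> and the size \<open>d\<close> of the graph come afterwards. Cutting costs
  a factor \<open>(card J)^2\<close>, while the moments gain
  \<open>((\<alpha> + \<beta>) / B) ^ (4 * 2 ^ k)\<close>, so the cut tends to the identity. This is
  where exactness enters: the size of the coefficients is chosen before the \<open>Y_i\<close>. The
  trace does not distinguish \<open>Y_i^* Y_i\<close> from \<open>Y_i Y_i^*\<close>, which suits
  equal weights only. Unequal weights need a vector state that is not tracial, and a single one that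
  serves all \<open>\<lambda>_i\<close> at once; harmonic weights supply it approximately on finite
  matrices. \<open>E\<close> and \<open>F\<close> get different cuts but share one family of
  involutions, since the pairing compares the two.\<close>

lemma star_zero [simp]: "star (0::'a::cstar_algebra) = 0"
  using star_add[of "0::'a" 0] by simp

lemma scaleC_one [simp]: "1 *\<^sub>C (x::'a::cstar_algebra) = x"
  using scaleC_of_real[of 1 x] by simp

lemma scaleC_minus_one: "(-1) *\<^sub>C (x::'a::cstar_algebra) = - x"
  using scaleC_of_real[of "-1" x] by simp

lemma star_scaleR: "star (r *\<^sub>R x) = r *\<^sub>R star (x::'a::cstar_algebra)"
  using star_scaleC[of "complex_of_real r" x] by (simp add: scaleC_of_real)

lemma star_minus: "star (- x) = - star (x::'a::cstar_algebra)"
  using star_scaleR[of "-1" x] by simp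

lemma star_diff: "star (x - y) = star x - star (y::'a::cstar_algebra)"
  using star_add[of x "- y"] by (simp add: star_minus)

lemma star_sum: "star (\<Sum>i\<in>I. f i) = (\<Sum>i\<in>I. star (f i::'a::cstar_algebra))"
  by (induction I rule: infinite_finite_induct) (auto simp: star_add)

lemma norm_star [simp]: "norm (star x) = norm (x::'a::cstar_algebra)"
proof -
  have *: "norm y \<le> norm (star y)" for y :: 'a
  proof (cases "y = 0")
    case False
    have "(norm y)\<^sup>2 \<le> norm (star y) * norm y"
      using norm_mult_ineq[of "star y" y] by (simp add: cstar_identity)
    then show ?thesis using False by (simp add: power2_eq_square)
  qed simp
  from *[of x] *[of "star x"] show ?thesis by (simp add: star_star)
qed

lemma norm_mult_star: "norm (x * star x) = (norm (x::'a::cstar_algebra))\<^sup>2"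
  using cstar_identity[of "star x"] by (simp add: star_star)

lemma bounded_linear_star: "bounded_linear (star :: 'a::cstar_algebra \<Rightarrow> 'a)"
  by (rule bounded_linear_intro[where K=1]) (auto simp: star_add star_scaleR)

lemma norm_selfadjoint_square: "star h = h \<Longrightarrow> norm (h * h) = (norm (h::'a::cstar_algebra))\<^sup>2"
  using cstar_identity[of h] by simp

text \<open>Solves \<open>(1 - y)\<^sup>2 = 1 - x\<close> without a unit. The iterates are polynomials in \<open>x\<close> with nonnegative
  coefficients, so their increments are dominated by those of the scalar iteration at \<open>x = 1\<close>.\<close>

primrec quasi_sqrt_iter :: "'a::real_normed_algebra \<Rightarrow> nat \<Rightarrow> 'a" where
  "quasi_sqrt_iter x 0 = 0"
| "quasi_sqrt_iter x (Suc k) = (1/2) *\<^sub>R (x + quasi_sqrt_iter x k * quasi_sqrt_iter x k)"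

lemma quasi_sqrt_iter_commute:
  "z * x = x * z \<Longrightarrow> z * quasi_sqrt_iter x k = quasi_sqrt_iter x k * (z::'a::real_normed_algebra)"
proof (induction k)
  case (Suc k)
  let ?y = "quasi_sqrt_iter x k"
  have "z * (?y * ?y) = (?y * ?y) * z" by (metis Suc mult.assoc)
  with Suc.prems show ?case by (simp add: distrib_left distrib_right)
qed simp

lemma quasi_sqrt_iter_real:
  "0 \<le> quasi_sqrt_iter (1::real) k \<and> quasi_sqrt_iter (1::real) k \<le> 1
    \<and> quasi_sqrt_iter (1::real) k \<le> quasi_sqrt_iter (1::real) (Suc k)"
proof (induction k)
  case (Suc k)
  let ?r = "quasi_sqrt_iter (1::real)"
  have 1: "?r (Suc k) = (1 + ?r k * ?r k) / 2" "?r (Suc (Suc k)) = (1 + ?r (Suc k) * ?r (Suc k)) / 2"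
    by simp_all
  have "?r k * ?r k \<le> 1" using Suc by (intro mult_le_one) auto
  moreover have "?r k * ?r k \<le> ?r (Suc k) * ?r (Suc k)" using Suc by (intro mult_mono) auto
  ultimately show ?case using Suc unfolding 1 by (auto simp del: quasi_sqrt_iter.simps)
qed simp

lemma quasi_sqrt_iter_bounds:
  fixes x :: "'a::real_normed_algebra"
  assumes "norm x \<le> 1"
  shows "norm (quasi_sqrt_iter x k) \<le> quasi_sqrt_iter 1 k"
    and "norm (quasi_sqrt_iter x (Suc k) - quasi_sqrt_iter x k)
      \<le> quasi_sqrt_iter 1 (Suc k) - quasi_sqrt_iter 1 k"
proof -
  let ?y = "quasi_sqrt_iter x" and ?r = "quasi_sqrt_iter (1::real)"
  have bd: "norm (?y k) \<le> ?r k" for k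
  proof (induction k)
    case (Suc k)
    have "norm (?y k * ?y k) \<le> ?r k * ?r k"
      by (intro order_trans[OF norm_mult_ineq] mult_mono Suc.IH norm_ge_zero)
        (use quasi_sqrt_iter_real[of k] in auto)
    then show ?case using norm_triangle_ineq[of x "?y k * ?y k"] assms by simp
  qed simp
  then show "norm (?y k) \<le> ?r k" .
  show "norm (?y (Suc k) - ?y k) \<le> ?r (Suc k) - ?r k"
  proof (induction k)
    case 0
    then show ?case using assms by simp
  next
    case (Suc k)
    let ?a = "?y (Suc k)" and ?b = "?y k"
    \<comment> \<open>Both iterates are polynomials in \<open>x\<close>; commuting makes the
      difference of squares factor.\<close>
    have comm: "?a * ?b = ?b * ?a"
      by (rule quasi_sqrt_iter_commute) (rule quasi_sqrt_iter_commute[symmetric], simp)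
    have "?y (Suc (Suc k)) - ?a = (1/2) *\<^sub>R (?a * ?a - ?b * ?b)"
      by (simp add: scaleR_diff_right[symmetric])
    also have "?a * ?a - ?b * ?b = (?a - ?b) * (?a + ?b)"
      using comm by (simp add: algebra_simps del: quasi_sqrt_iter.simps)
    finally have "norm (?y (Suc (Suc k)) - ?a) = (1/2) * norm ((?a - ?b) * (?a + ?b))" by simp
    also have "\<dots> \<le> (1/2) * ((?r (Suc k) - ?r k) * (?r (Suc k) + ?r k))"
      by (intro mult_left_mono order_trans[OF norm_mult_ineq] mult_mono Suc.IH
            order_trans[OF norm_triangle_ineq] add_mono bd)
         (use quasi_sqrt_iter_real[of k] in \<open>simp_all del: quasi_sqrt_iter.simps\<close>)
    also have "\<dots> = ?r (Suc (Suc k)) - ?r (Suc k)" by (simp add: field_simps)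
    finally show ?case .
  qed
qed

text \<open>This stands in for the continuous functional calculus: \<open>y\<close> is a limit of
  polynomials in \<open>x\<close>, so it commutes with all that commutes with \<open>x\<close> and
  inherits self-adjointness.\<close>

lemma quasi_sqrt:
  fixes x :: "'a::cstar_algebra"
  assumes x: "norm x \<le> 1"
  obtains y where "norm y \<le> 1" "y + y - y * y = x" "\<And>z. z * x = x * z \<Longrightarrow> z * y = y * z"
    "star x = x \<Longrightarrow> star y = y"
proof -
  let ?y = "quasi_sqrt_iter x" and ?r = "quasi_sqrt_iter (1::real)"
  have "incseq ?r" using quasi_sqrt_iter_real by (intro incseq_SucI) auto
  moreover have "bdd_above (range ?r)" using quasi_sqrt_iter_real by (intro bdd_aboveI[of _ 1]) auto
  ultimately have "convergent ?r"
    using LIMSEQ_incseq_SUP[of ?r] by (auto simp: convergent_def)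
  then have cr: "Cauchy ?r" by (rule convergent_Cauchy)
  \<comment> \<open>Telescoping the dominated increments carries the Cauchy property over from the
    scalar iteration, which is increasing and bounded.\<close>
  have diff: "norm (?y (m + k) - ?y m) \<le> ?r (m + k) - ?r m" for m k
  proof (induction k)
    case (Suc k)
    have "norm (?y (m + Suc k) - ?y m) \<le> norm (?y (Suc (m + k)) - ?y (m + k)) + norm (?y (m + k) - ?y m)"
      using norm_triangle_ineq[of "?y (Suc (m + k)) - ?y (m + k)" "?y (m + k) - ?y m"]
      by (simp del: quasi_sqrt_iter.simps)
    also have "\<dots> \<le> ?r (m + Suc k) - ?r m"
      using Suc quasi_sqrt_iter_bounds(2)[OF x, of "m + k"] by (simp del: quasi_sqrt_iter.simps)
    finally show ?case .
  qed simp
  have "Cauchy ?y"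
    unfolding Cauchy_altdef2
  proof (intro allI impI)
    fix e :: real assume "e > 0"
    with cr obtain N where N: "\<forall>n\<ge>N. dist (?r n) (?r N) < e" unfolding Cauchy_altdef2 by blast
    have "dist (?y n) (?y N) < e" if "n \<ge> N" for n
      using N that diff[of N "n - N"] by (force simp: dist_norm)
    then show "\<exists>N. \<forall>n\<ge>N. dist (?y n) (?y N) < e" by blast
  qed
  then obtain y where y: "?y \<longlonglongrightarrow> y"
    using Cauchy_convergent[of ?y] by (auto simp: convergent_def)
  have "norm (?y k) \<le> 1" for k
    using quasi_sqrt_iter_bounds(1)[OF x, of k] quasi_sqrt_iter_real[of k] by linarith
  then have 1: "norm y \<le> 1"
    using y by (intro tendsto_upperbound[OF tendsto_norm[OF y]]) auto
  have "(\<lambda>k. ?y (Suc k)) \<longlonglongrightarrow> (1/2) *\<^sub>R (x + y * y)"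
    by (simp, intro tendsto_intros y)
  with LIMSEQ_Suc[OF y] have eq: "y = (1/2) *\<^sub>R (x + y * y)" by (rule LIMSEQ_unique)
  have "y + y = x + y * y" by (subst (1 2) eq) (simp add: scaleR_left_distrib[symmetric])
  then have 2: "y + y - y * y = x" by simp
  have 3: "z * y = y * z" if "z * x = x * z" for z
  proof -
    have "(\<lambda>k. z * ?y k) \<longlonglongrightarrow> z * y" "(\<lambda>k. ?y k * z) \<longlonglongrightarrow> y * z"
      by (intro tendsto_intros y)+
    then show ?thesis using quasi_sqrt_iter_commute[OF that] LIMSEQ_unique by simp
  qed
  have 4: "star y = y" if "star x = x"
  proof -
    have "star (?y k) = ?y k" for k
      by (induction k) (auto simp: star_add star_scaleR star_mult that)
    with bounded_linear.tendsto[OF bounded_linear_star y] y show ?thesis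
      using LIMSEQ_unique by auto
  qed
  from 1 2 3 4 show ?thesis by (rule that)
qed

lemma star_one [simp]: "star (1::'a::{cstar_algebra,real_normed_algebra_1}) = 1"
  by (metis mult.right_neutral mult.left_neutral star_mult star_star)

text \<open>For self-adjoint \<open>h\<close> the norm condition says that the spectrum lies in
  \<open>[0, 2t]\<close>. In this form positivity needs no spectral theory, and sums and multiples
  follow from the triangle inequality.\<close>

definition cpos :: "'a::{cstar_algebra,real_normed_algebra_1} \<Rightarrow> bool" where
  "cpos h \<longleftrightarrow> star h = h \<and> (\<exists>t\<ge>0. norm (t *\<^sub>R 1 - h) \<le> t)"

lemma cpos_obtain:
  fixes h :: "'a::{cstar_algebra,real_normed_algebra_1}"
  assumes "cpos h"
  obtains t where "t > 0" "norm (t *\<^sub>R 1 - h) \<le> t"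
proof -
  from assms obtain t where t: "t \<ge> 0" "norm (t *\<^sub>R 1 - h) \<le> t" by (auto simp: cpos_def)
  have "norm ((t + 1) *\<^sub>R 1 - h) \<le> norm (t *\<^sub>R 1 - h) + norm (1::'a)"
    using norm_triangle_ineq[of "t *\<^sub>R 1 - h" 1] by (simp add: algebra_simps)
  then have "norm ((t + 1) *\<^sub>R 1 - h) \<le> t + 1" using t by simp
  with t show ?thesis by (intro that[of "t + 1"]) auto
qed

lemma cpos_add:
  assumes "cpos a" "cpos b" shows "cpos (a + b)"
proof -
  obtain s t where st: "s > 0" "norm (s *\<^sub>R 1 - a) \<le> s" "t > 0" "norm (t *\<^sub>R 1 - b) \<le> t"
    using assms cpos_obtain by metis
  have "norm ((s + t) *\<^sub>R 1 - (a + b)) \<le> norm (s *\<^sub>R 1 - a) + norm (t *\<^sub>R 1 - b)"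
    using norm_triangle_ineq[of "s *\<^sub>R 1 - a" "t *\<^sub>R 1 - b"] by (simp add: algebra_simps)
  with st assms show ?thesis unfolding cpos_def by (intro conjI exI[of _ "s + t"]) (auto simp: star_add)
qed

lemma cpos_scaleR:
  assumes "cpos a" "r \<ge> 0" shows "cpos (r *\<^sub>R a)"
proof -
  obtain s where s: "s > 0" "norm (s *\<^sub>R 1 - a) \<le> s" using assms cpos_obtain by metis
  have "norm ((r * s) *\<^sub>R 1 - r *\<^sub>R a) = r * norm (s *\<^sub>R 1 - a)"
    using \<open>r \<ge> 0\<close> by (simp flip: scaleR_scaleR scaleR_diff_right)
  also have "\<dots> \<le> r * s" using s assms by (intro mult_left_mono)
  finally show ?thesis using assms s unfolding cpos_def
    by (intro conjI exI[of _ "r * s"]) (auto simp: star_scaleR)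
qed

lemma cpos_0 [simp]: "cpos 0"
  by (auto simp: cpos_def intro: exI[of _ 0])

text \<open>Write \<open>h = t (1 - x)\<close> with \<open>norm x \<le> 1\<close>; then
  \<open>sqrt t (1 - y)\<close> is a root, where \<open>(1 - y)^2 = 1 - x\<close>, and
  \<open>norm y \<le> 1\<close> is exactly its positivity.\<close>

lemma cpos_sqrt:
  fixes h :: "'a::{cstar_algebra,real_normed_algebra_1}"
  assumes "cpos h"
  obtains k where "cpos k" "k * k = h" "\<And>z. z * h = h * z \<Longrightarrow> z * k = k * z"
proof -
  from assms obtain t where t: "t > 0" "norm (t *\<^sub>R 1 - h) \<le> t" by (rule cpos_obtain)
  define x where "x = 1 - (1/t) *\<^sub>R h"
  have "x = (1/t) *\<^sub>R (t *\<^sub>R 1 - h)" using t by (simp add: x_def scaleR_diff_right)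
  then have "norm x = (1/t) * norm (t *\<^sub>R 1 - h)" using t by simp
  also have "\<dots> \<le> 1" using t by (simp add: field_simps)
  finally have "norm x \<le> 1" .
  then obtain y where y: "norm y \<le> 1" "y + y - y * y = x" "\<And>z. z * x = x * z \<Longrightarrow> z * y = y * z"
    "star x = x \<Longrightarrow> star y = y" by (rule quasi_sqrt) blast
  define k where "k = sqrt t *\<^sub>R (1 - y)"
  have "star x = x" using assms by (simp add: x_def star_diff star_scaleR cpos_def)
  then have sk: "star k = k" using y(4) by (simp add: k_def star_scaleR star_diff)
  have "(1 - y) * (1 - y) = 1 - (y + y - y * y)" by (simp add: algebra_simps)
  then have "k * k = t *\<^sub>R (1 - x)" using t(1) y(2) by (simp add: k_def)
  then have kk: "k * k = h" using t by (simp add: x_def)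
  have "sqrt t *\<^sub>R 1 - k = sqrt t *\<^sub>R y" by (simp add: k_def algebra_simps)
  then have "norm (sqrt t *\<^sub>R 1 - k) \<le> sqrt t"
    using t(1) y(1) by (simp add: mult_left_le)
  with sk have ck: "cpos k" using t(1) unfolding cpos_def by (intro conjI exI[of _ "sqrt t"]) auto
  have comm: "z * k = k * z" if "z * h = h * z" for z
  proof -
    have "z * x = x * z" using that by (simp add: x_def algebra_simps)
    then show ?thesis using y(3)[of z] by (simp add: k_def algebra_simps)
  qed
  show ?thesis by (rule that[OF ck kk comm])
qed

text \<open>Commuting self-adjoint \<open>a\<close>, \<open>b\<close> are the real and imaginary parts of \<open>u = a + i b\<close>,
  and \<open>star u * u = a\<^sup>2 + b\<^sup>2\<close>.\<close>

lemma norm_le_commuting_squares: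
  fixes a b :: "'a::cstar_algebra"
  assumes "star a = a" "star b = b" "a * b = b * a"
  shows "(norm a)\<^sup>2 \<le> norm (a * a + b * b)"
proof -
  define u where "u = a + \<i> *\<^sub>C b"
  have su: "star u = a - \<i> *\<^sub>C b"
    using assms by (simp add: u_def star_add star_scaleC cvs.scale_minus_left)
  have "star u * u = a * a + b * b"
    unfolding su unfolding u_def using assms
    by (simp add: algebra_simps mult_scaleC_left mult_scaleC_right scaleC_scaleC scaleC_minus_one
        cvs.scale_minus_left)
  then have nu: "(norm u)\<^sup>2 = norm (a * a + b * b)" using cstar_identity[of u] by simp
  have "2 *\<^sub>R a = u + star u" unfolding su unfolding u_def by (simp add: scaleR_2)
  then have "2 * norm a = norm (u + star u)" by (metis norm_scaleR abs_numeral)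
  also have "\<dots> \<le> 2 * norm u" using norm_triangle_ineq[of u "star u"] by simp
  finally have "norm a \<le> norm u" by simp
  then show ?thesis using nu by (metis norm_ge_zero power_mono)
qed

text \<open>After normalising, \<open>1 - l^2 = (1 - y)^2\<close> with \<open>y\<close> commuting
  with \<open>l\<close>. The squares of \<open>1 - y\<close> and \<open>l\<close> add up to
  \<open>1\<close>, so \<open>norm (1 - y) \<le> 1\<close>, and hence
  \<open>norm (1 - l^2) \<le> 1\<close>.\<close>

lemma cpos_square:
  fixes k :: "'a::{cstar_algebra,real_normed_algebra_1}"
  assumes "star k = k" shows "cpos (k * k)"
proof (cases "k = 0")
  case False
  define l where "l = (1 / norm k) *\<^sub>R k"
  have l: "norm l = 1" "star l = l" "k * k = (norm k)\<^sup>2 *\<^sub>R (l * l)"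
    using False assms by (auto simp: l_def star_scaleR power2_eq_square)
  have "norm (l * l) \<le> 1" using l norm_mult_ineq[of l l] by simp
  then obtain y where y: "norm y \<le> 1" "y + y - y * y = l * l" "\<And>z. z * (l * l) = (l * l) * z \<Longrightarrow> z * y = y * z"
    "star (l * l) = l * l \<Longrightarrow> star y = y" by (rule quasi_sqrt) blast
  have "(1 - y) * (1 - y) = 1 - (y + y - y * y)" by (simp add: algebra_simps)
  then have q: "(1 - y) * (1 - y) = 1 - l * l" using y(2) by simp
  have "star y = y" using y(4) l(2) by (simp add: star_mult)
  moreover have "l * y = y * l" using y(3)[of l] by (simp add: mult.assoc)
  ultimately have "(norm (1 - y))\<^sup>2 \<le> norm ((1 - y) * (1 - y) + l * l)"
    using l(2) by (intro norm_le_commuting_squares) (auto simp: star_diff algebra_simps)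
  also have "\<dots> = 1" unfolding q by simp
  finally have "norm (1 - l * l) \<le> 1"
    using norm_mult_ineq[of "1 - y" "1 - y"] unfolding q by (simp add: power2_eq_square)
  then have "cpos (l * l)" using l unfolding cpos_def by (intro conjI exI[of _ 1]) (auto simp: star_mult)
  then show ?thesis unfolding l(3) by (rule cpos_scaleR) simp
qed simp

text \<open>The roots of \<open>h\<close> and \<open>1 - h\<close> commute and their squares add up
  to \<open>1\<close>, so neither root has norm above \<open>1\<close>.\<close>

lemma cpos_le_one:
  fixes h :: "'a::{cstar_algebra,real_normed_algebra_1}"
  assumes "cpos h" "cpos (1 - h)" shows "norm h \<le> 1"
proof -
  obtain k where k: "cpos k" "k * k = h" "\<And>z. z * h = h * z \<Longrightarrow> z * k = k * z"
    using cpos_sqrt[OF assms(1)] by metis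
  obtain l where l: "cpos l" "l * l = 1 - h" "\<And>z. z * (1 - h) = (1 - h) * z \<Longrightarrow> z * l = l * z"
    using cpos_sqrt[OF assms(2)] by metis
  have "k * h = h * k" using k(2) by (metis mult.assoc)
  then have "k * l = l * k" by (intro l(3)) (simp add: algebra_simps)
  then have "(norm k)\<^sup>2 \<le> norm (k * k + l * l)"
    using k(1) l(1) by (intro norm_le_commuting_squares) (auto simp: cpos_def)
  also have "\<dots> = 1" using k(2) l(2) by simp
  finally show ?thesis using norm_mult_ineq[of k k] k(2) by (simp add: power2_eq_square)
qed

text \<open>As before with commuting roots of \<open>h\<close> and \<open>- h\<close>, whose squares
  add up to \<open>0\<close>.\<close>

lemma cpos_antisym:
  fixes h :: "'a::{cstar_algebra,real_normed_algebra_1}"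
  assumes "cpos h" "cpos (- h)" shows "h = 0"
proof -
  obtain k where k: "cpos k" "k * k = h" "\<And>z. z * h = h * z \<Longrightarrow> z * k = k * z"
    using cpos_sqrt[OF assms(1)] by metis
  obtain l where l: "cpos l" "l * l = - h" "\<And>z. z * (- h) = (- h) * z \<Longrightarrow> z * l = l * z"
    using cpos_sqrt[OF assms(2)] by metis
  have "k * h = h * k" using k(2) by (metis mult.assoc)
  then have "k * l = l * k" by (intro l(3)) simp
  then have "(norm k)\<^sup>2 \<le> norm (k * k + l * l)"
    using k(1) l(1) by (intro norm_le_commuting_squares) (auto simp: cpos_def)
  then have "k = 0" using k(2) l(2) by simp
  then show ?thesis using k(2) by simp
qed

text \<open>Only exponents \<open>2 ^ j\<close> are available, because norms of powers are
  multiplicative along repeated squaring. Bernoulli's inequality is linear in the exponent, so it is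
  squared once to beat the linear hypothesis.\<close>

lemma le_one_if_power2_linear_bound:
  fixes r c :: real
  assumes "r \<ge> 0" and bd: "\<And>j. r ^ (2 ^ j) \<le> 1 + 2 ^ j * c"
  shows "r \<le> 1"
proof (rule ccontr)
  assume "\<not> r \<le> 1"
  define d where "d = r - 1"
  have d: "d > 0" "r = 1 + d" using \<open>\<not> r \<le> 1\<close> by (auto simp: d_def)
  obtain j :: nat where j: "2 * c / d\<^sup>2 < 2 ^ j" using real_arch_pow[of 2 "2 * c / d\<^sup>2"] by auto
  let ?m = "2 ^ j :: real"
  have "1 + ?m * d \<le> r ^ (2 ^ j)"
    using Bernoulli_inequality[of d "2 ^ j"] d by (simp add: mult.commute)
  then have "(1 + ?m * d)\<^sup>2 \<le> (r ^ (2 ^ j))\<^sup>2" using d by (intro power_mono) auto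
  also have "\<dots> = r ^ (2 ^ Suc j)" by (simp add: power_mult[symmetric] mult.commute)
  also have "\<dots> \<le> 1 + 2 ^ Suc j * c" by (rule bd)
  finally have "2 * ?m * d + ?m\<^sup>2 * d\<^sup>2 \<le> 2 * ?m * c" by (simp add: power2_eq_square algebra_simps)
  moreover have "2 * ?m * c < ?m\<^sup>2 * d\<^sup>2"
  proof -
    have "2 * c < ?m * d\<^sup>2" using j d by (simp add: field_simps)
    then have "?m * (2 * c) < ?m * (?m * d\<^sup>2)" by simp
    then show ?thesis by (simp add: power2_eq_square algebra_simps)
  qed
  moreover have "2 * ?m * d > 0" using d by simp
  ultimately show False by linarith
qed

lemma norm_selfadjoint_power:
  fixes h :: "'a::{cstar_algebra,real_normed_algebra_1}"
  assumes "star h = h" shows "norm (h ^ (2 ^ j)) = norm h ^ (2 ^ j)"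
proof (induction j)
  case (Suc j)
  have sp: "star (h ^ m) = h ^ m" for m
    by (induction m) (auto simp: star_mult assms power_commutes)
  have "h ^ (2 ^ Suc j) = h ^ (2 ^ j) * h ^ (2 ^ j)" by (simp flip: power_add add: mult_2)
  then have "norm (h ^ (2 ^ Suc j)) = (norm (h ^ (2 ^ j)))\<^sup>2" by (simp add: norm_selfadjoint_square sp)
  then show ?case using Suc by (simp add: power_mult[symmetric] mult.commute)
qed simp

text \<open>Both norms below are governed by spectral radii, and \<open>star y * y\<close>, \<open>y * star y\<close> have the same
  spectrum up to \<open>0\<close>: \<open>(t + y y\<^sup>*)\<^sup>k y y\<^sup>* = y (t + y\<^sup>* y)\<^sup>k y\<^sup>*\<close>.\<close>

lemma norm_shift_swap:
  fixes y :: "'a::{cstar_algebra,real_normed_algebra_1}"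
  assumes t: "t > 0" "norm (t *\<^sub>R 1 + star y * y) \<le> t"
  shows "norm (t *\<^sub>R 1 + y * star y) \<le> t"
proof -
  define h where "h = t *\<^sub>R 1 + star y * y"
  define w where "w = t *\<^sub>R 1 + y * star y"
  define M where "M = norm y * norm y"
  have wy: "w ^ k * y = y * h ^ k" for k
  proof (induction k)
    case (Suc k)
    have "w * y = y * h" by (simp add: w_def h_def algebra_simps)
    then show ?case using Suc by (metis mult.assoc power_Suc)
  qed simp
  have prod: "norm (w ^ k * (y * star y)) \<le> M * t ^ k" for k
  proof -
    have "w ^ k * (y * star y) = y * h ^ k * star y"
      unfolding wy[symmetric] by (rule mult.assoc[symmetric])
    also have "norm \<dots> \<le> norm (y * h ^ k) * norm y"
      using norm_mult_ineq[of "y * h ^ k" "star y"] by simp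
    also have "\<dots> \<le> norm y * norm (h ^ k) * norm y"
      by (intro mult_right_mono norm_mult_ineq) auto
    also have "\<dots> \<le> norm y * t ^ k * norm y"
      using t by (intro mult_right_mono mult_left_mono order_trans[OF norm_power_ineq] power_mono)
        (auto simp: h_def)
    finally show ?thesis by (simp add: M_def algebra_simps)
  qed
  \<comment> \<open>Expanding one factor at a time adds only a term of order \<open>t ^ k\<close>;
    the excess over \<open>t ^ k\<close> thus grows linearly in \<open>k\<close>, which disappears
    in the spectral radius.\<close>
  have wk: "norm (w ^ k) \<le> t ^ k * (1 + k * (M / t))" for k
  proof (induction k)
    case (Suc k)
    have "w ^ Suc k = t *\<^sub>R w ^ k + w ^ k * (y * star y)"
      by (subst power_Suc2) (simp add: w_def distrib_left)
    then have "norm (w ^ Suc k) \<le> t * norm (w ^ k) + M * t ^ k"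
      using norm_triangle_ineq[of "t *\<^sub>R w ^ k" "w ^ k * (y * star y)"] prod[of k] t by simp
    also have "\<dots> \<le> t * (t ^ k * (1 + k * (M / t))) + M * t ^ k"
      using Suc t by (intro add_right_mono mult_left_mono) auto
    also have "\<dots> = t ^ Suc k * (1 + Suc k * (M / t))" using t by (simp add: field_simps)
    finally show ?case .
  qed simp
  have sw: "star w = w" by (simp add: w_def star_add star_scaleR star_mult star_star)
  have "norm w / t \<le> 1"
  proof (rule le_one_if_power2_linear_bound[where c="M / t"])
    fix j :: nat
    have "norm w ^ (2 ^ j) \<le> t ^ (2 ^ j) * (1 + 2 ^ j * (M / t))"
      using wk[of "2 ^ j"] norm_selfadjoint_power[OF sw, of j] by simp
    then show "(norm w / t) ^ (2 ^ j) \<le> 1 + 2 ^ j * (M / t)"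
      using t by (simp add: power_divide divide_simps mult.commute)
  qed (use t in auto)
  then show ?thesis using t by (simp add: w_def)
qed

lemma cpos_minus_swap:
  fixes y :: "'a::{cstar_algebra,real_normed_algebra_1}"
  assumes "cpos (- (star y * y))" shows "cpos (- (y * star y))"
proof -
  obtain t where t: "t > 0" "norm (t *\<^sub>R 1 - - (star y * y)) \<le> t" using assms by (rule cpos_obtain)
  then have "norm (t *\<^sub>R 1 + y * star y) \<le> t" by (intro norm_shift_swap) auto
  with t show ?thesis unfolding cpos_def
    by (intro conjI exI[of _ t]) (auto simp: star_minus star_mult star_star)
qed

lemma square_eq_0_selfadjoint:
  fixes k :: "'a::cstar_algebra" shows "star k = k \<Longrightarrow> k * k = 0 \<Longrightarrow> k = 0"
  using norm_selfadjoint_square[of k] by simp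

text \<open>Up to real factors \<open>u\<close> and \<open>v\<close> are the real and imaginary
  parts of \<open>y\<close>. Their squares add up to \<open>2 (star y * y + y * star y)\<close>,
  which is both positive and, by \<open>cpos_minus_swap\<close>, negative.\<close>

lemma cpos_minus_star_mult_self:
  fixes y :: "'a::{cstar_algebra,real_normed_algebra_1}"
  assumes "cpos (- (star y * y))" shows "y = 0"
proof -
  define u v where "u = y + star y" and "v = \<i> *\<^sub>C (y - star y)"
  have s1: "star u = u" by (simp add: u_def star_add star_star add.commute)
  have "star v = - (\<i> *\<^sub>C (star y - y))"
    by (simp add: v_def star_scaleC star_diff star_star cvs.scale_minus_left)
  also have "\<dots> = v" unfolding v_def by (simp flip: cvs.scale_minus_right)
  finally have s2: "star v = v" .
  note s = s1 s2
  have vv: "v * v = - ((y - star y) * (y - star y))"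
    by (simp add: v_def mult_scaleC_left mult_scaleC_right scaleC_scaleC scaleC_minus_one)
  have sum: "u * u + v * v = 2 *\<^sub>R (star y * y + y * star y)"
    unfolding vv by (simp add: u_def algebra_simps scaleR_2)
  have "cpos (2 *\<^sub>R (- (star y * y) + - (y * star y)))"
    using assms by (intro cpos_scaleR cpos_add cpos_minus_swap) auto
  then have "cpos (- (u * u + v * v))" unfolding sum by (simp add: algebra_simps)
  then have "cpos (- (u * u + v * v) + v * v)" using s by (intro cpos_add cpos_square)
  then have "cpos (- (u * u))" by simp
  then have "u * u = 0" using s by (intro cpos_antisym cpos_square)
  then have u: "u = 0" by (rule square_eq_0_selfadjoint[OF s1])
  have "cpos (- (v * v))" using \<open>cpos (- (u * u + v * v))\<close> unfolding u by simp
  then have "v * v = 0" using s by (intro cpos_antisym cpos_square)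
  then have v: "v = 0" by (rule square_eq_0_selfadjoint[OF s2])
  have "\<i> *\<^sub>C v = - (y - star y)" by (simp add: v_def scaleC_scaleC scaleC_minus_one)
  then have "2 *\<^sub>R y = u - \<i> *\<^sub>C v" by (simp add: u_def scaleR_2)
  then show ?thesis using u v by simp
qed

text \<open>With \<open>h = x\<^sup>* x\<close> and \<open>g = \<bar>h\<bar> - h\<close> one has \<open>g h = - \<bar>h\<bar> g\<close>, so \<open>(x g)\<^sup>* (x g)\<close> is negative and
  hence vanishes.\<close>

lemma cpos_star_mult_self:
  fixes x :: "'a::{cstar_algebra,real_normed_algebra_1}"
  shows "cpos (star x * x)"
proof -
  define h where "h = star x * x"
  have sh: "star h = h" by (simp add: h_def star_mult star_star)
  obtain b where b: "cpos b" "b * b = h * h" "\<And>z. z * (h * h) = (h * h) * z \<Longrightarrow> z * b = b * z"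
    using cpos_sqrt[OF cpos_square[OF sh]] by metis
  have sb: "star b = b" using b(1) by (simp add: cpos_def)
  have hb: "h * b = b * h" by (rule b(3)) (simp add: mult.assoc)
  obtain c where c: "cpos c" "c * c = b" "\<And>z. z * b = b * z \<Longrightarrow> z * c = c * z"
    using cpos_sqrt[OF b(1)] by metis
  have sc: "star c = c" using c(1) by (simp add: cpos_def)
  define g where "g = b - h"
  have sg: "star g = g" by (simp add: g_def star_diff sb sh)
  have gb: "g * b = b * g" by (simp add: g_def algebra_simps hb)
  have gc: "g * c = c * g" by (rule c(3)) (rule gb)
  have gh: "g * h = - (b * g)" by (simp add: g_def algebra_simps hb b(2))
  define k where "k = c * g"
  have sk: "star k = k" by (simp add: k_def star_mult sc sg gc)
  have kk: "k * k = b * (g * g)" using gc c(2) by (simp add: k_def) (metis mult.assoc)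
  have "star (x * g) * (x * g) = g * h * g" by (simp add: star_mult sg h_def mult.assoc)
  also have "\<dots> = - (k * k)" by (simp add: gh kk mult.assoc)
  finally have eq: "star (x * g) * (x * g) = - (k * k)" .
  then have "cpos (- (star (x * g) * (x * g)))" using cpos_square[OF sk] by simp
  then have "x * g = 0" by (rule cpos_minus_star_mult_self)
  then have "k * k = 0" using eq by simp
  then have bgg: "b * (g * g) = 0" by (simp add: kk)
  have "g * g * b = 0" using bgg gb by (metis mult.assoc)
  moreover have "g * (g * h) = - (b * (g * g))" by (simp add: gh) (metis gb mult.assoc)
  moreover have "g * g * g = g * g * b - g * (g * h)"
    by (subst (3) g_def) (simp add: right_diff_distrib mult.assoc)
  ultimately have "g * g * g = 0" using bgg by simp
  then have "(g * g) * (g * g) = 0" by (metis mult.assoc mult_zero_right mult_zero_left)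
  then have "g * g = 0" by (rule square_eq_0_selfadjoint[rotated]) (simp add: star_mult sg)
  then have "g = 0" by (rule square_eq_0_selfadjoint[OF sg])
  then show ?thesis using b(1) by (simp add: g_def h_def)
qed

text \<open>Scale \<open>a + b\<close> to norm \<open>1\<close>. Then \<open>1 - (a + b)\<close> is
  positive with \<open>t = 1\<close>, adding \<open>b\<close> gives \<open>1 - a\<close> positive,
  and \<open>cpos_le_one\<close> applies.\<close>

lemma cpos_norm_mono:
  fixes a b :: "'a::{cstar_algebra,real_normed_algebra_1}"
  assumes a: "cpos a" and b: "cpos b" shows "norm a \<le> norm (a + b)"
proof (cases "a + b = 0")
  case True
  then have "b = - a" by (simp add: eq_neg_iff_add_eq_0 add.commute)
  with a b have "a = 0" by (intro cpos_antisym) auto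
  then show ?thesis by simp
next
  case False
  define r where "r = 1 / norm (a + b)"
  have r: "r > 0" "norm (r *\<^sub>R (a + b)) = 1" using False by (auto simp: r_def)
  have "cpos (r *\<^sub>R (a + b))" using a b r by (intro cpos_scaleR cpos_add) auto
  then have "cpos (1 - r *\<^sub>R (a + b))"
    using r unfolding cpos_def by (intro conjI exI[of _ 1]) (auto simp: star_diff)
  moreover have "cpos (r *\<^sub>R b)" using b r by (intro cpos_scaleR) auto
  ultimately have "cpos (1 - r *\<^sub>R (a + b) + r *\<^sub>R b)" by (rule cpos_add)
  then have "cpos (1 - r *\<^sub>R a)" by (simp add: algebra_simps)
  then have "norm (r *\<^sub>R a) \<le> 1" using a r by (intro cpos_le_one cpos_scaleR) auto
  then show ?thesis using r False by (simp add: r_def field_simps)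
qed

section \<open>Unitization and the Cauchy-Schwarz inequality\<close>

datatype 'a unitization = Unitization (scal: complex) (vect: 'a)

instantiation unitization :: (cstar_algebra) real_vector
begin
definition "0 = Unitization 0 0"
definition "x + y = Unitization (scal x + scal y) (vect x + vect y)"
definition "x - y = Unitization (scal x - scal y) (vect x - vect y)"
definition "- x = Unitization (- scal x) (- vect x)"
definition "r *\<^sub>R x = Unitization (complex_of_real r * scal x) (complex_of_real r *\<^sub>C vect x)"
instance
  by standard (auto simp: zero_unitization_def plus_unitization_def minus_unitization_def
      uminus_unitization_def scaleR_unitization_def algebra_simps scaleC_add_right scaleC_add_left
      scaleC_scaleC)
end

instantiation unitization :: (cstar_algebra) real_algebra_1
begin
definition "1 = Unitization 1 0"
definition "x * y = Unitization (scal x * scal y) (scal x *\<^sub>C vect y + scal y *\<^sub>C vect x + vect x * vect y)"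
instance
  by standard (auto simp: zero_unitization_def plus_unitization_def one_unitization_def
      times_unitization_def scaleR_unitization_def algebra_simps scaleC_add_right scaleC_add_left
      scaleC_scaleC mult_scaleC_left mult_scaleC_right)
end

lemmas unitization_ops = zero_unitization_def plus_unitization_def minus_unitization_def
  uminus_unitization_def scaleR_unitization_def one_unitization_def times_unitization_def

definition left_mult :: "'a unitization \<Rightarrow> 'a \<Rightarrow> 'a::cstar_algebra" where
  "left_mult x z = scal x *\<^sub>C z + vect x * z"

lemma bounded_linear_left_mult: "bounded_linear (left_mult x)"
proof (rule bounded_linear_intro[where K="cmod (scal x) + norm (vect x)"])
  show "norm (left_mult x z) \<le> norm z * (cmod (scal x) + norm (vect x))" for z
    unfolding left_mult_def using norm_mult_ineq[of "vect x" z]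
    by (intro order_trans[OF norm_triangle_ineq]) (auto simp: norm_scaleC algebra_simps)
  show "left_mult x (r *\<^sub>R z) = r *\<^sub>R left_mult x z" for r z
    unfolding scaleC_of_real[symmetric]
    by (simp add: left_mult_def scaleC_add_right scaleC_scaleC mult_scaleC_right mult.commute)
qed (auto simp: left_mult_def scaleC_add_right distrib_left)

lemma left_mult_mult: "left_mult (x * y) z = left_mult x (left_mult y z)"
  by (simp add: left_mult_def unitization_ops algebra_simps scaleC_add_right
      scaleC_scaleC mult_scaleC_left mult_scaleC_right)

lemma left_mult_add: "left_mult (x + y) z = left_mult x z + left_mult y z"
  by (simp add: left_mult_def unitization_ops algebra_simps scaleC_add_left)

text \<open>If \<open>'a\<close> is unital then left multiplication is not faithful on the unitization; the
  modulus of the scalar part makes the norm definite in that case.\<close>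

instantiation unitization :: (cstar_algebra) real_normed_algebra_1
begin
definition "norm x = max (cmod (scal x)) (onorm (left_mult x))"
definition "sgn (x :: 'a unitization) = x /\<^sub>R norm x"
definition "dist (x :: 'a unitization) y = norm (x - y)"
definition [code del]: "uniformity = (INF e\<in>{0<..}. principal {(x, y :: 'a unitization). dist x y < e})"
definition [code del]: "open (U :: 'a unitization set) \<longleftrightarrow> (\<forall>x\<in>U. eventually (\<lambda>(x', y). x' = x \<longrightarrow> y \<in> U) uniformity)"
instance
proof
  fix x y :: "'a unitization" and r :: real
  show "(norm x = 0) = (x = 0)"
  proof
    assume "norm x = 0"
    then have "cmod (scal x) \<le> 0" "onorm (left_mult x) \<le> 0" by (auto simp: norm_unitization_def max_def split: if_splits)
    then have "scal x = 0" "\<forall>z. left_mult x z = 0"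
      using onorm_eq_0[OF bounded_linear_left_mult, of x] onorm_pos_le[OF bounded_linear_left_mult, of x] by auto
    then have "vect x * star (vect x) = 0" by (auto simp: left_mult_def)
    then have "vect x = 0" using norm_mult_star[of "vect x"] by simp
    with \<open>scal x = 0\<close> show "x = 0" by (simp add: unitization_ops unitization.expand)
  next
    assume "x = 0"
    then have "left_mult x = (\<lambda>z. 0)" "scal x = 0" by (auto simp: unitization_ops left_mult_def)
    then show "norm x = 0" by (simp add: norm_unitization_def onorm_zero)
  qed
  show "norm (x + y) \<le> norm x + norm y"
  proof -
    have "left_mult (x + y) = (\<lambda>z. left_mult x z + left_mult y z)" by (rule ext) (rule left_mult_add)
    then have "onorm (left_mult (x + y)) = onorm (\<lambda>z. left_mult x z + left_mult y z)" by simp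
    also have "\<dots> \<le> onorm (left_mult x) + onorm (left_mult y)"
      by (intro onorm_triangle bounded_linear_left_mult)
    finally show ?thesis using norm_triangle_ineq[of "scal x" "scal y"]
      by (auto simp: norm_unitization_def plus_unitization_def max_def)
  qed
  show "norm (r *\<^sub>R x) = \<bar>r\<bar> * norm x"
  proof -
    have "left_mult (r *\<^sub>R x) = (\<lambda>z. r *\<^sub>R left_mult x z)"
      unfolding scaleC_of_real[symmetric]
      by (auto simp: left_mult_def scaleR_unitization_def scaleC_add_right scaleC_scaleC mult_scaleC_left)
    then show ?thesis using onorm_scaleR[OF bounded_linear_left_mult, of r x]
      by (simp add: norm_unitization_def scaleR_unitization_def max_mult_distrib_left norm_mult)
  qed
  show "norm (x * y) \<le> norm x * norm y"
  proof -
    have "onorm (left_mult (x * y)) = onorm (left_mult x \<circ> left_mult y)"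
      by (simp add: o_def flip: left_mult_mult)
    also have "\<dots> \<le> onorm (left_mult x) * onorm (left_mult y)"
      by (intro onorm_compose bounded_linear_left_mult)
    also have "\<dots> \<le> norm x * norm y"
      by (intro mult_mono) (auto simp: norm_unitization_def onorm_pos_le bounded_linear_left_mult le_max_iff_disj)
    finally have 1: "onorm (left_mult (x * y)) \<le> norm x * norm y" .
    have "cmod (scal x * scal y) \<le> norm x * norm y"
      unfolding norm_mult by (intro mult_mono) (auto simp: norm_unitization_def le_max_iff_disj)
    with 1 show ?thesis unfolding norm_unitization_def[of "x * y"]
      by (simp add: times_unitization_def)
  qed
  show "norm (1 :: 'a unitization) = 1"
  proof -
    have "left_mult (1 :: 'a unitization) = (\<lambda>z. z)" by (auto simp: left_mult_def one_unitization_def)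
    then show ?thesis using onorm_id_le[where ?'a='a] by (simp add: norm_unitization_def one_unitization_def max_absorb1)
  qed
qed (auto simp: sgn_unitization_def dist_unitization_def uniformity_unitization_def open_unitization_def)
end

text \<open>Left multiplication by \<open>a\<close> attains its norm at \<open>star a\<close>, so
  the embedding into the unitization is isometric.\<close>

lemma norm_Unitization_0: "norm (Unitization 0 a) = norm (a::'a::cstar_algebra)"
proof -
  have "onorm (left_mult (Unitization 0 a)) \<le> norm a"
    by (rule onorm_bound) (auto simp: left_mult_def norm_mult_ineq)
  moreover have "norm a \<le> onorm (left_mult (Unitization 0 a))"
  proof (cases "a = 0")
    case False
    have "norm a * norm a \<le> onorm (left_mult (Unitization 0 a)) * norm a"
      using onorm[OF bounded_linear_left_mult, of "Unitization 0 a" "star a"] norm_mult_star[of a]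
      by (simp add: left_mult_def power2_eq_square)
    with False show ?thesis by simp
  qed (auto intro: onorm_pos_le bounded_linear_left_mult)
  ultimately show ?thesis by (simp add: norm_unitization_def)
qed


lemma norm_Unitization_scal: "norm (Unitization c (0::'a::cstar_algebra)) = cmod c"
proof -
  have "onorm (left_mult (Unitization c (0::'a))) \<le> cmod c"
    by (rule onorm_bound) (auto simp: left_mult_def norm_scaleC)
  then show ?thesis by (simp add: norm_unitization_def)
qed

lemma norm_unitization_le: "norm x \<le> cmod (scal x) + norm (vect x :: 'a::cstar_algebra)"
proof -
  have "x = Unitization (scal x) 0 + Unitization 0 (vect x)"
    by (simp add: plus_unitization_def)
  then show ?thesis using norm_triangle_ineq norm_Unitization_0 norm_Unitization_scal by metis
qed

lemma cmod_scal_le: "cmod (scal x) \<le> norm (x :: 'a::cstar_algebra unitization)"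
  by (simp add: norm_unitization_def)

lemma norm_vect_le: "norm (vect x) \<le> 2 * norm (x :: 'a::cstar_algebra unitization)"
proof -
  have "norm (vect x) = norm (x - Unitization (scal x) 0)"
    by (simp add: norm_Unitization_0 minus_unitization_def)
  also have "\<dots> \<le> norm x + cmod (scal x)"
    using norm_triangle_ineq4[of x "Unitization (scal x) 0"] by (simp add: norm_Unitization_scal)
  finally show ?thesis using cmod_scal_le[of x] by simp
qed

instance unitization :: (cstar_algebra) banach
proof
  fix X :: "nat \<Rightarrow> 'a unitization"
  assume X: "Cauchy X"
  have "Cauchy (\<lambda>n. scal (X n))"
  proof (rule CauchyI)
    fix e :: real assume "e > 0"
    then obtain M where "\<forall>m\<ge>M. \<forall>n\<ge>M. norm (X m - X n) < e" using CauchyD[OF X] by blast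
    moreover have "norm (scal (X m) - scal (X n)) \<le> norm (X m - X n)" for m n
      using cmod_scal_le[of "X m - X n"] by (simp add: minus_unitization_def)
    ultimately show "\<exists>M. \<forall>m\<ge>M. \<forall>n\<ge>M. norm (scal (X m) - scal (X n)) < e"
      using le_less_trans by blast
  qed
  then obtain c where c: "(\<lambda>n. scal (X n)) \<longlonglongrightarrow> c" using Cauchy_convergent convergent_def by blast
  have "Cauchy (\<lambda>n. vect (X n))"
  proof (rule CauchyI)
    fix e :: real assume "e > 0"
    then obtain M where M: "\<forall>m\<ge>M. \<forall>n\<ge>M. norm (X m - X n) < e / 2" using CauchyD[OF X, of "e / 2"] by auto
    have "norm (vect (X m) - vect (X n)) < e" if "m \<ge> M" "n \<ge> M" for m n
    proof -
      have "norm (X m - X n) < e / 2" using M that by blast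
      then show ?thesis using norm_vect_le[of "X m - X n"] by (simp add: minus_unitization_def)
    qed
    then show "\<exists>M. \<forall>m\<ge>M. \<forall>n\<ge>M. norm (vect (X m) - vect (X n)) < e" by blast
  qed
  then obtain a where a: "(\<lambda>n. vect (X n)) \<longlonglongrightarrow> a" using Cauchy_convergent convergent_def by blast
  have "(\<lambda>n. X n - Unitization c a) \<longlonglongrightarrow> 0"
  proof (rule tendsto_0_le[where K=1])
    show "\<forall>\<^sub>F n in sequentially. norm (X n - Unitization c a) \<le> norm (cmod (scal (X n) - c) + norm (vect (X n) - a)) * 1"
      using norm_unitization_le[of "X n - Unitization c a" for n]
      by (intro always_eventually allI) (auto simp: minus_unitization_def)
    have "(\<lambda>n. cmod (scal (X n) - c) + norm (vect (X n) - a)) \<longlonglongrightarrow> cmod (c - c) + norm (a - a)"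
      by (intro tendsto_intros a c)
    then show "(\<lambda>n. cmod (scal (X n) - c) + norm (vect (X n) - a)) \<longlonglongrightarrow> 0" by simp
  qed
  then have "X \<longlonglongrightarrow> Unitization c a" by (rule LIM_zero_cancel)
  then show "convergent X" by (auto simp: convergent_def)
qed

instantiation unitization :: (cstar_algebra) cstar_algebra
begin
definition "c *\<^sub>C x = Unitization (c * scal x) (c *\<^sub>C vect x)"
definition "star x = Unitization (cnj (scal x)) (star (vect x))"
instance
proof
  fix x y :: "'a unitization" and c d :: complex and r :: real
  note defs = unitization_ops scaleC_unitization_def star_unitization_def
  show "c *\<^sub>C (x + y) = c *\<^sub>C x + c *\<^sub>C y" "(c + d) *\<^sub>C x = c *\<^sub>C x + d *\<^sub>C x"
    "c *\<^sub>C d *\<^sub>C x = (c * d) *\<^sub>C x"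
    by (auto simp: defs scaleC_add_right scaleC_add_left scaleC_scaleC algebra_simps)
  show "complex_of_real r *\<^sub>C x = r *\<^sub>R x"
    by (auto simp: defs scaleC_of_real scaleR_conv_of_real)
  show "c *\<^sub>C x * y = c *\<^sub>C (x * y)" "x * c *\<^sub>C y = c *\<^sub>C (x * y)"
    by (auto simp: defs scaleC_add_right scaleC_scaleC mult_scaleC_left mult_scaleC_right algebra_simps)
  show "star (x + y) = star x + star y" "star (c *\<^sub>C x) = cnj c *\<^sub>C star x"
    "star (x * y) = star y * star x" "star (star x) = x"
    by (auto simp: defs star_add star_scaleC star_mult star_star algebra_simps)
  have le: "norm (c *\<^sub>C x) \<le> cmod c * norm x" for c and x :: "'a unitization"
    using norm_mult_ineq[of "Unitization c 0" x] by (simp add: norm_Unitization_scal defs)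
  show "norm (c *\<^sub>C x) = cmod c * norm x"
  proof (cases "c = 0")
    case True
    then show ?thesis using le[of c x] by simp
  next
    case False
    have "inverse c *\<^sub>C c *\<^sub>C x = x" using False by (simp add: defs scaleC_scaleC flip: mult.assoc)
    then have "norm x \<le> inverse (cmod c) * norm (c *\<^sub>C x)"
      using le[of "inverse c" "c *\<^sub>C x"] by (simp add: norm_inverse)
    then show ?thesis using False le[of c x] by (simp add: field_simps)
  qed
  \<comment> \<open>For the scalar part \<open>star x * x\<close> has scalar part of modulus
    \<open>(cmod (scal x))^2\<close>; for the operator part the C*-identity is used on the vectors
    \<open>left_mult x z\<close> of the original algebra.\<close>
  have sq: "(norm x)\<^sup>2 \<le> norm (star x * x)" for x :: "'a unitization"
  proof -
    let ?N = "norm (star x * x)"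
    have 1: "cmod (scal x) \<le> sqrt ?N"
      using cmod_scal_le[of "star x * x"]
      by (intro real_le_rsqrt) (simp add: defs norm_mult power2_eq_square)
    have "onorm (left_mult x) \<le> sqrt ?N"
    proof (rule onorm_bound)
      fix z
      have "star (left_mult x z) * w = star z * left_mult (star x) w" for w
        by (simp add: left_mult_def star_add star_scaleC star_mult defs algebra_simps mult_scaleC_left mult_scaleC_right)
      then have "(norm (left_mult x z))\<^sup>2 = norm (star z * left_mult (star x * x) z)"
        by (simp add: left_mult_mult flip: cstar_identity)
      also have "\<dots> \<le> norm z * (onorm (left_mult (star x * x)) * norm z)"
        using onorm[OF bounded_linear_left_mult, of "star x * x" z]
        by (intro order_trans[OF norm_mult_ineq]) (auto intro: mult_left_mono)
      also have "\<dots> \<le> norm z * (?N * norm z)"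
        by (intro mult_left_mono mult_right_mono) (auto simp: norm_unitization_def)
      also have "\<dots> = (sqrt ?N * norm z)\<^sup>2" by (simp add: power2_eq_square algebra_simps)
      finally show "norm (left_mult x z) \<le> sqrt ?N * norm z"
        by (rule power2_le_imp_le) auto
    qed auto
    with 1 have "norm x \<le> sqrt ?N" by (simp add: norm_unitization_def[of x])
    then show ?thesis by (metis norm_ge_zero power_mono real_sqrt_pow2)
  qed
  have ss: "star (star x) = x" for x :: "'a unitization" by (simp add: defs star_star)
  have "norm x \<le> norm (star x)" for x :: "'a unitization"
  proof (cases "x = 0")
    case False
    have "norm x * norm x \<le> norm (star x) * norm x"
      using sq[of x] norm_mult_ineq[of "star x" x] by (simp add: power2_eq_square)
    with False show ?thesis by simp
  qed simp
  from this[of x] this[of "star x"] have "norm (star x) = norm x" by (simp add: ss)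
  then have "norm (star x * x) \<le> (norm x)\<^sup>2" using norm_mult_ineq[of "star x" x] by (simp add: power2_eq_square)
  with sq[of x] show "norm (star x * x) = (norm x)\<^sup>2" by simp
qed
end

text \<open>Positivity is only defined with a unit, so the sums are moved isometrically into the
  unitization.\<close>

lemma norm_sum_star_mult_mono:
  fixes f :: "'i \<Rightarrow> 'a::cstar_algebra"
  assumes "finite J" "I \<subseteq> J"
  shows "norm (\<Sum>i\<in>I. star (f i) * f i) \<le> norm (\<Sum>i\<in>J. star (f i) * f i)"
proof -
  let ?u = "Unitization 0 :: 'a \<Rightarrow> _"
  have u0: "?u 0 = 0" and ua: "\<And>a b. ?u (a + b) = ?u a + ?u b"
    and um: "\<And>a. ?u (star a * a) = star (?u a) * ?u a"
    by (auto simp: unitization_ops star_unitization_def)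
  have u: "?u (\<Sum>i\<in>K. star (f i) * f i) = (\<Sum>i\<in>K. star (?u (f i)) * ?u (f i))" for K
    by (induction K rule: infinite_finite_induct) (simp_all add: u0 ua um)
  have cp: "cpos (\<Sum>i\<in>K. star (?u (f i)) * ?u (f i))" for K
    by (induction K rule: infinite_finite_induct) (auto intro: cpos_add cpos_star_mult_self)
  have "(\<Sum>i\<in>J. star (?u (f i)) * ?u (f i)) = (\<Sum>i\<in>I. star (?u (f i)) * ?u (f i)) + (\<Sum>i\<in>J-I. star (?u (f i)) * ?u (f i))"
    using assms by (subst sum.subset_diff[of I J]) (auto simp: add.commute)
  then have "norm (\<Sum>i\<in>I. star (?u (f i)) * ?u (f i)) \<le> norm (\<Sum>i\<in>J. star (?u (f i)) * ?u (f i))"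
    using cpos_norm_mono[OF cp[of I] cp[of "J - I"]] by simp
  then show ?thesis by (simp add: norm_Unitization_0 flip: u)
qed

lemma norm_star_mult_le_add:
  fixes x :: "'a::cstar_algebra"
  assumes "finite I"
  shows "(norm x)\<^sup>2 \<le> norm (star x * x + (\<Sum>i\<in>I. star (f i) * f i))"
proof -
  \<comment> \<open>The extra square is adjoined under the fresh index \<open>None\<close>, which
    reduces the claim to monotonicity in the index set.\<close>
  let ?g = "case_option x f"
  have "norm (\<Sum>i\<in>{None}. star (?g i) * ?g i) \<le> norm (\<Sum>i\<in>insert None (Some ` I). star (?g i) * ?g i)"
    using assms by (intro norm_sum_star_mult_mono) auto
  also have "(\<Sum>i\<in>insert None (Some ` I). star (?g i) * ?g i) = star x * x + (\<Sum>i\<in>I. star (f i) * f i)"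
    using assms by (subst sum.insert) (auto simp: sum.reindex)
  finally show ?thesis by (simp add: cstar_identity)
qed

text \<open>For \<open>z = \<langle>w, v\<rangle>\<close> and \<open>a = \<langle>w, w\<rangle>\<close> with \<open>\<parallel>a\<parallel> \<le> 1\<close>:
  \<open>\<langle>v, v\<rangle> = z\<^sup>* z + z\<^sup>* (1 - a) z + \<langle>v - w z, v - w z\<rangle>\<close>.\<close>

lemma cstar_Cauchy_Schwarz:
  fixes v w :: "'i \<Rightarrow> 'a::cstar_algebra"
  assumes "finite I"
  shows "(norm (\<Sum>i\<in>I. star (w i) * v i))\<^sup>2
    \<le> norm (\<Sum>i\<in>I. star (w i) * w i) * norm (\<Sum>i\<in>I. star (v i) * v i)"
proof -
  have main: "(norm (\<Sum>i\<in>I. star (w i) * v i))\<^sup>2 \<le> norm (\<Sum>i\<in>I. star (v i) * v i)"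
    if "norm (\<Sum>i\<in>I. star (w i) * w i) \<le> 1" for w :: "'i \<Rightarrow> 'a"
  proof -
    define a where "a = (\<Sum>i\<in>I. star (w i) * w i)"
    define z where "z = (\<Sum>i\<in>I. star (w i) * v i)"
    have sa: "star a = a" by (simp add: a_def star_sum star_mult star_star)
    from that have "norm a \<le> 1" by (simp add: a_def)
    \<comment> \<open>Since \<open>(1 - y)^2 = 1 - a\<close>, the term \<open>z^* (1 - a) z\<close>
      is the square of \<open>z - y * z\<close>; every summand but \<open>z^* z\<close> is then of
      the form \<open>star u * u\<close>, and no unit is mentioned.\<close>
    then obtain y where y: "y + y - y * y = a" "star y = y" using quasi_sqrt[of a] sa by metis
    have yz: "star (z - y * z) * (z - y * z) = star z * z - star z * a * z"
      by (simp add: star_diff star_mult y(2) algebra_simps flip: y(1))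
    have vz: "(\<Sum>i\<in>I. star (v i) * w i) = star z" by (simp add: z_def star_sum star_mult star_star)
    have "(\<Sum>i\<in>I. star (v i - w i * z) * (v i - w i * z))
      = (\<Sum>i\<in>I. star (v i) * v i - star (v i) * w i * z - star z * (star (w i) * v i)
          + star z * (star (w i) * w i) * z)"
      by (intro sum.cong) (simp_all add: star_diff star_mult algebra_simps)
    also have "\<dots> = (\<Sum>i\<in>I. star (v i) * v i) - (\<Sum>i\<in>I. star (v i) * w i) * z
        - star z * (\<Sum>i\<in>I. star (w i) * v i) + star z * a * z"
      by (simp add: sum_subtractf sum.distrib sum_distrib_left sum_distrib_right a_def)
    also have "(\<Sum>i\<in>I. star (w i) * v i) = z" by (simp add: z_def)
    finally have "(\<Sum>i\<in>I. star (v i - w i * z) * (v i - w i * z))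
      = (\<Sum>i\<in>I. star (v i) * v i) - (\<Sum>i\<in>I. star (v i) * w i) * z - star z * z + star z * a * z" .
    then have "(\<Sum>i\<in>I. star (v i) * v i)
      = star z * z + (star (z - y * z) * (z - y * z) + (\<Sum>i\<in>I. star (v i - w i * z) * (v i - w i * z)))"
      by (simp add: vz yz)
    also have "(star (z - y * z) * (z - y * z) + (\<Sum>i\<in>I. star (v i - w i * z) * (v i - w i * z)))
      = (\<Sum>j\<in>insert None (Some ` I). star (case_option (z - y * z) (\<lambda>i. v i - w i * z) j)
          * case_option (z - y * z) (\<lambda>i. v i - w i * z) j)"
      using assms by (subst sum.insert) (auto simp: sum.reindex)
    finally show ?thesis
      using norm_star_mult_le_add[of "insert None (Some ` I)" z "case_option (z - y * z) (\<lambda>i. v i - w i * z)"] assms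
      by (simp add: z_def)
  qed
  define r where "r = sqrt (norm (\<Sum>i\<in>I. star (w i) * w i))"
  have r2: "r\<^sup>2 = norm (\<Sum>i\<in>I. star (w i) * w i)" "r \<ge> 0" by (simp_all add: r_def)
  show ?thesis
  proof (cases "r = 0")
    case True
    have "w i = 0" if "i \<in> I" for i
    proof -
      have "norm (\<Sum>i\<in>{i}. star (w i) * w i) \<le> norm (\<Sum>i\<in>I. star (w i) * w i)"
        using assms that by (intro norm_sum_star_mult_mono) auto
      then show ?thesis using True r2(1) by (simp add: cstar_identity)
    qed
    then show ?thesis by simp
  next
    case False
    define w' where "w' i = (1 / r) *\<^sub>R w i" for i
    have "(\<Sum>i\<in>I. star (w' i) * w' i) = (1 / r\<^sup>2) *\<^sub>R (\<Sum>i\<in>I. star (w i) * w i)"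
      by (simp add: w'_def star_scaleR scaleR_sum_right power2_eq_square)
    then have "norm (\<Sum>i\<in>I. star (w' i) * w' i) \<le> 1" using False r2(1) by simp
    from main[OF this] have "(norm (\<Sum>i\<in>I. star (w' i) * v i))\<^sup>2 \<le> norm (\<Sum>i\<in>I. star (v i) * v i)" .
    also have "(\<Sum>i\<in>I. star (w' i) * v i) = (1 / r) *\<^sub>R (\<Sum>i\<in>I. star (w i) * v i)"
      by (simp add: w'_def star_scaleR scaleR_sum_right)
    finally show ?thesis using False r2(2) unfolding r2(1)[symmetric]
      by (simp add: power_divide divide_le_eq mult.commute)
  qed
qed

section \<open>The C*-norm on matrices\<close>

text \<open>The norm of the Hilbert module \<open>A^n\<close> over \<open>A\<close>, whose inner
  product takes values in \<open>A\<close>.\<close>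

definition hnorm :: "nat \<Rightarrow> (nat \<Rightarrow> 'a::cstar_algebra) \<Rightarrow> real" where
  "hnorm n v = sqrt (norm (\<Sum>i<n. star (v i) * v i))"

definition mat_app :: "nat \<Rightarrow> 'a::cstar_algebra mat \<Rightarrow> (nat \<Rightarrow> 'a) \<Rightarrow> nat \<Rightarrow> 'a" where
  "mat_app n X v i = (\<Sum>j<n. X $$ (i, j) * v j)"

abbreviation mat_star :: "'a::cstar_algebra mat \<Rightarrow> 'a mat" where
  "mat_star X \<equiv> transpose_mat (map_mat star X)"

lemma hnorm_nonneg [simp]: "hnorm n v \<ge> 0" by (simp add: hnorm_def)

lemma hnorm_sq: "(hnorm n v)\<^sup>2 = norm (\<Sum>i<n. star (v i) * v i)" by (simp add: hnorm_def)

lemma hnorm_cong: "(\<And>i. i < n \<Longrightarrow> v i = w i) \<Longrightarrow> hnorm n v = hnorm n w"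
  unfolding hnorm_def by (intro arg_cong[where f="\<lambda>x. sqrt (norm x)"] sum.cong) auto

lemma norm_inner_le_hnorm: "norm (\<Sum>i<n. star (w i) * v i) \<le> hnorm n w * hnorm n v"
proof (rule power2_le_imp_le)
  show "(norm (\<Sum>i<n. star (w i) * v i))\<^sup>2 \<le> (hnorm n w * hnorm n v)\<^sup>2"
    unfolding power_mult_distrib hnorm_sq by (rule cstar_Cauchy_Schwarz) simp
qed simp

lemma hnorm_triangle: "hnorm n (\<lambda>i. v i + w i) \<le> hnorm n v + hnorm n w"
proof (rule power2_le_imp_le)
  have "(\<Sum>i<n. star (v i + w i) * (v i + w i)) = ((\<Sum>i<n. star (v i) * v i) + (\<Sum>i<n. star (v i) * w i))
     + ((\<Sum>i<n. star (w i) * v i) + (\<Sum>i<n. star (w i) * w i))"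
    by (simp add: star_add distrib_left distrib_right sum.distrib)
  then have "(hnorm n (\<lambda>i. v i + w i))\<^sup>2 \<le> (norm (\<Sum>i<n. star (v i) * v i) + norm (\<Sum>i<n. star (v i) * w i))
     + (norm (\<Sum>i<n. star (w i) * v i) + norm (\<Sum>i<n. star (w i) * w i))"
    unfolding hnorm_sq by (simp only:) (intro order_trans[OF norm_triangle_ineq] add_mono norm_triangle_ineq)
  also have "\<dots> \<le> ((hnorm n v)\<^sup>2 + hnorm n v * hnorm n w) + (hnorm n w * hnorm n v + (hnorm n w)\<^sup>2)"
    unfolding hnorm_sq[symmetric] by (intro add_mono norm_inner_le_hnorm order_refl)
  finally have "(hnorm n (\<lambda>i. v i + w i))\<^sup>2 \<le> ((hnorm n v)\<^sup>2 + hnorm n v * hnorm n w) + (hnorm n w * hnorm n v + (hnorm n w)\<^sup>2)" .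
  then show "(hnorm n (\<lambda>i. v i + w i))\<^sup>2 \<le> (hnorm n v + hnorm n w)\<^sup>2"
    by (simp add: power2_eq_square algebra_simps)
qed simp

lemma hnorm_scaleC: "hnorm n (\<lambda>i. c *\<^sub>C v i) = cmod c * hnorm n v"
proof -
  have "(\<Sum>i<n. star (c *\<^sub>C v i) * (c *\<^sub>C v i)) = (c * cnj c) *\<^sub>C (\<Sum>i<n. star (v i) * v i)"
    by (simp add: star_scaleC mult_scaleC_left mult_scaleC_right scaleC_scaleC cvs.scale_sum_right mult.commute)
  then show ?thesis unfolding hnorm_def by (simp add: norm_scaleC real_sqrt_mult norm_mult)
qed

lemma norm_le_hnorm: assumes "i < n" shows "norm (v i) \<le> hnorm n v"
proof (rule power2_le_imp_le)
  have "norm (\<Sum>i\<in>{i}. star (v i) * v i) \<le> norm (\<Sum>i<n. star (v i) * v i)"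
    using assms by (intro norm_sum_star_mult_mono) auto
  then show "(norm (v i))\<^sup>2 \<le> (hnorm n v)\<^sup>2" by (simp add: hnorm_sq cstar_identity)
qed simp

lemma hnorm_zero [simp]: "hnorm n (\<lambda>i. 0) = 0" by (simp add: hnorm_def)

lemma hnorm_single: "k < n \<Longrightarrow> hnorm n (\<lambda>i. if i = k then a else 0) = norm a"
proof -
  assume "k < n"
  have "(\<Sum>i<n. star (if i = k then a else 0) * (if i = k then a else 0)) = (\<Sum>i<n. if i = k then star a * a else 0)"
    by (intro sum.cong) auto
  then show ?thesis using \<open>k < n\<close> by (simp add: hnorm_def cstar_identity)
qed

lemma hnorm_le_sum: "hnorm n v \<le> (\<Sum>i<n. norm (v i))"
proof (rule power2_le_imp_le)
  have "(hnorm n v)\<^sup>2 \<le> (\<Sum>i<n. norm (v i) * norm (v i))"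
    unfolding hnorm_sq using norm_mult_ineq[of "star (v i)" "v i" for i]
    by (intro order_trans[OF norm_sum] sum_mono) auto
  also have "\<dots> \<le> (\<Sum>i<n. norm (v i) * (\<Sum>i<n. norm (v i)))"
    by (intro sum_mono mult_left_mono member_le_sum) auto
  finally show "(hnorm n v)\<^sup>2 \<le> (\<Sum>i<n. norm (v i))\<^sup>2"
    by (simp add: power2_eq_square sum_distrib_right)
qed (simp add: sum_nonneg)

text \<open>A crude bound which makes the supremum that defines \<open>hmat_norm\<close>
  finite.\<close>

lemma hnorm_mat_app_le_sum:
  "hnorm n (mat_app n X v) \<le> (\<Sum>i<n. \<Sum>j<n. norm (X $$ (i, j))) * hnorm n v"
proof -
  have "hnorm n (mat_app n X v) \<le> (\<Sum>i<n. norm (mat_app n X v i))" by (rule hnorm_le_sum)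
  also have "\<dots> \<le> (\<Sum>i<n. \<Sum>j<n. norm (X $$ (i, j)) * hnorm n v)"
    unfolding mat_app_def
    by (intro sum_mono order_trans[OF norm_sum] order_trans[OF norm_mult_ineq] mult_left_mono norm_le_hnorm) auto
  finally show ?thesis by (simp add: sum_distrib_right)
qed

text \<open>The operator norm of a matrix acting on the Hilbert module \<open>A^n\<close>. It
  realises the C*-norm of \<open>M_n(A)\<close> without representing \<open>A\<close> on a Hilbert
  space.\<close>

definition hmat_norm :: "nat \<Rightarrow> 'a::cstar_algebra mat \<Rightarrow> real" where
  "hmat_norm n X = Sup {hnorm n (mat_app n X v) | v. hnorm n v \<le> 1}"

lemma mat_app_scaleC: "mat_app n X (\<lambda>i. c *\<^sub>C v i) = (\<lambda>i. c *\<^sub>C mat_app n X v i)"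
  by (simp add: mat_app_def mult_scaleC_right cvs.scale_sum_right fun_eq_iff)

lemma hnorm_mat_app_le: "hnorm n (mat_app n X v) \<le> hmat_norm n X * hnorm n v"
proof (cases "hnorm n v = 0")
  case True
  then show ?thesis using hnorm_mat_app_le_sum[of n X v] by simp
next
  case False
  then have pos: "hnorm n v > 0" by (simp add: less_le)
  define c where "c = complex_of_real (1 / hnorm n v)"
  have c: "cmod c = 1 / hnorm n v" unfolding c_def norm_of_real by simp
  have bdd: "bdd_above {hnorm n (mat_app n X v) | v. hnorm n v \<le> 1}"
  proof (rule bdd_aboveI)
    fix r assume "r \<in> {hnorm n (mat_app n X v) | v. hnorm n v \<le> 1}"
    then obtain u where u: "r = hnorm n (mat_app n X u)" "hnorm n u \<le> 1" by auto
    have "(\<Sum>i<n. \<Sum>j<n. norm (X $$ (i, j))) * hnorm n u \<le> (\<Sum>i<n. \<Sum>j<n. norm (X $$ (i, j))) * 1"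
      using u by (intro mult_left_mono sum_nonneg) auto
    with hnorm_mat_app_le_sum[of n X u] u show "r \<le> (\<Sum>i<n. \<Sum>j<n. norm (X $$ (i, j)))" by simp
  qed
  have "hnorm n (mat_app n X (\<lambda>i. c *\<^sub>C v i)) \<le> hmat_norm n X"
    unfolding hmat_norm_def
    by (rule cSup_upper[OF _ bdd]) (use pos c in \<open>auto simp: hnorm_scaleC intro!: exI[of _ "\<lambda>i. c *\<^sub>C v i"]\<close>)
  then show ?thesis using pos by (simp add: mat_app_scaleC hnorm_scaleC c field_simps)
qed

lemma hmat_norm_leI:
  assumes "\<And>v. hnorm n (mat_app n X v) \<le> K * hnorm n v" "K \<ge> 0" shows "hmat_norm n X \<le> K"
  unfolding hmat_norm_def
proof (rule cSup_least)
  have "hnorm n (\<lambda>i. 0::'a) \<le> 1" by simp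
  then show "{hnorm n (mat_app n X v) | v. hnorm n v \<le> 1} \<noteq> {}" by blast
  fix r assume "r \<in> {hnorm n (mat_app n X v) | v. hnorm n v \<le> 1}"
  then obtain u where u: "r = hnorm n (mat_app n X u)" "hnorm n u \<le> 1" by auto
  then show "r \<le> K" using assms(1)[of u] mult_left_mono[OF u(2) assms(2)] by simp
qed

lemma hmat_norm_nonneg [simp]: "hmat_norm n X \<ge> 0"
proof (cases "\<exists>v. hnorm n v \<noteq> (0::real) \<and> v \<in> (UNIV :: (nat \<Rightarrow> 'a) set)")
  case True
  then obtain v :: "nat \<Rightarrow> 'a" where "hnorm n v > 0" by (auto simp: less_le)
  moreover have "0 \<le> hmat_norm n X * hnorm n v" using hnorm_mat_app_le[of n X v] hnorm_nonneg order_trans by blast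
  ultimately show ?thesis by (simp add: zero_le_mult_iff)
next
  case False
  then have "{hnorm n (mat_app n X v) | v. hnorm n v \<le> 1} = {0}" by auto
  then show ?thesis by (simp add: hmat_norm_def)
qed

lemma mat_app_add:
  "X \<in> carrier_mat n n \<Longrightarrow> Y \<in> carrier_mat n n \<Longrightarrow> i < n \<Longrightarrow> mat_app n (X + Y) v i = mat_app n X v i + mat_app n Y v i"
  by (auto simp: mat_app_def distrib_right sum.distrib intro!: sum.cong)

lemma mat_app_mult:
  assumes "X \<in> carrier_mat n n" "Y \<in> carrier_mat n n" "i < n"
  shows "mat_app n (X * Y) v i = mat_app n X (mat_app n Y v) i"
proof -
  have "mat_app n (X * Y) v i = (\<Sum>j<n. \<Sum>k<n. X $$ (i, k) * Y $$ (k, j) * v j)"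
    unfolding mat_app_def using assms
    by (intro sum.cong) (auto simp: scalar_prod_def sum_distrib_right atLeast0LessThan)
  also have "\<dots> = (\<Sum>k<n. \<Sum>j<n. X $$ (i, k) * Y $$ (k, j) * v j)" by (rule sum.swap)
  finally show ?thesis by (simp add: mat_app_def sum_distrib_left mult.assoc)
qed

lemma sum_star_mat_app:
  assumes "X \<in> carrier_mat n n"
  shows "(\<Sum>i<n. star (mat_app n X v i) * w i) = (\<Sum>j<n. star (v j) * mat_app n (mat_star X) w j)"
proof -
  have "(\<Sum>i<n. star (mat_app n X v i) * w i) = (\<Sum>i<n. \<Sum>j<n. star (v j) * star (X $$ (i, j)) * w i)"
    by (simp add: mat_app_def star_sum star_mult sum_distrib_right)
  also have "\<dots> = (\<Sum>j<n. \<Sum>i<n. star (v j) * star (X $$ (i, j)) * w i)" by (rule sum.swap)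
  also have "\<dots> = (\<Sum>j<n. star (v j) * mat_app n (mat_star X) w j)"
    unfolding mat_app_def sum_distrib_left using assms by (intro sum.cong) (auto simp: mult.assoc)
  finally show ?thesis .
qed

lemma mat_star_mat_star: "mat_star (mat_star X) = X"
  by (intro eq_matI) (auto simp: star_star)

lemma hmat_norm_mult:
  assumes "X \<in> carrier_mat n n" "Y \<in> carrier_mat n n"
  shows "hmat_norm n (X * Y) \<le> hmat_norm n X * hmat_norm n Y"
proof (rule hmat_norm_leI)
  fix v
  have "hnorm n (mat_app n (X * Y) v) = hnorm n (mat_app n X (mat_app n Y v))"
    using mat_app_mult[OF assms] by (intro hnorm_cong) auto
  also have "\<dots> \<le> hmat_norm n X * (hmat_norm n Y * hnorm n v)"
    by (intro order_trans[OF hnorm_mat_app_le] mult_left_mono hnorm_mat_app_le) simp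
  finally show "hnorm n (mat_app n (X * Y) v) \<le> hmat_norm n X * hmat_norm n Y * hnorm n v" by simp
qed simp

lemma hmat_norm_sq_le:
  assumes X: "X \<in> carrier_mat n n"
  shows "(hmat_norm n X)\<^sup>2 \<le> hmat_norm n (mat_star X * X)"
proof -
  let ?N = "hmat_norm n (mat_star X * X)"
  have "hmat_norm n X \<le> sqrt ?N"
  proof (rule hmat_norm_leI)
    fix v
    have "(hnorm n (mat_app n X v))\<^sup>2 = norm (\<Sum>j<n. star (v j) * mat_app n (mat_star X) (mat_app n X v) j)"
      unfolding hnorm_sq sum_star_mat_app[OF X] ..
    also have "(\<Sum>j<n. star (v j) * mat_app n (mat_star X) (mat_app n X v) j)
      = (\<Sum>j<n. star (v j) * mat_app n (mat_star X * X) v j)"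
      using X by (intro sum.cong) (auto simp: mat_app_mult[of _ n])
    also have "norm \<dots> \<le> hnorm n v * (?N * hnorm n v)"
      by (intro order_trans[OF norm_inner_le_hnorm] mult_left_mono hnorm_mat_app_le) simp
    also have "\<dots> = (sqrt ?N * hnorm n v)\<^sup>2" by (simp add: power2_eq_square algebra_simps)
    finally show "hnorm n (mat_app n X v) \<le> sqrt ?N * hnorm n v" by (rule power2_le_imp_le) simp
  qed simp
  then have "(hmat_norm n X)\<^sup>2 \<le> (sqrt ?N)\<^sup>2" by (intro power_mono) auto
  then show ?thesis by simp
qed

lemma cstar_matrix_norm_hmat_norm: "cstar_matrix_norm n (hmat_norm n :: 'a::cstar_algebra mat \<Rightarrow> real)"
  unfolding cstar_matrix_norm_def
proof (intro conjI ballI allI impI)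
  fix X Y :: "'a mat" assume X: "X \<in> carrier_mat n n" and Y: "Y \<in> carrier_mat n n"
  show "hmat_norm n (X + Y) \<le> hmat_norm n X + hmat_norm n Y"
  proof (rule hmat_norm_leI)
    fix v
    have "hnorm n (mat_app n (X + Y) v) = hnorm n (\<lambda>i. mat_app n X v i + mat_app n Y v i)"
      using mat_app_add[OF X Y] by (intro hnorm_cong) auto
    also have "\<dots> \<le> hmat_norm n X * hnorm n v + hmat_norm n Y * hnorm n v"
      by (intro order_trans[OF hnorm_triangle] add_mono hnorm_mat_app_le)
    finally show "hnorm n (mat_app n (X + Y) v) \<le> (hmat_norm n X + hmat_norm n Y) * hnorm n v"
      by (simp add: algebra_simps)
  qed simp
  show "hmat_norm n (X * Y) \<le> hmat_norm n X * hmat_norm n Y" by (rule hmat_norm_mult[OF X Y])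
next
  fix X :: "'a mat" assume X: "X \<in> carrier_mat n n"
  show "(hmat_norm n X = 0) = (X = 0\<^sub>m n n)"
  proof
    assume 0: "hmat_norm n X = 0"
    show "X = 0\<^sub>m n n"
    proof (rule eq_matI)
      fix i j assume ij: "i < dim_row (0\<^sub>m n n :: 'a mat)" "j < dim_col (0\<^sub>m n n :: 'a mat)"
      \<comment> \<open>Without a unit there are no basis vectors; the adjoint of the entry under
        test takes the place of \<open>1\<close>.\<close>
      let ?v = "\<lambda>k. if k = j then star (X $$ (i, j)) else 0"
      have "mat_app n X ?v i = (\<Sum>k<n. if k = j then X $$ (i, j) * star (X $$ (i, j)) else 0)"
        unfolding mat_app_def by (intro sum.cong) auto
      then have "mat_app n X ?v i = X $$ (i, j) * star (X $$ (i, j))" using ij by simp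
      moreover have "hnorm n (mat_app n X ?v) \<le> 0" using hnorm_mat_app_le[of n X ?v] 0 by simp
      ultimately have "norm (X $$ (i, j) * star (X $$ (i, j))) \<le> 0"
        using norm_le_hnorm[of i n "mat_app n X ?v"] ij by (metis index_zero_mat(2) order_trans)
      then have "X $$ (i, j) = 0" unfolding norm_mult_star by simp
      then show "X $$ (i, j) = 0\<^sub>m n n $$ (i, j)" using ij by simp
    qed (use X in auto)
  next
    assume "X = 0\<^sub>m n n"
    then have "hnorm n (mat_app n X v) = hnorm n (\<lambda>i. 0::'a)" for v
      by (intro hnorm_cong) (simp add: mat_app_def)
    then have "hmat_norm n X \<le> 0" by (intro hmat_norm_leI) auto
    then show "hmat_norm n X = 0" by (simp add: order_antisym)
  qed
  have le: "hmat_norm n (map_mat (scaleC c) X) \<le> cmod c * hmat_norm n X" if X: "X \<in> carrier_mat n n" for c and X :: "'a mat"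
  proof (rule hmat_norm_leI)
    fix v
    have "hnorm n (mat_app n (map_mat (scaleC c) X) v) = hnorm n (\<lambda>i. c *\<^sub>C mat_app n X v i)"
      using X by (intro hnorm_cong) (auto simp: mat_app_def mult_scaleC_left cvs.scale_sum_right intro!: sum.cong)
    then show "hnorm n (mat_app n (map_mat (scaleC c) X) v) \<le> cmod c * hmat_norm n X * hnorm n v"
      using mult_left_mono[OF hnorm_mat_app_le[of n X v], of "cmod c"] by (simp add: hnorm_scaleC mult.assoc)
  qed simp
  fix c
  show "hmat_norm n (map_mat (scaleC c) X) = cmod c * hmat_norm n X"
  proof (cases "c = 0")
    case True
    then show ?thesis using le[OF X, of c] by (simp add: order_antisym)
  next
    case False
    have "map_mat (scaleC (inverse c)) (map_mat (scaleC c) X) = X"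
      using False by (intro eq_matI) (auto simp: scaleC_scaleC)
    then have "hmat_norm n X \<le> inverse (cmod c) * hmat_norm n (map_mat (scaleC c) X)"
      using le[of "map_mat (scaleC c) X" "inverse c"] X by (simp add: norm_inverse)
    then show ?thesis using False le[OF X, of c] by (simp add: field_simps)
  qed
next
  fix X :: "'a mat" assume X: "X \<in> carrier_mat n n"
  have le: "hmat_norm n X \<le> hmat_norm n (mat_star X)" if X: "X \<in> carrier_mat n n" for X :: "'a mat"
  proof (cases "hmat_norm n X = 0")
    case False
    have "hmat_norm n X * hmat_norm n X \<le> hmat_norm n (mat_star X) * hmat_norm n X"
      using hmat_norm_sq_le[OF X] hmat_norm_mult[of "mat_star X" n X] X by (simp add: power2_eq_square)
    with False show ?thesis by (simp add: less_le)
  qed simp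
  from le[OF X] le[of "mat_star X"] X have "hmat_norm n (mat_star X) = hmat_norm n X"
    by (simp add: mat_star_mat_star)
  then show "hmat_norm n (mat_star X * X) = (hmat_norm n X)\<^sup>2"
    using hmat_norm_sq_le[OF X] hmat_norm_mult[of "mat_star X" n X] X by (simp add: power2_eq_square)
next
  fix k :: nat and a :: 'a assume k: "k < n"
  let ?E = "mat n n (\<lambda>(i, j). if i = k \<and> j = k then a else 0)"
  have app: "hnorm n (mat_app n ?E v) = norm (a * v k)" for v
  proof -
    have "mat_app n ?E v i = (if i = k then a * v k else 0)" if "i < n" for i
    proof -
      have "mat_app n ?E v i = (\<Sum>j<n. if j = k then (if i = k then a * v k else 0) else 0)"
        unfolding mat_app_def using that by (intro sum.cong) auto
      then show ?thesis using k by simp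
    qed
    then have "hnorm n (mat_app n ?E v) = hnorm n (\<lambda>i. if i = k then a * v k else 0)" by (intro hnorm_cong) auto
    then show ?thesis using hnorm_single[OF k] by simp
  qed
  have "hmat_norm n ?E \<le> norm a"
    by (rule hmat_norm_leI) (auto simp: app k intro!: order_trans[OF norm_mult_ineq] mult_left_mono norm_le_hnorm)
  moreover have "norm a \<le> hmat_norm n ?E"
  proof (cases "a = 0")
    case False
    have "norm (a * star a) \<le> hmat_norm n ?E * norm a"
      using hnorm_mat_app_le[of n ?E "\<lambda>i. if i = k then star a else 0"] hnorm_single[OF k, of "star a"] by (simp add: app)
    then show ?thesis using False by (simp add: norm_mult_star power2_eq_square)
  qed simp
  ultimately show "hmat_norm n ?E = norm a" by simp
qed


section \<open>Uniqueness of the C*-norm on matrices\<close>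

definition elem_mat :: "nat \<Rightarrow> nat \<Rightarrow> nat \<Rightarrow> 'a::zero \<Rightarrow> 'a mat" where
  "elem_mat n i j a = mat n n (\<lambda>(k, l). if k = i \<and> l = j then a else 0)"

lemma elem_mat_carrier [simp]: "elem_mat n i j a \<in> carrier_mat n n"
  by (simp add: elem_mat_def)

lemma mat_star_elem_mat: "mat_star (elem_mat n i j a) = elem_mat n j i (star a)"
  by (intro eq_matI) (auto simp: elem_mat_def)

lemma index_mult_mat_sum:
  "X \<in> carrier_mat n n \<Longrightarrow> Y \<in> carrier_mat n n \<Longrightarrow> k < n \<Longrightarrow> l < n
    \<Longrightarrow> (X * Y) $$ (k, l) = (\<Sum>m<n. X $$ (k, m) * Y $$ (m, l))"
  by (auto simp: scalar_prod_def atLeast0LessThan)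

lemma elem_mat_mult:
  fixes a b :: "'a::semiring_0"
  assumes "j < n" shows "elem_mat n i j a * elem_mat n j k b = elem_mat n i k (a * b)"
proof (rule eq_matI)
  fix p q assume "p < dim_row (elem_mat n i k (a * b))" "q < dim_col (elem_mat n i k (a * b))"
  then have pq: "p < n" "q < n" by (auto simp: elem_mat_def)
  have "(elem_mat n i j a * elem_mat n j k b) $$ (p, q)
    = (\<Sum>m<n. if m = j then (if p = i \<and> q = k then a * b else 0) else 0)"
    unfolding index_mult_mat_sum[OF elem_mat_carrier elem_mat_carrier pq]
    using pq by (intro sum.cong refl) (auto simp: elem_mat_def)
  then show "(elem_mat n i j a * elem_mat n j k b) $$ (p, q) = elem_mat n i k (a * b) $$ (p, q)"
    using assms pq by (simp add: elem_mat_def)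
qed (auto simp: elem_mat_def)

lemma elem_mat_mult_mult:
  fixes X :: "'a::semiring_0 mat"
  assumes X: "X \<in> carrier_mat n n" and ij: "i < n" "j < n"
  shows "elem_mat n i i a * X * elem_mat n j j b = elem_mat n i j (a * X $$ (i, j) * b)"
proof (rule eq_matI)
  fix p q assume "p < dim_row (elem_mat n i j (a * X $$ (i, j) * b))" "q < dim_col (elem_mat n i j (a * X $$ (i, j) * b))"
  then have pq: "p < n" "q < n" by (auto simp: elem_mat_def)
  have 1: "(elem_mat n i i a * X) $$ (p, m) = (if p = i then a * X $$ (i, m) else 0)" if "m < n" for m
  proof -
    have "(elem_mat n i i a * X) $$ (p, m) = (\<Sum>k<n. if k = i then (if p = i then a * X $$ (i, m) else 0) else 0)"
      unfolding index_mult_mat_sum[OF elem_mat_carrier X pq(1) that]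
      using pq that by (intro sum.cong refl) (auto simp: elem_mat_def)
    then show ?thesis using ij by simp
  qed
  have 2: "elem_mat n j j b $$ (m, q) = (if m = j \<and> q = j then b else 0)" if "m < n" for m
    using that pq by (simp add: elem_mat_def)
  have "(elem_mat n i i a * X * elem_mat n j j b) $$ (p, q)
    = (\<Sum>m<n. (elem_mat n i i a * X) $$ (p, m) * elem_mat n j j b $$ (m, q))"
    by (rule index_mult_mat_sum[OF mult_carrier_mat[OF elem_mat_carrier X] elem_mat_carrier pq])
  also have "\<dots> = (\<Sum>m<n. if m = j then (if p = i \<and> q = j then a * X $$ (i, j) * b else 0) else 0)"
    using pq by (intro sum.cong refl) (auto simp: 1 2)
  finally show "(elem_mat n i i a * X * elem_mat n j j b) $$ (p, q) = elem_mat n i j (a * X $$ (i, j) * b) $$ (p, q)"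
    using ij pq by (simp add: elem_mat_def)
qed (use X in \<open>auto simp: elem_mat_def\<close>)

text \<open>A compression that should be tested against a unit is tested against
  \<open>star x\<close> on both sides instead; dividing by \<open>(norm x)^2\<close> afterwards
  recovers \<open>norm x\<close>.\<close>

lemma norm_cube_le: "norm x ^ 3 \<le> norm (star x * x * star (x::'a::cstar_algebra))"
proof (cases "x = 0")
  case False
  have "norm x ^ 4 = (norm (star x * x))\<^sup>2" by (simp add: cstar_identity)
  also have "\<dots> = norm ((star x * x) * (star x * x))"
    by (rule norm_selfadjoint_square[symmetric]) (simp add: star_mult star_star)
  also have "\<dots> \<le> norm (star x * x * star x) * norm x"
    using norm_mult_ineq[of "star x * x * star x" x] by (simp add: mult.assoc)
  finally have "norm x ^ 3 * norm x \<le> norm (star x * x * star x) * norm x" by (simp add: power_numeral_reduce)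
  with False show ?thesis by simp
qed simp

context
  fixes n :: nat and N :: "'a::cstar_algebra mat \<Rightarrow> real"
  assumes N: "cstar_matrix_norm n N"
begin

lemma cmn_triangle: "X \<in> carrier_mat n n \<Longrightarrow> Y \<in> carrier_mat n n \<Longrightarrow> N (X + Y) \<le> N X + N Y"
  and cmn_scaleC: "X \<in> carrier_mat n n \<Longrightarrow> N (map_mat (scaleC c) X) = cmod c * N X"
  and cmn_mult: "X \<in> carrier_mat n n \<Longrightarrow> Y \<in> carrier_mat n n \<Longrightarrow> N (X * Y) \<le> N X * N Y"
  and cmn_cstar: "X \<in> carrier_mat n n \<Longrightarrow> N (mat_star X * X) = (N X)\<^sup>2"
  and cmn_zero: "N (0\<^sub>m n n) = 0"
  and cmn_corner: "k < n \<Longrightarrow> N (elem_mat n k k a) = norm a"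
  using N unfolding cstar_matrix_norm_def elem_mat_def by auto

lemma cmn_nonneg: assumes X: "X \<in> carrier_mat n n" shows "N X \<ge> 0"
proof -
  have "X + map_mat (scaleC (-1)) X = 0\<^sub>m n n" using X by (intro eq_matI) (auto simp: scaleC_minus_one)
  then show ?thesis using cmn_triangle[of X "map_mat (scaleC (-1)) X"] cmn_scaleC[of X "-1"] X
    by (simp add: cmn_zero)
qed

lemma cmn_star: assumes X: "X \<in> carrier_mat n n" shows "N (mat_star X) = N X"
proof -
  have le: "N X \<le> N (mat_star X)" if X: "X \<in> carrier_mat n n" for X
  proof (cases "N X = 0")
    case True
    then show ?thesis using cmn_nonneg[of "mat_star X"] X by simp
  next
    case False
    have "N X * N X \<le> N (mat_star X) * N X"
      using cmn_cstar[OF X] cmn_mult[of "mat_star X" X] X by (simp add: power2_eq_square)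
    with False cmn_nonneg[OF X] show ?thesis by (simp add: less_le)
  qed
  from le[OF X] le[of "mat_star X"] X show ?thesis by (simp add: mat_star_mat_star)
qed

text \<open>The axioms fix the norm on diagonal corners only; the C*-identity moves an off-diagonal
  corner to a diagonal one.\<close>

lemma cmn_elem_mat: assumes "i < n" "j < n" shows "N (elem_mat n i j a) = norm a"
proof -
  have "(N (elem_mat n i j a))\<^sup>2 = (norm a)\<^sup>2"
    using cmn_cstar[of "elem_mat n i j a"] assms
    by (simp add: mat_star_elem_mat elem_mat_mult cmn_corner cstar_identity)
  then show ?thesis by (simp add: cmn_nonneg)
qed

lemma cmn_entry_le:
  assumes X: "X \<in> carrier_mat n n" and ij: "i < n" "j < n" shows "norm (X $$ (i, j)) \<le> N X"
proof (cases "X $$ (i, j) = 0")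
  case True
  then show ?thesis using cmn_nonneg[OF X] by simp
next
  case False
  let ?x = "X $$ (i, j)"
  have "norm ?x ^ 3 \<le> N (elem_mat n i i (star ?x) * X * elem_mat n j j (star ?x))"
    unfolding elem_mat_mult_mult[OF X ij] cmn_elem_mat[OF ij] by (rule norm_cube_le)
  also have "\<dots> \<le> (N (elem_mat n i i (star ?x)) * N X) * N (elem_mat n j j (star ?x))"
    using X by (intro order_trans[OF cmn_mult] mult_right_mono cmn_mult cmn_nonneg) (auto intro: mult_carrier_mat[of _ n n])
  also have "\<dots> = norm ?x ^ 2 * N X" using ij by (simp add: cmn_corner power2_eq_square)
  finally have "norm ?x ^ 2 * norm ?x \<le> norm ?x ^ 2 * N X" by (simp add: power_numeral_reduce mult.assoc)
  with False show ?thesis by (metis mult_le_cancel_left_pos norm_ge_zero order_less_le zero_less_norm_iff zero_less_power)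
qed

lemma cmn_le_sum:
  assumes X: "X \<in> carrier_mat n n"
  shows "N X \<le> (\<Sum>i<n. \<Sum>j<n. norm (X $$ (i, j)))"
proof -
  define P where "P S = mat n n (\<lambda>ij. if ij \<in> S then X $$ ij else 0)" for S
  have "N (P S) \<le> (\<Sum>ij\<in>S. norm (X $$ ij))" if "finite S" "S \<subseteq> {..<n} \<times> {..<n}" for S
    using that
  proof (induction S rule: finite_induct)
    case empty
    have "P {} = 0\<^sub>m n n" by (intro eq_matI) (auto simp: P_def)
    then show ?case by (simp add: cmn_zero)
  next
    case (insert ij S)
    obtain i j where ij: "ij = (i, j)" by (cases ij)
    with insert.prems have b: "i < n" "j < n" by auto
    have "P (insert ij S) = elem_mat n i j (X $$ (i, j)) + P S"
      using insert.hyps by (intro eq_matI) (auto simp: P_def elem_mat_def ij)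
    then have "N (P (insert ij S)) \<le> norm (X $$ (i, j)) + N (P S)"
      using cmn_triangle[of "elem_mat n i j (X $$ (i, j))" "P S"] by (simp add: cmn_elem_mat[OF b]) (simp add: P_def)
    then show ?case using insert ij by simp
  qed
  from this[of "{..<n} \<times> {..<n}"] have "N (P ({..<n} \<times> {..<n})) \<le> (\<Sum>ij\<in>{..<n} \<times> {..<n}. norm (X $$ ij))" by simp
  moreover have "P ({..<n} \<times> {..<n}) = X" using X by (intro eq_matI) (auto simp: P_def)
  ultimately show ?thesis by (simp add: sum.cartesian_product split_def)
qed

text \<open>On self-adjoint matrices the C*-identity reads \<open>N (H * H) = (N H)^2\<close>, and
  squares are again self-adjoint.\<close>

lemma cmn_iterated_square:
  assumes H: "H \<in> carrier_mat n n" "mat_star H = H"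
  shows "((\<lambda>Z. Z * Z) ^^ k) H \<in> carrier_mat n n \<and> mat_star (((\<lambda>Z. Z * Z) ^^ k) H) = ((\<lambda>Z. Z * Z) ^^ k) H
     \<and> N (((\<lambda>Z. Z * Z) ^^ k) H) = N H ^ (2 ^ k)"
proof (induction k)
  case (Suc k)
  let ?Z = "((\<lambda>Z. Z * Z) ^^ k) H"
  have Z: "?Z \<in> carrier_mat n n" "mat_star ?Z = ?Z" "N ?Z = N H ^ (2 ^ k)" using Suc by auto
  have "mat_star (?Z * ?Z) = ?Z * ?Z"
  proof (rule eq_matI)
    fix i j assume "i < dim_row (?Z * ?Z)" "j < dim_col (?Z * ?Z)"
    then have ij: "i < n" "j < n" using Z(1) by auto
    have st: "star (?Z $$ (p, q)) = ?Z $$ (q, p)" if "p < n" "q < n" for p q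
    proof -
      have "mat_star ?Z $$ (q, p) = star (?Z $$ (p, q))" using Z(1) that by auto
      then show ?thesis unfolding Z(2) by simp
    qed
    have "mat_star (?Z * ?Z) $$ (i, j) = star ((?Z * ?Z) $$ (j, i))" using ij Z(1) by auto
    also have "\<dots> = (\<Sum>m<n. ?Z $$ (i, m) * ?Z $$ (m, j))"
      using ij by (subst index_mult_mat_sum[OF Z(1) Z(1)]) (auto simp: star_sum star_mult st intro!: sum.cong)
    also have "\<dots> = (?Z * ?Z) $$ (i, j)" using ij by (subst index_mult_mat_sum[OF Z(1) Z(1)]) auto
    finally show "mat_star (?Z * ?Z) $$ (i, j) = (?Z * ?Z) $$ (i, j)" .
  qed (use Z(1) in auto)
  moreover have "N (?Z * ?Z) = N H ^ (2 ^ Suc k)"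
    using cmn_cstar[OF Z(1)] unfolding Z(2) Z(3) by (simp add: power_mult[symmetric] mult.commute)
  ultimately show ?case using Z(1) by (auto intro: mult_carrier_mat[of _ n n])
qed (use H in auto)

end

text \<open>On self-adjoint elements a C*-norm is determined by the growth of the iterated squares,
  and any two C*-norms are equivalent by the entry bounds.\<close>

lemma cstar_matrix_norm_le:
  fixes N N' :: "'a::cstar_algebra mat \<Rightarrow> real"
  assumes N: "cstar_matrix_norm n N" and N': "cstar_matrix_norm n N'" and X: "X \<in> carrier_mat n n"
  shows "N X \<le> N' X"
proof -
  have equiv: "N Z \<le> real n * real n * N' Z" if "Z \<in> carrier_mat n n" for Z
  proof -
    have "N Z \<le> (\<Sum>i<n. \<Sum>j<n. norm (Z $$ (i, j)))" by (rule cmn_le_sum[OF N that])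
    also have "\<dots> \<le> (\<Sum>i<n. \<Sum>j<n. N' Z)" by (intro sum_mono cmn_entry_le[OF N' that]) auto
    finally show ?thesis by simp
  qed
  define H where "H = mat_star X * X"
  have H: "H \<in> carrier_mat n n" using X by (auto simp: H_def)
  have sH: "mat_star H = H"
  proof (rule eq_matI)
    fix i j assume "i < dim_row H" "j < dim_col H"
    then have ij: "i < n" "j < n" using H by auto
    have "mat_star H $$ (i, j) = star (H $$ (j, i))" using ij H by auto
    also have "\<dots> = (\<Sum>m<n. mat_star X $$ (i, m) * X $$ (m, j))"
      unfolding H_def using ij X
      by (subst index_mult_mat_sum[of _ n]) (auto simp: star_sum star_mult star_star intro!: sum.cong)
    also have "\<dots> = H $$ (i, j)" unfolding H_def using ij X by (subst index_mult_mat_sum[of _ n]) auto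
    finally show "mat_star H $$ (i, j) = H $$ (i, j)" .
  qed (use H in auto)
  have "N H \<le> N' H"
  proof (cases "N' H = 0")
    case True
    then show ?thesis using equiv[OF H] by simp
  next
    case False
    then have pos: "N' H > 0" using cmn_nonneg[OF N' H] by simp
    have "N H / N' H \<le> 1"
    proof (rule le_one_if_power2_linear_bound)
      fix k
      let ?Z = "((\<lambda>Z. Z * Z) ^^ k) H"
      \<comment> \<open>The equivalence constant \<open>n^2\<close> stays fixed while the exponent
        doubles, so it is lost when the root is taken.\<close>
      have "N H ^ (2 ^ k) \<le> real n * real n * N' H ^ (2 ^ k)"
        using cmn_iterated_square[OF N H sH, of k] cmn_iterated_square[OF N' H sH, of k] equiv[of ?Z] by simp
      then have "(N H / N' H) ^ (2 ^ k) \<le> real n * real n"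
        using pos by (simp add: power_divide divide_le_eq)
      also have "\<dots> \<le> 1 + 2 ^ k * (real n * real n)"
        using mult_right_mono[of 1 "2 ^ k" "real n * real n"] by simp
      finally show "(N H / N' H) ^ (2 ^ k) \<le> 1 + 2 ^ k * (real n * real n)" .
    qed (use cmn_nonneg[OF N H] pos in auto)
    then show ?thesis using pos by (simp add: divide_le_eq)
  qed
  then have "(N X)\<^sup>2 \<le> (N' X)\<^sup>2" unfolding H_def cmn_cstar[OF N X] cmn_cstar[OF N' X] .
  then show ?thesis using cmn_nonneg[OF N' X] power2_le_imp_le by blast
qed

lemma mat_norm_eq_hmat_norm:
  assumes X: "X \<in> carrier_mat n n" shows "mat_norm X = hmat_norm n X"
proof -
  have d: "dim_row X = n" using X by simp
  show ?thesis unfolding mat_norm_def d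
  proof (rule the_equality)
    show "\<exists>N. cstar_matrix_norm n N \<and> hmat_norm n X = N X" using cstar_matrix_norm_hmat_norm by blast
    fix r assume "\<exists>N. cstar_matrix_norm n N \<and> r = N X"
    then show "r = hmat_norm n X"
      using cstar_matrix_norm_le[OF _ cstar_matrix_norm_hmat_norm X]
        cstar_matrix_norm_le[OF cstar_matrix_norm_hmat_norm _ X] by (metis order_antisym)
  qed
qed

lemma cstar_matrix_norm_mat_norm: "cstar_matrix_norm n (mat_norm :: 'a::cstar_algebra mat \<Rightarrow> real)"
proof -
  show ?thesis
    using cstar_matrix_norm_hmat_norm[of n, where 'a='a] unfolding cstar_matrix_norm_def
    by (simp add: mat_norm_eq_hmat_norm[of _ n] mult_carrier_mat[of _ n n])
qed

lemma mat_norm_nonneg: "X \<in> carrier_mat n n \<Longrightarrow> mat_norm X \<ge> 0"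
  by (rule cmn_nonneg[OF cstar_matrix_norm_mat_norm])

lemma mat_norm_scaleC: "X \<in> carrier_mat n n \<Longrightarrow> mat_norm (map_mat (scaleC c) X) = cmod c * mat_norm X"
  by (rule cmn_scaleC[OF cstar_matrix_norm_mat_norm])

text \<open>The column is padded with zeros because \<open>mat_norm\<close> is meant for square
  matrices; its C*-square lives in a single corner.\<close>

lemma mat_norm_column:
  fixes a :: "nat \<Rightarrow> 'a::cstar_algebra"
  assumes "n > 0"
  shows "mat_norm (mat n n (\<lambda>(i, j). if j = 0 then a i else 0)) = sqrt (norm (\<Sum>i<n. star (a i) * a i))"
    (is "mat_norm ?X = _")
proof -
  have X: "?X \<in> carrier_mat n n" by simp
  have "mat_star ?X * ?X = elem_mat n 0 0 (\<Sum>i<n. star (a i) * a i)"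
  proof (rule eq_matI)
    fix i j assume "i < dim_row (elem_mat n 0 0 (\<Sum>i<n. star (a i) * a i))"
      "j < dim_col (elem_mat n 0 0 (\<Sum>i<n. star (a i) * a i))"
    then have "i < n" "j < n" by (auto simp: elem_mat_def)
    then show "(mat_star ?X * ?X) $$ (i, j) = elem_mat n 0 0 (\<Sum>i<n. star (a i) * a i) $$ (i, j)"
      by (subst index_mult_mat_sum[of _ n]) (auto simp: elem_mat_def intro!: sum.neutral)
  qed (auto simp: elem_mat_def)
  then have "(mat_norm ?X)\<^sup>2 = mat_norm (elem_mat n 0 0 (\<Sum>i<n. star (a i) * a i))"
    unfolding cmn_cstar[OF cstar_matrix_norm_mat_norm X, symmetric] by (rule arg_cong)
  also have "\<dots> = norm (\<Sum>i<n. star (a i) * a i)" by (rule cmn_corner[OF cstar_matrix_norm_mat_norm assms])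
  finally show ?thesis using real_sqrt_unique[OF _ mat_norm_nonneg[OF X]] by simp
qed

lemma mat_norm_row:
  fixes a :: "nat \<Rightarrow> 'a::cstar_algebra"
  assumes "n > 0"
  shows "mat_norm (mat n n (\<lambda>(i, j). if i = 0 then a j else 0)) = sqrt (norm (\<Sum>i<n. a i * star (a i)))"
    (is "mat_norm ?X = _")
proof -
  have "mat_norm ?X = mat_norm (mat_star ?X)"
    by (rule cmn_star[OF cstar_matrix_norm_mat_norm, of _ n, symmetric]) simp
  also have "mat_star ?X = mat n n (\<lambda>(i, j). if j = 0 then star (a i) else 0)"
    by (intro eq_matI) auto
  finally show ?thesis using mat_norm_column[OF assms, of "\<lambda>i. star (a i)"] by (simp add: star_star)
qed

text \<open>Scalar vectors are tested as \<open>x \<otimes> z\<^sup>*\<close> and \<open>y \<otimes> z\<close>, where \<open>z\<close> is the compressed element,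
  because there is no unit to tensor with.\<close>

lemma norm_scalar_compression_le:
  fixes X :: "'a::cstar_algebra mat"
  assumes X: "X \<in> carrier_mat n n"
  shows "norm (\<Sum>k<n. \<Sum>l<n. (cnj (y k) * x l) *\<^sub>C X $$ (k, l))
    \<le> mat_norm X * sqrt (\<Sum>l<n. (cmod (x l))\<^sup>2) * sqrt (\<Sum>k<n. (cmod (y k))\<^sup>2)"
proof -
  define z where "z = (\<Sum>k<n. \<Sum>l<n. (cnj (y k) * x l) *\<^sub>C X $$ (k, l))"
  define sx sy where "sx = sqrt (\<Sum>l<n. (cmod (x l))\<^sup>2)" and "sy = sqrt (\<Sum>k<n. (cmod (y k))\<^sup>2)"
  have hn: "hnorm n (\<lambda>l. x l *\<^sub>C a) = norm a * sqrt (\<Sum>l<n. (cmod (x l))\<^sup>2)" for x and a :: 'a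
  proof -
    have "(\<Sum>i<n. star (x i *\<^sub>C a) * (x i *\<^sub>C a)) = complex_of_real (\<Sum>l<n. (cmod (x l))\<^sup>2) *\<^sub>C (star a * a)"
      unfolding of_real_sum cvs.scale_sum_left
      by (intro sum.cong refl)
        (simp only: star_scaleC mult_scaleC_left mult_scaleC_right scaleC_scaleC complex_norm_square)
    then show ?thesis unfolding hnorm_def
      by (simp add: norm_scaleC cstar_identity real_sqrt_mult sum_nonneg del: of_real_sum)
  qed
  have "(\<Sum>k<n. star (y k *\<^sub>C z) * mat_app n X (\<lambda>l. x l *\<^sub>C star z) k) = star z * z * star z"
  proof -
    have "(\<Sum>k<n. star (y k *\<^sub>C z) * mat_app n X (\<lambda>l. x l *\<^sub>C star z) k)
      = (\<Sum>k<n. \<Sum>l<n. star z * ((cnj (y k) * x l) *\<^sub>C X $$ (k, l)) * star z)"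
      by (intro sum.cong) (simp_all add: mat_app_def star_scaleC mult_scaleC_left mult_scaleC_right
          scaleC_scaleC sum_distrib_left cvs.scale_sum_right mult.assoc mult.commute[of "x l" for l])
    also have "\<dots> = star z * (\<Sum>k<n. \<Sum>l<n. (cnj (y k) * x l) *\<^sub>C X $$ (k, l)) * star z"
      by (simp add: sum_distrib_left sum_distrib_right)
    finally show ?thesis by (simp add: z_def)
  qed
  then have "norm z ^ 3 \<le> norm (\<Sum>k<n. star (y k *\<^sub>C z) * mat_app n X (\<lambda>l. x l *\<^sub>C star z) k)"
    by (simp add: norm_cube_le)
  also have "\<dots> \<le> (norm z * sy) * (mat_norm X * (norm z * sx))"
  proof (rule order_trans[OF norm_inner_le_hnorm], rule mult_mono)
    show "hnorm n (\<lambda>k. y k *\<^sub>C z) \<le> norm z * sy" unfolding hn sy_def ..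
    show "hnorm n (mat_app n X (\<lambda>l. x l *\<^sub>C star z)) \<le> mat_norm X * (norm z * sx)"
      using hnorm_mat_app_le[of n X "\<lambda>l. x l *\<^sub>C star z"]
      unfolding hn sx_def mat_norm_eq_hmat_norm[OF X] by simp
  qed (auto simp: sy_def sum_nonneg)
  also have "\<dots> = (norm z)\<^sup>2 * (mat_norm X * sx * sy)" by (simp only: power2_eq_square ac_simps)
  finally have *: "(norm z)\<^sup>2 * norm z \<le> (norm z)\<^sup>2 * (mat_norm X * sx * sy)"
    by (simp only: power2_eq_square power3_eq_cube)
  have "norm z \<le> mat_norm X * sx * sy"
  proof (cases "z = 0")
    case True
    then show ?thesis using mat_norm_nonneg[OF X] by (simp add: sum_nonneg sx_def sy_def)
  next
    case False
    then have "(norm z)\<^sup>2 > 0" by simp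
    with * show ?thesis by (simp only: mult_le_cancel_left_pos)
  qed
  then show ?thesis unfolding z_def sx_def sy_def .
qed

section \<open>Involutions without short relations\<close>

text \<open>The vertices are the reduced words of length at most \<open>R\<close> in the free product of copies of
  \<open>\<int>/2\<close>; generators act on them by involutions that fix those words of length \<open>R\<close> which
  they cannot shorten.\<close>

definition red_words :: "'c set \<Rightarrow> nat \<Rightarrow> 'c list set" where
  "red_words I R = {w. set w \<subseteq> I \<and> length w \<le> R \<and> distinct_adj w}"

definition flip_word :: "nat \<Rightarrow> 'c \<Rightarrow> 'c list \<Rightarrow> 'c list" where
  "flip_word R i w = (if w \<noteq> [] \<and> hd w = i then tl w else if length w < R then i # w else w)"

lemma finite_red_words: "finite I \<Longrightarrow> finite (red_words I R)"
  by (rule finite_subset[OF _ finite_lists_length_le[of I R]]) (auto simp: red_words_def)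

lemma flip_word_in: "i \<in> I \<Longrightarrow> w \<in> red_words I R \<Longrightarrow> flip_word R i w \<in> red_words I R"
  by (cases w) (auto simp: red_words_def flip_word_def distinct_adj_Cons)

lemma flip_word_flip_word: "w \<in> red_words I R \<Longrightarrow> flip_word R i (flip_word R i w) = w"
  by (cases w) (auto simp: red_words_def flip_word_def distinct_adj_Cons)

lemma length_flip_word:
  "length w < R \<Longrightarrow> length (flip_word R i w) = Suc (length w) \<or> Suc (length (flip_word R i w)) = length w"
  by (cases w) (auto simp: flip_word_def)

lemma length_flip_word_less:
  "length (flip_word R i w) < length w \<Longrightarrow> length (flip_word R j w) < length w \<Longrightarrow> i = j"
  by (auto simp: flip_word_def split: if_splits)

text \<open>Around every point \<open>p\<close> the coloured graph is a tree up to distance \<open>R\<close>, and \<open>len p\<close> is the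
  distance to \<open>p\<close> there.\<close>

definition local_tree :: "nat \<Rightarrow> 'c set \<Rightarrow> ('c \<Rightarrow> nat \<Rightarrow> nat) \<Rightarrow> nat \<Rightarrow> (nat \<Rightarrow> nat \<Rightarrow> nat) \<Rightarrow> bool" where
  "local_tree d I s R len \<longleftrightarrow>
     (\<forall>i\<in>I. \<forall>p<d. s i p < d \<and> s i (s i p) = p) \<and>
     (\<forall>p<d. len p p = 0 \<and>
       (\<forall>q<d. \<forall>i\<in>I. len p q < R \<longrightarrow> len p (s i q) = Suc (len p q) \<or> Suc (len p (s i q)) = len p q) \<and>
       (\<forall>q<d. \<forall>i\<in>I. \<forall>j\<in>I. len p (s i q) < len p q \<longrightarrow> len p (s j q) < len p q \<longrightarrow> i = j))"

text \<open>The ball of reduced words is a tree only away from its boundary. To make all points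
  alike, the vertices are the permutations of the ball, on which a generator acts by composition
  with its flip: a Cayley graph, in which the view from any vertex is the view from the empty
  word.\<close>

lemma ex_local_tree:
  fixes I :: "'c set"
  assumes "finite I"
  obtains d s len where "d > 0" "local_tree d I s R len"
proof -
  define V where "V = red_words I R"
  have finV: "finite V" and nilV: "[] \<in> V"
    by (auto simp: V_def finite_red_words assms) (simp add: red_words_def)
  define P where "P = {g. g permutes V}"
  have finP: "finite P" unfolding P_def by (rule finite_permutations[OF finV])
  define d where "d = card P"
  obtain h where h: "bij_betw h {..<d} P"
    using ex_bij_betw_nat_finite[OF finP] by (auto simp: d_def atLeast0LessThan)
  define h' where "h' = the_inv_into {..<d} h"
  have h'1: "h' (h p) = p" if "p < d" for p
    using that h by (simp add: h'_def bij_betw_def the_inv_into_f_f)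
  have h'2: "h' g < d" "h (h' g) = g" if "g \<in> P" for g
    using that h f_the_inv_into_f[of h "{..<d}" g] the_inv_into_into[of h "{..<d}" g "{..<d}"]
    by (auto simp: h'_def bij_betw_def)
  have hP: "h p \<in> P" if "p < d" for p using h that by (auto simp: bij_betw_def)
  define f where "f i = (\<lambda>w. if w \<in> V then flip_word R i w else w)" for i
  have f: "f i permutes V" if "i \<in> I" for i
    unfolding permutes_def
  proof (intro conjI allI impI)
    fix w show "\<exists>!v. f i v = w"
    proof (rule ex1I[of _ "f i w"])
      show "f i (f i w) = w" using flip_word_in[OF that] flip_word_flip_word by (auto simp: f_def V_def)
      show "v = f i w" if "f i v = w" for v
        using that flip_word_in[OF \<open>i \<in> I\<close>] flip_word_flip_word[of v I R i] by (auto simp: f_def V_def)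
    qed
  qed (simp add: f_def)
  have ff: "f i (f i w) = w" if "i \<in> I" for i w
    using flip_word_in[OF that] flip_word_flip_word by (auto simp: f_def V_def)
  have fP: "f i \<circ> g \<in> P" if "i \<in> I" "g \<in> P" for i g
    using that f by (auto simp: P_def intro: permutes_compose)
  define s where "s i p = h' (f i \<circ> h p)" for i p
  \<comment> \<open>The length of the word to which the permutation \<open>q p^{-1}\<close> sends
    the empty word.\<close>
  define len where "len p q = length (h q (inv_into UNIV (h p) []))" for p q
  have hs: "h (s i p) = f i \<circ> h p" if "i \<in> I" "p < d" for i p
    unfolding s_def by (rule h'2(2)[OF fP[OF that(1) hP[OF that(2)]]])
  have val: "h q (inv_into UNIV (h p) []) \<in> V" if "p < d" "q < d" for p q
    using hP[OF that(1)] hP[OF that(2)] nilV permutes_inv permutes_in_image by (metis P_def mem_Collect_eq)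
  have "local_tree d I s R len"
    unfolding local_tree_def
  proof (intro conjI ballI allI impI)
    fix i p assume ip: "i \<in> I" "p < d"
    show sd: "s i p < d" unfolding s_def using ip by (intro h'2 fP hP)
    have "f i \<circ> h (s i p) = h p" using ip by (auto simp: hs ff fun_eq_iff)
    then show "s i (s i p) = p" using h'1[OF ip(2)] by (simp add: s_def[of i "s i p"])
  next
    fix p assume p: "p < d"
    show "len p p = 0" using hP[OF p] permutes_inverses(1)[of "h p" V "[]"] by (simp add: len_def P_def)
    fix q assume q: "q < d"
    have ls: "len p (s i q) = length (flip_word R i (h q (inv_into UNIV (h p) [])))" if "i \<in> I" for i
      using val[OF p q] by (simp add: len_def hs that q f_def)
    { fix i assume "i \<in> I" "len p q < R"
      then show "len p (s i q) = Suc (len p q) \<or> Suc (len p (s i q)) = len p q"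
        unfolding ls[OF \<open>i \<in> I\<close>] unfolding len_def by (intro length_flip_word) }
    { fix i j assume "i \<in> I" "j \<in> I" "len p (s i q) < len p q" "len p (s j q) < len p q"
      then show "i = j"
        unfolding ls[OF \<open>i \<in> I\<close>] ls[OF \<open>j \<in> I\<close>] unfolding len_def by (intro length_flip_word_less) }
  qed
  moreover have "d > 0"
  proof -
    have "id \<in> P" by (simp add: P_def permutes_id)
    then show ?thesis using finP by (auto simp: d_def card_gt_0_iff)
  qed
  ultimately show ?thesis by (rule that[rotated])
qed

text \<open>At a fixed point of \<open>s i \<circ> s j\<close> both colours lead to the same neighbour \<open>q\<close> and both decrease
  the distance from \<open>q\<close> to \<open>p\<close>.\<close>

lemma local_tree_neq:
  assumes lt: "local_tree d I s R len" and R: "R \<ge> 2" and ij: "i \<in> I" "j \<in> I" "i \<noteq> j" and p: "p < d"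
  shows "s i p \<noteq> s j p"
proof
  assume eq: "s i p = s j p"
  have l0: "len p p = 0" using lt p by (auto simp: local_tree_def)
  have sd: "s i p < d" using lt p ij by (auto simp: local_tree_def)
  have "len p (s i p) = Suc (len p p) \<or> Suc (len p (s i p)) = len p p"
    using lt p ij(1) R l0 unfolding local_tree_def by (metis less_le_trans pos2)
  then have l1: "len p (s i p) = 1" using l0 by simp
  have "s i (s i p) = p" "s j (s j p) = p" using lt p ij unfolding local_tree_def by blast+
  then have "s i (s i p) = p" "s j (s i p) = p" unfolding eq by simp_all
  then have "len p (s i (s i p)) < len p (s i p)" "len p (s j (s i p)) < len p (s i p)" using l0 l1 by auto
  then have "i = j" using lt p sd ij unfolding local_tree_def by blast
  with ij show False by simp
qed

section \<open>Operators over locally tree-like graphs\<close>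

text \<open>Vectors are functions and the index set is a parameter, so that tensor products become
  Cartesian products of index sets.\<close>

definition vnorm :: "'k set \<Rightarrow> ('k \<Rightarrow> complex) \<Rightarrow> real" where
  "vnorm K v = L2_set (\<lambda>k. cmod (v k)) K"

definition vinner :: "'k set \<Rightarrow> ('k \<Rightarrow> complex) \<Rightarrow> ('k \<Rightarrow> complex) \<Rightarrow> complex" where
  "vinner K v w = (\<Sum>k\<in>K. v k * cnj (w k))"

definition kapp :: "'k set \<Rightarrow> ('l \<Rightarrow> 'k \<Rightarrow> complex) \<Rightarrow> ('k \<Rightarrow> complex) \<Rightarrow> 'l \<Rightarrow> complex" where
  "kapp K M v = (\<lambda>l. \<Sum>k\<in>K. M l k * v k)"

lemma sum_pairs: "(\<Sum>k\<in>A \<times> B. g k) = (\<Sum>a\<in>A. \<Sum>b\<in>B. g (a, b))"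
  by (simp add: sum.cartesian_product)

lemma vnorm_nonneg [simp]: "vnorm K v \<ge> 0" by (simp add: vnorm_def)

lemma vnorm_sq: "(vnorm K v)\<^sup>2 = (\<Sum>k\<in>K. (cmod (v k))\<^sup>2)"
  by (simp add: vnorm_def L2_set_def sum_nonneg)

lemma vnorm_cong: "(\<And>k. k \<in> K \<Longrightarrow> v k = w k) \<Longrightarrow> vnorm K v = vnorm K w"
  unfolding vnorm_def by (rule L2_set_cong) auto

lemma vinner_cong: "(\<And>k. k \<in> K \<Longrightarrow> v k = v' k) \<Longrightarrow> (\<And>k. k \<in> K \<Longrightarrow> w k = w' k) \<Longrightarrow> vinner K v w = vinner K v' w'"
  unfolding vinner_def by (intro sum.cong) auto

lemma vnorm_triangle: "vnorm K (\<lambda>k. v k + w k) \<le> vnorm K v + vnorm K w"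
  unfolding vnorm_def
  by (rule order_trans[OF L2_set_mono L2_set_triangle_ineq]) (auto intro: norm_triangle_ineq)

lemma vinner_self: "vinner K v v = complex_of_real ((vnorm K v)\<^sup>2)"
  unfolding vinner_def vnorm_sq of_real_sum complex_norm_square ..

lemma vinner_commute: "vinner K w v = cnj (vinner K v w)"
  by (simp add: vinner_def mult.commute)

lemma cmod_vinner_le: "cmod (vinner K v w) \<le> vnorm K v * vnorm K w"
proof -
  have "cmod (vinner K v w) \<le> (\<Sum>k\<in>K. \<bar>cmod (v k)\<bar> * \<bar>cmod (w k)\<bar>)"
    unfolding vinner_def by (rule order_trans[OF norm_sum]) (simp add: norm_mult)
  also have "\<dots> \<le> vnorm K v * vnorm K w" unfolding vnorm_def by (rule L2_set_mult_ineq)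
  finally show ?thesis .
qed


lemma vinner_kapp_left:
  "vinner L (kapp K M v) w = vinner K v (kapp L (\<lambda>k l. cnj (M l k)) w)"
proof -
  have "vinner L (kapp K M v) w = (\<Sum>l\<in>L. \<Sum>k\<in>K. M l k * v k * cnj (w l))"
    by (simp add: vinner_def kapp_def sum_distrib_right)
  also have "\<dots> = (\<Sum>k\<in>K. \<Sum>l\<in>L. M l k * v k * cnj (w l))" by (rule sum.swap)
  finally show ?thesis by (simp add: vinner_def kapp_def sum_distrib_left mult_ac)
qed

lemma vnorm_adjoint_le:
  assumes adj: "\<And>v w. vinner L (T v) w = vinner K v (T' w)"
    and T: "\<And>v. vnorm L (T v) \<le> B * vnorm K v" and B: "B \<ge> 0"
  shows "vnorm K (T' w) \<le> B * vnorm L w"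
proof (cases "vnorm K (T' w) = 0")
  case True
  then show ?thesis using B by simp
next
  case False
  have "complex_of_real ((vnorm K (T' w))\<^sup>2) = vinner L (T (T' w)) w"
    unfolding adj vinner_self ..
  then have "(vnorm K (T' w))\<^sup>2 = cmod (vinner L (T (T' w)) w)"
    by (metis norm_of_real abs_of_nonneg zero_le_power2)
  also have "\<dots> \<le> B * vnorm K (T' w) * vnorm L w"
    by (rule order_trans[OF cmod_vinner_le]) (intro mult_right_mono T vnorm_nonneg)
  finally have "vnorm K (T' w) * vnorm K (T' w) \<le> (B * vnorm L w) * vnorm K (T' w)"
    by (simp add: power2_eq_square mult_ac)
  then show ?thesis using False by (simp add: less_le)
qed

text \<open>The operator \<open>\<Sum> C_i \<otimes> s_i\<close>, with \<open>s_i\<close> read as a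
  permutation matrix. Pulling back along \<open>s i\<close> is correct because it is an
  involution.\<close>

definition tapp :: "'c set \<Rightarrow> 'j set \<Rightarrow> ('c \<Rightarrow> nat \<Rightarrow> nat) \<Rightarrow> ('c \<Rightarrow> 'j \<Rightarrow> 'j \<Rightarrow> complex)
    \<Rightarrow> ('j \<times> nat \<Rightarrow> complex) \<Rightarrow> 'j \<times> nat \<Rightarrow> complex" where
  "tapp I J s C v = (\<lambda>(a, p). \<Sum>i\<in>I. \<Sum>b\<in>J. C i a b * v (b, s i p))"

text \<open>The norm of the column \<open>(C_i)\<close>: equivalently
  \<open>\<Sum> C_i^* C_i \<le> \<alpha>^2\<close>. Its companion \<open>row_bound\<close> is
  \<open>\<Sum> C_i C_i^* \<le> \<beta>^2\<close>.\<close>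

definition col_bound :: "'c set \<Rightarrow> 'j set \<Rightarrow> ('c \<Rightarrow> 'j \<Rightarrow> 'j \<Rightarrow> complex) \<Rightarrow> real \<Rightarrow> bool" where
  "col_bound I J C \<alpha> \<longleftrightarrow> (\<forall>x. (\<Sum>i\<in>I. \<Sum>a\<in>J. (cmod (\<Sum>b\<in>J. C i a b * x b))\<^sup>2) \<le> \<alpha>\<^sup>2 * (\<Sum>b\<in>J. (cmod (x b))\<^sup>2))"

definition row_bound :: "'c set \<Rightarrow> 'j set \<Rightarrow> ('c \<Rightarrow> 'j \<Rightarrow> 'j \<Rightarrow> complex) \<Rightarrow> real \<Rightarrow> bool" where
  "row_bound I J C \<beta> \<longleftrightarrow> (\<forall>x. (\<Sum>a\<in>J. (cmod (\<Sum>i\<in>I. \<Sum>b\<in>J. C i a b * x i b))\<^sup>2)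
     \<le> \<beta>\<^sup>2 * (\<Sum>i\<in>I. \<Sum>b\<in>J. (cmod (x i b))\<^sup>2))"

definition adj_coeff :: "('c \<Rightarrow> 'j \<Rightarrow> 'j \<Rightarrow> complex) \<Rightarrow> 'c \<Rightarrow> 'j \<Rightarrow> 'j \<Rightarrow> complex" where
  "adj_coeff C i a b = cnj (C i b a)"

text \<open>The adjoint of the column of the \<open>C_i\<close> is the row of their
  adjoints.\<close>

lemma row_bound_adj:
  assumes "col_bound I J C \<alpha>" "\<alpha> \<ge> 0" shows "row_bound I J (adj_coeff C) \<alpha>"
proof -
  define T where "T x = (\<lambda>(i, a). \<Sum>b\<in>J. C i a b * x b)" for x
  define T' where "T' y = (\<lambda>a. \<Sum>i\<in>I. \<Sum>b\<in>J. adj_coeff C i a b * y (i, b))" for y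
  have adj: "vinner (I \<times> J) (T x) y = vinner J x (T' y)" for x y
  proof -
    have "vinner (I \<times> J) (T x) y = (\<Sum>i\<in>I. \<Sum>a\<in>J. \<Sum>b\<in>J. C i a b * x b * cnj (y (i, a)))"
      by (simp add: vinner_def T_def sum_pairs sum_distrib_right)
    also have "\<dots> = (\<Sum>i\<in>I. \<Sum>b\<in>J. \<Sum>a\<in>J. C i a b * x b * cnj (y (i, a)))"
      by (intro sum.cong refl sum.swap)
    also have "\<dots> = (\<Sum>b\<in>J. \<Sum>i\<in>I. \<Sum>a\<in>J. C i a b * x b * cnj (y (i, a)))" by (rule sum.swap)
    also have "\<dots> = vinner J x (T' y)"
      by (simp add: vinner_def T'_def adj_coeff_def sum_distrib_left mult_ac)
    finally show ?thesis .
  qed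
  have T: "vnorm (I \<times> J) (T x) \<le> \<alpha> * vnorm J x" for x
  proof (rule power2_le_imp_le)
    show "(vnorm (I \<times> J) (T x))\<^sup>2 \<le> (\<alpha> * vnorm J x)\<^sup>2"
      using assms(1) unfolding power_mult_distrib vnorm_sq col_bound_def
      by (simp add: T_def sum_pairs)
  qed (use assms in auto)
  show ?thesis unfolding row_bound_def
  proof
    fix y :: "'a \<Rightarrow> 'b \<Rightarrow> complex"
    have "vnorm J (T' (case_prod y)) \<le> \<alpha> * vnorm (I \<times> J) (case_prod y)"
      by (rule vnorm_adjoint_le[OF adj T assms(2)])
    then have "(vnorm J (T' (case_prod y)))\<^sup>2 \<le> (\<alpha> * vnorm (I \<times> J) (case_prod y))\<^sup>2" by (intro power_mono) auto
    then show "(\<Sum>a\<in>J. (cmod (\<Sum>i\<in>I. \<Sum>b\<in>J. adj_coeff C i a b * y i b))\<^sup>2)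
      \<le> \<alpha>\<^sup>2 * (\<Sum>i\<in>I. \<Sum>b\<in>J. (cmod (y i b))\<^sup>2)"
      unfolding power_mult_distrib vnorm_sq
      by (simp add: T'_def sum_pairs)
  qed
qed

lemma col_bound_adj:
  assumes "row_bound I J C \<beta>" "\<beta> \<ge> 0" shows "col_bound I J (adj_coeff C) \<beta>"
proof -
  define T where "T y = (\<lambda>a. \<Sum>i\<in>I. \<Sum>b\<in>J. C i a b * y (i, b))" for y
  define T' where "T' x = (\<lambda>(i, a). \<Sum>b\<in>J. adj_coeff C i a b * x b)" for x
  have adj: "vinner J (T y) x = vinner (I \<times> J) y (T' x)" for x y
  proof -
    have "vinner J (T y) x = (\<Sum>a\<in>J. \<Sum>i\<in>I. \<Sum>b\<in>J. C i a b * y (i, b) * cnj (x a))"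
      by (simp add: vinner_def T_def sum_distrib_right)
    also have "\<dots> = (\<Sum>i\<in>I. \<Sum>a\<in>J. \<Sum>b\<in>J. C i a b * y (i, b) * cnj (x a))" by (rule sum.swap)
    also have "\<dots> = (\<Sum>i\<in>I. \<Sum>b\<in>J. \<Sum>a\<in>J. C i a b * y (i, b) * cnj (x a))"
      by (intro sum.cong refl sum.swap)
    also have "\<dots> = vinner (I \<times> J) y (T' x)"
      by (simp add: vinner_def T'_def adj_coeff_def sum_pairs sum_distrib_left mult_ac)
    finally show ?thesis .
  qed
  have T: "vnorm J (T y) \<le> \<beta> * vnorm (I \<times> J) y" for y
  proof (rule power2_le_imp_le)
    show "(vnorm J (T y))\<^sup>2 \<le> (\<beta> * vnorm (I \<times> J) y)\<^sup>2"
      using assms(1)[unfolded row_bound_def, rule_format, of "\<lambda>i b. y (i, b)"]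
      unfolding power_mult_distrib vnorm_sq
      by (simp add: T_def sum_pairs)
  qed (use assms in auto)
  show ?thesis unfolding col_bound_def
  proof
    fix x :: "'b \<Rightarrow> complex"
    have "vnorm (I \<times> J) (T' x) \<le> \<beta> * vnorm J x"
      by (rule vnorm_adjoint_le[OF adj T assms(2)])
    then have "(vnorm (I \<times> J) (T' x))\<^sup>2 \<le> (\<beta> * vnorm J x)\<^sup>2" by (intro power_mono) auto
    then show "(\<Sum>i\<in>I. \<Sum>a\<in>J. (cmod (\<Sum>b\<in>J. adj_coeff C i a b * x b))\<^sup>2) \<le> \<beta>\<^sup>2 * (\<Sum>b\<in>J. (cmod (x b))\<^sup>2)"
      unfolding power_mult_distrib vnorm_sq
      by (simp add: T'_def sum_pairs)
  qed
qed

section \<open>Estimates near a vertex\<close>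

lemma sum_involution:
  assumes "local_tree d I s R len" "i \<in> I"
  shows "(\<Sum>p<d. g (s i p)) = (\<Sum>p<d. g p)"
  by (rule sum.reindex_bij_witness[of _ "s i" "s i"]) (use assms in \<open>auto simp: local_tree_def\<close>)

text \<open>Permutation matrices of involutions are self-adjoint, so taking adjoints affects the
  coefficients alone.\<close>

lemma vinner_tapp:
  assumes lt: "local_tree d I s R len"
  shows "vinner (J \<times> {..<d}) (tapp I J s C v) w = vinner (J \<times> {..<d}) v (tapp I J s (adj_coeff C) w)"
proof -
  have "vinner (J \<times> {..<d}) (tapp I J s C v) w
    = (\<Sum>a\<in>J. \<Sum>p<d. \<Sum>i\<in>I. \<Sum>b\<in>J. C i a b * v (b, s i p) * cnj (w (a, p)))"
    by (simp add: vinner_def tapp_def sum_pairs sum_distrib_right)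
  also have "\<dots> = (\<Sum>a\<in>J. \<Sum>i\<in>I. \<Sum>p<d. \<Sum>b\<in>J. C i a b * v (b, s i p) * cnj (w (a, p)))"
    by (intro sum.cong refl sum.swap)
  also have "\<dots> = (\<Sum>a\<in>J. \<Sum>i\<in>I. \<Sum>p<d. \<Sum>b\<in>J. C i a b * v (b, p) * cnj (w (a, s i p)))"
  proof (rule sum.cong[OF refl], rule sum.cong[OF refl])
    fix a i assume i: "i \<in> I"
    have "(\<Sum>p<d. \<Sum>b\<in>J. C i a b * v (b, s i p) * cnj (w (a, p)))
      = (\<Sum>p<d. \<Sum>b\<in>J. C i a b * v (b, s i p) * cnj (w (a, s i (s i p))))"
      using lt i by (intro sum.cong refl) (auto simp: local_tree_def)
    also have "\<dots> = (\<Sum>p<d. \<Sum>b\<in>J. C i a b * v (b, p) * cnj (w (a, s i p)))"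
      by (rule sum_involution[OF lt i])
    finally show "(\<Sum>p<d. \<Sum>b\<in>J. C i a b * v (b, s i p) * cnj (w (a, p)))
      = (\<Sum>p<d. \<Sum>b\<in>J. C i a b * v (b, p) * cnj (w (a, s i p)))" .
  qed
  also have "\<dots> = (\<Sum>a\<in>J. \<Sum>p<d. \<Sum>i\<in>I. \<Sum>b\<in>J. C i a b * v (b, p) * cnj (w (a, s i p)))"
    by (intro sum.cong refl sum.swap)
  also have "\<dots> = (\<Sum>a\<in>J. \<Sum>p<d. \<Sum>b\<in>J. \<Sum>i\<in>I. C i a b * v (b, p) * cnj (w (a, s i p)))"
    by (intro sum.cong refl sum.swap)
  also have "\<dots> = (\<Sum>a\<in>J. \<Sum>b\<in>J. \<Sum>p<d. \<Sum>i\<in>I. C i a b * v (b, p) * cnj (w (a, s i p)))"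
    by (intro sum.cong refl sum.swap)
  also have "\<dots> = (\<Sum>b\<in>J. \<Sum>a\<in>J. \<Sum>p<d. \<Sum>i\<in>I. C i a b * v (b, p) * cnj (w (a, s i p)))"
    by (rule sum.swap)
  also have "\<dots> = (\<Sum>b\<in>J. \<Sum>p<d. \<Sum>a\<in>J. \<Sum>i\<in>I. C i a b * v (b, p) * cnj (w (a, s i p)))"
    by (intro sum.cong refl sum.swap)
  also have "\<dots> = (\<Sum>b\<in>J. \<Sum>p<d. \<Sum>i\<in>I. \<Sum>a\<in>J. C i a b * v (b, p) * cnj (w (a, s i p)))"
    by (intro sum.cong refl sum.swap)
  also have "\<dots> = vinner (J \<times> {..<d}) v (tapp I J s (adj_coeff C) w)"
    by (simp add: vinner_def tapp_def adj_coeff_def sum_pairs sum_distrib_left mult_ac)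
  finally show ?thesis .
qed

lemma vnorm_sq_pairs: "(vnorm (J \<times> {..<d}) v)\<^sup>2 = (\<Sum>p<d. \<Sum>a\<in>J. (cmod (v (a, p)))\<^sup>2)"
  unfolding vnorm_sq by (subst sum.swap) (simp add: sum_pairs)

lemma sum_le_single:
  fixes r :: real
  assumes "finite I" "\<And>i j. i \<in> I \<Longrightarrow> j \<in> I \<Longrightarrow> P i \<Longrightarrow> P j \<Longrightarrow> i = j" "r \<ge> 0"
  shows "(\<Sum>i\<in>I. if P i then r else 0) \<le> r"
proof (cases "\<exists>i\<in>I. P i")
  case True
  then obtain i where i: "i \<in> I" "P i" by blast
  have "(\<Sum>j\<in>I. if P j then r else 0) = (\<Sum>j\<in>I. if j = i then r else 0)"
    using assms(2) i by (intro sum.cong) auto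
  then show ?thesis using i assms by simp
next
  case False
  then have "(\<Sum>i\<in>I. if P i then r else 0) = 0" by (intro sum.neutral) auto
  then show ?thesis using assms by simp
qed

lemma cmod_sum_single_sq:
  assumes "finite I" "\<And>i j. i \<in> I \<Longrightarrow> j \<in> I \<Longrightarrow> P i \<Longrightarrow> P j \<Longrightarrow> i = j"
  shows "(cmod (\<Sum>i\<in>I. if P i then f i else 0))\<^sup>2 \<le> (\<Sum>i\<in>I. (cmod (f i))\<^sup>2)"
proof (cases "\<exists>i\<in>I. P i")
  case True
  then obtain i where i: "i \<in> I" "P i" by blast
  have "(\<Sum>j\<in>I. if P j then f j else 0) = (\<Sum>j\<in>I. if j = i then f i else 0)"
    using assms(2) i by (intro sum.cong) auto
  then have "(cmod (\<Sum>j\<in>I. if P j then f j else 0))\<^sup>2 = (cmod (f i))\<^sup>2" using i assms by simp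
  also have "\<dots> \<le> (\<Sum>i\<in>I. (cmod (f i))\<^sup>2)" using i assms by (intro member_le_sum) auto
  finally show ?thesis .
next
  case False
  then have "(\<Sum>i\<in>I. if P i then f i else 0) = 0" by (intro sum.neutral) auto
  then show ?thesis by (simp add: sum_nonneg)
qed

text \<open>Near \<open>p0\<close> the operator splits into a creation part, whose components have orthogonal ranges,
  and an annihilation part, whose components have orthogonal supports.\<close>

lemma vnorm_tapp_local:
  assumes fin: "finite I" "finite J" and lt: "local_tree d I s R len" and p0: "p0 < d"
    and col: "col_bound I J C \<alpha>" "\<alpha> \<ge> 0" and row: "row_bound I J C \<beta>" "\<beta> \<ge> 0"
    and supp: "\<And>b q. b \<in> J \<Longrightarrow> q < d \<Longrightarrow> len p0 q \<ge> R \<Longrightarrow> v (b, q) = 0"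
  shows "vnorm (J \<times> {..<d}) (tapp I J s C v) \<le> (\<alpha> + \<beta>) * vnorm (J \<times> {..<d}) v"
proof -
  \<comment> \<open>The colour \<open>i\<close> leads from \<open>p\<close> one step closer to
    \<open>p0\<close>; at each \<open>p\<close> at most one colour does. \<open>S\<close> moves mass
    away from \<open>p0\<close>, \<open>S'\<close> moves it towards \<open>p0\<close>.\<close>
  define A where "A i p \<longleftrightarrow> len p0 (s i p) < len p0 p" for i p
  define S where "S = (\<lambda>(a, p). \<Sum>i\<in>I. if A i p then \<Sum>b\<in>J. C i a b * v (b, s i p) else 0)"
  define x where "x p i b = (if A i (s i p) then v (b, s i p) else 0)" for p i b
  define S' where "S' = (\<lambda>(a, p). \<Sum>i\<in>I. \<Sum>b\<in>J. C i a b * x p i b)"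
  have sd: "s i p < d" "s i (s i p) = p" if "i \<in> I" "p < d" for i p
    using lt that by (auto simp: local_tree_def)
  have uniq: "i = j" if "i \<in> I" "j \<in> I" "A i p" "A j p" "p < d" for i j p
    using lt p0 that unfolding local_tree_def A_def by blast
  have split: "tapp I J s C v k = S k + S' k" if kK: "k \<in> J \<times> {..<d}" for k
  proof -
    obtain a p where k: "k = (a, p)" "a \<in> J" "p < d" using kK by auto
    have "C i a b * v (b, s i p) = (if A i p then C i a b * v (b, s i p) else 0) + C i a b * x p i b"
      if i: "i \<in> I" and b: "b \<in> J" for i b
    proof (cases "len p0 (s i p) \<ge> R")
      case True
      then have "v (b, s i p) = 0" using supp b sd(1)[OF i \<open>p < d\<close>] by blast
      then show ?thesis by (simp add: x_def)
    next
      case False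
      then have "len p0 (s i (s i p)) = Suc (len p0 (s i p)) \<or> Suc (len p0 (s i (s i p))) = len p0 (s i p)"
        using lt p0 i sd(1)[OF i \<open>p < d\<close>] unfolding local_tree_def by auto
      then have "A i p \<longleftrightarrow> \<not> A i (s i p)" using sd(2)[OF i \<open>p < d\<close>] by (auto simp: A_def)
      then show ?thesis by (auto simp: x_def)
    qed
    then have "tapp I J s C v k = (\<Sum>i\<in>I. \<Sum>b\<in>J. (if A i p then C i a b * v (b, s i p) else 0) + C i a b * x p i b)"
      unfolding tapp_def k by auto
    also have "\<dots> = S k + S' k"
      unfolding S_def S'_def k by (auto simp: sum.distrib intro!: sum.cong)
    finally show ?thesis .
  qed
  \<comment> \<open>At each point only the colour leading back to \<open>p0\<close> contributes, so
    the square of the sum is at most the sum of the squares, which the column bound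
    controls.\<close>
  have "(vnorm (J \<times> {..<d}) S)\<^sup>2 \<le> (\<alpha> * vnorm (J \<times> {..<d}) v)\<^sup>2"
  proof -
    have "(vnorm (J \<times> {..<d}) S)\<^sup>2 \<le> (\<Sum>p<d. \<Sum>a\<in>J. \<Sum>i\<in>I. (cmod (\<Sum>b\<in>J. C i a b * v (b, s i p)))\<^sup>2)"
      unfolding vnorm_sq_pairs S_def by (simp, intro sum_mono cmod_sum_single_sq fin uniq) auto
    also have "\<dots> = (\<Sum>p<d. \<Sum>i\<in>I. \<Sum>a\<in>J. (cmod (\<Sum>b\<in>J. C i a b * v (b, s i p)))\<^sup>2)"
      by (intro sum.cong refl sum.swap)
    also have "\<dots> = (\<Sum>i\<in>I. \<Sum>p<d. \<Sum>a\<in>J. (cmod (\<Sum>b\<in>J. C i a b * v (b, s i p)))\<^sup>2)" by (rule sum.swap)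
    also have "\<dots> = (\<Sum>i\<in>I. \<Sum>p<d. \<Sum>a\<in>J. (cmod (\<Sum>b\<in>J. C i a b * v (b, p)))\<^sup>2)"
      by (intro sum.cong refl sum_involution[OF lt])
    also have "\<dots> = (\<Sum>p<d. \<Sum>i\<in>I. \<Sum>a\<in>J. (cmod (\<Sum>b\<in>J. C i a b * v (b, p)))\<^sup>2)" by (rule sum.swap)
    also have "\<dots> \<le> (\<Sum>p<d. \<alpha>\<^sup>2 * (\<Sum>b\<in>J. (cmod (v (b, p)))\<^sup>2))"
      by (intro sum_mono col(1)[unfolded col_bound_def, rule_format])
    finally show ?thesis by (simp add: power_mult_distrib vnorm_sq_pairs sum_distrib_left)
  qed
  then have 1: "vnorm (J \<times> {..<d}) S \<le> \<alpha> * vnorm (J \<times> {..<d}) v"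
    using col(2) by (rule power2_le_imp_le[OF _ mult_nonneg_nonneg]) simp
  \<comment> \<open>The row bound holds at every point with inputs \<open>x p\<close>; summed over
    all points, each value of \<open>v\<close> occurs in these inputs for at most one
    colour.\<close>
  have "(vnorm (J \<times> {..<d}) S')\<^sup>2 \<le> (\<beta> * vnorm (J \<times> {..<d}) v)\<^sup>2"
  proof -
    have "(vnorm (J \<times> {..<d}) S')\<^sup>2 \<le> (\<Sum>p<d. \<beta>\<^sup>2 * (\<Sum>i\<in>I. \<Sum>b\<in>J. (cmod (x p i b))\<^sup>2))"
      unfolding vnorm_sq_pairs S'_def by (simp, intro sum_mono row(1)[unfolded row_bound_def, rule_format])
    also have "\<dots> = \<beta>\<^sup>2 * (\<Sum>i\<in>I. \<Sum>p<d. \<Sum>b\<in>J. (cmod (x p i b))\<^sup>2)"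
      unfolding sum_distrib_left[symmetric] by (subst sum.swap) (rule refl)
    also have "(\<Sum>i\<in>I. \<Sum>p<d. \<Sum>b\<in>J. (cmod (x p i b))\<^sup>2)
      = (\<Sum>i\<in>I. \<Sum>p<d. \<Sum>b\<in>J. if A i p then (cmod (v (b, p)))\<^sup>2 else 0)"
    proof (rule sum.cong[OF refl])
      fix i assume i: "i \<in> I"
      show "(\<Sum>p<d. \<Sum>b\<in>J. (cmod (x p i b))\<^sup>2) = (\<Sum>p<d. \<Sum>b\<in>J. if A i p then (cmod (v (b, p)))\<^sup>2 else 0)"
        unfolding sum_involution[OF lt i, of "\<lambda>p. \<Sum>b\<in>J. if A i p then (cmod (v (b, p)))\<^sup>2 else 0", symmetric]
        by (intro sum.cong refl) (simp add: x_def)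
    qed
    also have "\<dots> = (\<Sum>p<d. \<Sum>b\<in>J. \<Sum>i\<in>I. if A i p then (cmod (v (b, p)))\<^sup>2 else 0)"
      by (subst sum.swap) (intro sum.cong refl sum.swap)
    also have "\<dots> \<le> (\<Sum>p<d. \<Sum>b\<in>J. (cmod (v (b, p)))\<^sup>2)"
      by (intro sum_mono sum_le_single fin uniq) auto
    finally show ?thesis by (simp add: power_mult_distrib vnorm_sq_pairs mult_left_mono)
  qed
  then have 2: "vnorm (J \<times> {..<d}) S' \<le> \<beta> * vnorm (J \<times> {..<d}) v"
    using row(2) by (rule power2_le_imp_le[OF _ mult_nonneg_nonneg]) simp
  have "vnorm (J \<times> {..<d}) (tapp I J s C v) = vnorm (J \<times> {..<d}) (\<lambda>k. S k + S' k)"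
    by (rule vnorm_cong) (rule split)
  also have "\<dots> \<le> vnorm (J \<times> {..<d}) S + vnorm (J \<times> {..<d}) S'" by (rule vnorm_triangle)
  finally show ?thesis using 1 2 by (simp add: distrib_right)
qed

text \<open>The operator moves mass along edges, hence by one step; this keeps an iterate inside the
  region where the graph is a tree.\<close>

lemma tapp_support:
  assumes lt: "local_tree d I s R len" and p0: "p0 < d" and m: "m < R"
    and supp: "\<And>b q. b \<in> J \<Longrightarrow> q < d \<Longrightarrow> len p0 q > m \<Longrightarrow> v (b, q) = 0"
    and q: "q < d" "len p0 q > Suc m"
  shows "tapp I J s C v (a, q) = 0"
proof -
  have "v (b, s i q) = 0" if "i \<in> I" "b \<in> J" for i b
  proof (rule supp)
    have sd: "s i q < d" "s i (s i q) = q" using lt that q by (auto simp: local_tree_def)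
    show "s i q < d" by (rule sd)
    show "len p0 (s i q) > m"
    proof (rule ccontr)
      assume "\<not> len p0 (s i q) > m"
      then have "len p0 (s i (s i q)) = Suc (len p0 (s i q)) \<or> Suc (len p0 (s i (s i q))) = len p0 (s i q)"
        using lt p0 that(1) sd(1) m unfolding local_tree_def by auto
      then show False using sd(2) q(2) \<open>\<not> len p0 (s i q) > m\<close> by auto
    qed
  qed (use that in auto)
  then show ?thesis by (simp add: tapp_def)
qed

definition delta :: "'k \<Rightarrow> 'k \<Rightarrow> complex" where "delta k l = (if l = k then 1 else 0)"

lemma vnorm_delta: "finite K \<Longrightarrow> k \<in> K \<Longrightarrow> vnorm K (delta k) = 1"
proof -
  assume "finite K" "k \<in> K"
  then have "(\<Sum>l\<in>K. (cmod (delta k l))\<^sup>2) = (\<Sum>l\<in>K. if l = k then 1 else 0)"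
    by (intro sum.cong) (auto simp: delta_def)
  then have "(vnorm K (delta k))\<^sup>2 = 1\<^sup>2" using \<open>finite K\<close> \<open>k \<in> K\<close> by (simp add: vnorm_sq)
  then show ?thesis by (simp only: power2_eq_iff_nonneg vnorm_nonneg zero_le_one)
qed

text \<open>The \<open>2 * K\<close> applications that start at a point mass never see beyond
  distance \<open>R\<close>, so each of them obeys the local estimate. Passing to the adjoint
  exchanges \<open>\<alpha>\<close> and \<open>\<beta>\<close> and leaves the factor
  \<open>\<alpha> + \<beta>\<close> unchanged.\<close>

lemma vnorm_local_iterate:
  assumes fin: "finite I" "finite J" and lt: "local_tree d I s R len" and p0: "p0 < d" and a0: "a0 \<in> J"
    and col: "col_bound I J C \<alpha>" "\<alpha> \<ge> 0" and row: "row_bound I J C \<beta>" "\<beta> \<ge> 0" and K: "2 * K \<le> R"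
  shows "vnorm (J \<times> {..<d}) (((\<lambda>v. tapp I J s (adj_coeff C) (tapp I J s C v)) ^^ K) (delta (a0, p0)))
    \<le> (\<alpha> + \<beta>) ^ (2 * K)"
proof -
  let ?P = "\<lambda>v. tapp I J s (adj_coeff C) (tapp I J s C v)"
  have "vnorm (J \<times> {..<d}) ((?P ^^ k) (delta (a0, p0))) \<le> (\<alpha> + \<beta>) ^ (2 * k)
    \<and> (\<forall>b\<in>J. \<forall>q<d. len p0 q > 2 * k \<longrightarrow> (?P ^^ k) (delta (a0, p0)) (b, q) = 0)" if "2 * k \<le> R" for k
    using that
  proof (induction k)
    case 0
    have "len p0 p0 = 0" using lt p0 by (auto simp: local_tree_def)
    moreover have "vnorm (J \<times> {..<d}) (delta (a0, p0)) = 1" using fin a0 p0 by (intro vnorm_delta) auto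
    ultimately show ?case by (auto simp: delta_def[of "(a0, p0)" "(b, q)" for b q])
  next
    case (Suc k)
    define v where "v = (?P ^^ k) (delta (a0, p0))"
    have v: "vnorm (J \<times> {..<d}) v \<le> (\<alpha> + \<beta>) ^ (2 * k)"
      "\<And>b q. b \<in> J \<Longrightarrow> q < d \<Longrightarrow> len p0 q > 2 * k \<Longrightarrow> v (b, q) = 0"
      using Suc by (auto simp: v_def)
    have n1: "vnorm (J \<times> {..<d}) (tapp I J s C v) \<le> (\<alpha> + \<beta>) * vnorm (J \<times> {..<d}) v"
      using Suc.prems by (intro vnorm_tapp_local[OF fin lt p0 col row] v) auto
    have s1: "tapp I J s C v (b, q) = 0" if "q < d" "len p0 q > Suc (2 * k)" for b q
      using Suc.prems that v(2)
      by (intro tapp_support[OF lt p0, where m="2 * k" and v=v]) auto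
    have n2: "vnorm (J \<times> {..<d}) (?P v) \<le> (\<beta> + \<alpha>) * vnorm (J \<times> {..<d}) (tapp I J s C v)"
      using Suc.prems
      by (intro vnorm_tapp_local[OF fin lt p0 col_bound_adj[OF row] row(2) row_bound_adj[OF col] col(2)] s1) auto
    have s2: "?P v (b, q) = 0" if "q < d" "len p0 q > Suc (Suc (2 * k))" for b q
      using Suc.prems that s1
      by (intro tapp_support[OF lt p0, where m="Suc (2 * k)" and v="tapp I J s C v"]) auto
    have "vnorm (J \<times> {..<d}) (?P v) \<le> (\<beta> + \<alpha>) * ((\<alpha> + \<beta>) * (\<alpha> + \<beta>) ^ (2 * k))"
      using col(2) row(2) by (intro order_trans[OF n2] mult_left_mono order_trans[OF n1] v) auto
    then show ?case using s2 by (simp add: v_def add.commute mult.assoc)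
  qed
  then show ?thesis using K by blast
qed


text \<open>If \<open>M\<close> is positive semidefinite then \<open>1 + M\<close> is injective, hence invertible.\<close>

lemma ex_right_inverse_one_plus:
  fixes M :: "nat \<Rightarrow> nat \<Rightarrow> complex"
  assumes psd: "\<And>y. Re (vinner {..<d} (kapp {..<d} M y) y) \<ge> 0"
  obtains f where "\<And>x p. p < d \<Longrightarrow> kapp {..<d} f x p + kapp {..<d} M (kapp {..<d} f x) p = x p"
proof -
  define G where "G = mat d d (\<lambda>(p, q). (if p = q then 1 else 0) + M p q)"
  have G: "G \<in> carrier_mat d d" by (simp add: G_def)
  have Gv: "(G *\<^sub>v v) $ p = v $ p + kapp {..<d} M (\<lambda>q. v $ q) p" if "p < d" "v \<in> carrier_vec d" for v p
  proof -
    have "(G *\<^sub>v v) $ p = (\<Sum>q<d. (if q = p then v $ p else 0) + M p q * v $ q)"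
      using that by (auto simp: G_def scalar_prod_def atLeast0LessThan distrib_right intro!: sum.cong)
    then show ?thesis using that by (simp add: sum.distrib kapp_def)
  qed
  have "det G \<noteq> 0"
  proof
    assume "det G = 0"
    then obtain v where v: "v \<in> carrier_vec d" "v \<noteq> 0\<^sub>v d" "G *\<^sub>v v = 0\<^sub>v d"
      using det_0_iff_vec_prod_zero_field[OF G] by blast
    define y where "y q = v $ q" for q
    have "kapp {..<d} M y p = - y p" if "p < d" for p
    proof -
      have "(G *\<^sub>v v) $ p = 0" unfolding v(3) using that by simp
      then show ?thesis unfolding Gv[OF that v(1)] y_def by (simp add: add_eq_0_iff)
    qed
    then have "vinner {..<d} (kapp {..<d} M y) y = - vinner {..<d} y y"
      by (simp add: vinner_def sum_negf)
    then have "(vnorm {..<d} y)\<^sup>2 \<le> 0" using psd[of y] by (simp add: vinner_self)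
    then have "vnorm {..<d} y = 0" by simp
    then have "\<forall>q<d. y q = 0" by (simp add: vnorm_def L2_set_eq_0_iff)
    then have "v = 0\<^sub>v d" using v(1) by (intro eq_vecI) (auto simp: y_def)
    with v(2) show False by simp
  qed
  then have "G \<in> Units (ring_mat TYPE(complex) d ())" using G by (intro det_non_zero_imp_unit)
  then obtain F where F: "F \<in> carrier_mat d d" "G * F = 1\<^sub>m d"
    unfolding Units_def ring_mat_def by auto
  define f where "f p q = F $$ (p, q)" for p q
  have "kapp {..<d} f x p + kapp {..<d} M (kapp {..<d} f x) p = x p" if p: "p < d" for x p
  proof -
    define u where "u = vec d x"
    have u: "u \<in> carrier_vec d" by (simp add: u_def)
    have Fu: "(F *\<^sub>v u) $ q = kapp {..<d} f x q" if "q < d" for q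
      using F that by (auto simp: scalar_prod_def atLeast0LessThan kapp_def f_def u_def intro!: sum.cong)
    have "G *\<^sub>v (F *\<^sub>v u) = u" using F G u by (simp flip: assoc_mult_mat_vec)
    then have "(F *\<^sub>v u) $ p + kapp {..<d} M (\<lambda>q. (F *\<^sub>v u) $ q) p = u $ p"
      using Gv[OF p, of "F *\<^sub>v u"] F u by simp
    moreover have "kapp {..<d} M (\<lambda>q. (F *\<^sub>v u) $ q) p = kapp {..<d} M (kapp {..<d} f x) p"
      unfolding kapp_def[of _ M] using Fu by (intro sum.cong) auto
    ultimately show ?thesis using p Fu[OF p] by (simp add: u_def)
  qed
  then show ?thesis by (rule that)
qed

lemma sum_square_le_card_sum_squares:
  fixes g :: "'i \<Rightarrow> real"
  assumes "\<And>i. i \<in> A \<Longrightarrow> g i \<ge> 0"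
  shows "(\<Sum>i\<in>A. g i)\<^sup>2 \<le> real (card A) * (\<Sum>i\<in>A. (g i)\<^sup>2)"
proof -
  have "(\<Sum>i\<in>A. g i) \<le> L2_set g A * L2_set (\<lambda>_. 1) A"
    using L2_set_mult_ineq[of g "\<lambda>_. 1" A] assms by simp
  then have "(\<Sum>i\<in>A. g i)\<^sup>2 \<le> (L2_set g A * L2_set (\<lambda>_. 1) A)\<^sup>2"
    using assms by (intro power_mono sum_nonneg)
  then show ?thesis by (simp add: power_mult_distrib L2_set_def sum_nonneg mult.commute)
qed

lemma vinner_add_left: "vinner K (\<lambda>k. u k + v k) w = vinner K u w + vinner K v w"
  by (simp add: vinner_def distrib_right sum.distrib)

lemma vinner_add_right: "vinner K w (\<lambda>k. u k + v k) = vinner K w u + vinner K w v"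
  by (simp add: vinner_def distrib_left sum.distrib)

lemma kapp_add: "kapp K M (\<lambda>k. u k + v k) l = kapp K M u l + kapp K M v l"
  by (simp add: kapp_def distrib_left sum.distrib)

text \<open>With \<open>y = (1 + M)^{-1} x\<close> and \<open>z = M y\<close> one has
  \<open>x = y + z\<close>. Expanding the square of \<open>norm x\<close> gives the first two
  bounds, expanding the form of \<open>M\<close> at \<open>x\<close> the third; all discarded terms
  are nonnegative.\<close>

lemma resolvent_bounds:
  fixes M :: "nat \<Rightarrow> nat \<Rightarrow> complex"
  assumes herm: "\<And>p q. M p q = cnj (M q p)"
    and psd: "\<And>y. Re (vinner {..<d} (kapp {..<d} M y) y) \<ge> 0"
    and f: "\<And>x p. p < d \<Longrightarrow> kapp {..<d} f x p + kapp {..<d} M (kapp {..<d} f x) p = x p"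
  shows "vnorm {..<d} (kapp {..<d} f x) \<le> vnorm {..<d} x"
    and "2 * Re (vinner {..<d} (kapp {..<d} M (kapp {..<d} f x)) (kapp {..<d} f x)) \<le> (vnorm {..<d} x)\<^sup>2"
    and "2 * (vnorm {..<d} (\<lambda>p. x p - kapp {..<d} f x p))\<^sup>2 \<le> Re (vinner {..<d} (kapp {..<d} M x) x)"
proof -
  let ?D = "{..<d}"
  define y where "y = kapp ?D f x"
  define z where "z = kapp ?D M y"
  have xyz: "x p = y p + z p" if "p < d" for p using f[OF that, of x] by (simp add: y_def z_def)
  have self: "vinner ?D (kapp ?D M u) w = vinner ?D u (kapp ?D M w)" for u w
  proof -
    have "(\<lambda>k l. cnj (M l k)) = M" by (intro ext) (rule herm[symmetric])
    then show ?thesis unfolding vinner_kapp_left by simp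
  qed
  have "vinner ?D x x = vinner ?D (\<lambda>p. y p + z p) (\<lambda>p. y p + z p)" by (intro vinner_cong) (auto simp: xyz)
  also have "\<dots> = vinner ?D y y + vinner ?D y z + (vinner ?D z y + vinner ?D z z)"
    by (simp add: vinner_add_left vinner_add_right)
  also have "vinner ?D y z = cnj (vinner ?D z y)" by (rule vinner_commute)
  finally have "Re (vinner ?D x x) = Re (vinner ?D y y) + 2 * Re (vinner ?D z y) + Re (vinner ?D z z)" by simp
  then have eq: "(vnorm ?D x)\<^sup>2 = (vnorm ?D y)\<^sup>2 + 2 * Re (vinner ?D z y) + (vnorm ?D z)\<^sup>2"
    by (simp add: vinner_self)
  have Q: "Re (vinner ?D z y) \<ge> 0" using psd by (simp add: z_def)
  have "(vnorm ?D y)\<^sup>2 \<le> (vnorm ?D x)\<^sup>2" using eq Q by simp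
  then show "vnorm ?D (kapp ?D f x) \<le> vnorm ?D x" unfolding y_def by (rule power2_le_imp_le) simp
  show "2 * Re (vinner ?D (kapp ?D M (kapp ?D f x)) (kapp ?D f x)) \<le> (vnorm ?D x)\<^sup>2"
    using eq unfolding z_def y_def by (simp add: add_increasing)
  have "vinner ?D (kapp ?D M x) x = vinner ?D (\<lambda>p. kapp ?D M y p + kapp ?D M z p) (\<lambda>p. y p + z p)"
  proof (intro vinner_cong)
    fix p assume "p \<in> ?D"
    have "kapp ?D M x p = kapp ?D M (\<lambda>k. y k + z k) p" unfolding kapp_def by (intro sum.cong) (auto simp: xyz)
    then show "kapp ?D M x p = kapp ?D M y p + kapp ?D M z p" by (simp add: kapp_add)
  qed (auto simp: xyz)
  also have "\<dots> = vinner ?D z y + vinner ?D z z + (vinner ?D (kapp ?D M z) y + vinner ?D (kapp ?D M z) z)"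
    by (simp add: vinner_add_left vinner_add_right z_def)
  also have "vinner ?D (kapp ?D M z) y = vinner ?D z z" by (simp add: self z_def)
  finally have "Re (vinner ?D (kapp ?D M x) x) = Re (vinner ?D z y) + 2 * (vnorm ?D z)\<^sup>2 + Re (vinner ?D (kapp ?D M z) z)"
    by (simp add: vinner_self)
  then have "2 * (vnorm ?D z)\<^sup>2 \<le> Re (vinner ?D (kapp ?D M x) x)" using Q psd[of z] by simp
  moreover have "vnorm ?D (\<lambda>p. x p - kapp ?D f x p) = vnorm ?D z"
    by (rule vnorm_cong) (auto simp: xyz simp flip: y_def)
  ultimately show "2 * (vnorm ?D (\<lambda>p. x p - kapp ?D f x p))\<^sup>2 \<le> Re (vinner ?D (kapp ?D M x) x)" by simp
qed

text \<open>The operator \<open>L\<^sup>* L\<close> on \<open>\<complex>\<^sup>J \<otimes> \<complex>\<^sup>d\<close> is dominated by \<open>card J\<close> times \<open>1 \<otimes> M\<close>, where \<open>M\<close> is its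
  partial trace over \<open>\<complex>\<^sup>J\<close>, so compressing by the resolvent of \<open>M\<close> controls \<open>L\<close>.\<close>

lemma partial_trace_cut:
  fixes m :: "'l \<Rightarrow> 'j \<times> nat \<Rightarrow> complex"
  assumes fin: "finite J" "finite Kl" and c: "c > 0"
    and small: "\<And>a p. a \<in> J \<Longrightarrow> p < d \<Longrightarrow> (vnorm Kl (\<lambda>k. m k (a, p)))\<^sup>2 \<le> c * t"
  obtains f where
    "\<And>v. (vnorm Kl (kapp (J \<times> {..<d}) m (\<lambda>(a, p). kapp {..<d} f (\<lambda>q. v (a, q)) p)))\<^sup>2
       \<le> c * (vnorm (J \<times> {..<d}) v)\<^sup>2"
    "\<And>x. vnorm {..<d} (kapp {..<d} f x) \<le> vnorm {..<d} x"
    "\<And>q. q < d \<Longrightarrow> (vnorm {..<d} (\<lambda>p. delta q p - f p q))\<^sup>2 \<le> (real (card J))\<^sup>2 * t"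
proof -
  let ?D = "{..<d}"
  \<comment> \<open>The factor \<open>card J\<close> makes the scaled partial trace dominate;
    dividing by \<open>c\<close> moves the threshold of the resolvent to \<open>1\<close>.\<close>
  define r where "r = real (card J) / c"
  have r: "r \<ge> 0" using c by (simp add: r_def)
  define ma where "ma a = (\<lambda>k q. m k (a, q))" for a
  define M where "M p q = complex_of_real r * (\<Sum>a\<in>J. \<Sum>k\<in>Kl. cnj (m k (a, p)) * m k (a, q))" for p q
  have herm: "M p q = cnj (M q p)" for p q by (simp add: M_def mult.commute)
  have Mq: "vinner ?D (kapp ?D M y) y = complex_of_real (r * (\<Sum>a\<in>J. (vnorm Kl (kapp ?D (ma a) y))\<^sup>2))" for y
  proof -
    have "kapp ?D M y p = complex_of_real r * (\<Sum>a\<in>J. kapp Kl (\<lambda>q k. cnj (ma a k q)) (kapp ?D (ma a) y) p)" for p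
    proof -
      have "kapp ?D M y p = (\<Sum>q<d. \<Sum>a\<in>J. \<Sum>k\<in>Kl. complex_of_real r * (cnj (m k (a, p)) * m k (a, q) * y q))"
        by (simp add: kapp_def M_def sum_distrib_left sum_distrib_right mult.assoc)
      also have "\<dots> = (\<Sum>a\<in>J. \<Sum>q<d. \<Sum>k\<in>Kl. complex_of_real r * (cnj (m k (a, p)) * m k (a, q) * y q))"
        by (rule sum.swap)
      also have "\<dots> = (\<Sum>a\<in>J. \<Sum>k\<in>Kl. \<Sum>q<d. complex_of_real r * (cnj (m k (a, p)) * m k (a, q) * y q))"
        by (intro sum.cong[OF refl] sum.swap)
      also have "\<dots> = complex_of_real r * (\<Sum>a\<in>J. kapp Kl (\<lambda>q k. cnj (ma a k q)) (kapp ?D (ma a) y) p)"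
        by (simp add: kapp_def ma_def sum_distrib_left mult.assoc)
      finally show ?thesis .
    qed
    then have "vinner ?D (kapp ?D M y) y
      = complex_of_real r * (\<Sum>p<d. \<Sum>a\<in>J. kapp Kl (\<lambda>q k. cnj (ma a k q)) (kapp ?D (ma a) y) p * cnj (y p))"
      by (simp add: vinner_def sum_distrib_left sum_distrib_right mult.assoc)
    also have "\<dots> = complex_of_real r * (\<Sum>a\<in>J. vinner ?D (kapp Kl (\<lambda>q k. cnj (ma a k q)) (kapp ?D (ma a) y)) y)"
      by (subst sum.swap) (simp add: vinner_def)
    also have "\<dots> = complex_of_real r * (\<Sum>a\<in>J. vinner Kl (kapp ?D (ma a) y) (kapp ?D (ma a) y))"
      unfolding vinner_kapp_left by simp
    finally show ?thesis by (simp add: vinner_self)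
  qed
  have psd: "Re (vinner ?D (kapp ?D M y) y) \<ge> 0" for y
    unfolding Mq using r by (simp add: sum_nonneg)
  obtain f where f: "\<And>x p. p < d \<Longrightarrow> kapp ?D f x p + kapp ?D M (kapp ?D f x) p = x p"
    using ex_right_inverse_one_plus[of d M, OF psd] by blast
  note rb = resolvent_bounds[of M d f, OF herm psd f]
  show ?thesis
  proof (rule that[of f])
    show "vnorm ?D (kapp ?D f x) \<le> vnorm ?D x" for x by (rule rb(1))
  next
    fix q assume q: "q < d"
    have fd: "kapp ?D f (delta q) p = f p q" for p
    proof -
      have "kapp ?D f (delta q) p = (\<Sum>k<d. if k = q then f p q else 0)"
        unfolding kapp_def delta_def by (intro sum.cong) auto
      then show ?thesis using q by simp
    qed
    have md: "kapp ?D (ma a) (delta q) k = m k (a, q)" for a k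
    proof -
      have "kapp ?D (ma a) (delta q) k = (\<Sum>l<d. if l = q then m k (a, q) else 0)"
        unfolding kapp_def delta_def ma_def by (intro sum.cong) auto
      then show ?thesis using q by simp
    qed
    have "2 * (vnorm ?D (\<lambda>p. delta q p - f p q))\<^sup>2 \<le> r * (\<Sum>a\<in>J. (vnorm Kl (\<lambda>k. m k (a, q)))\<^sup>2)"
      using rb(3)[of "delta q"] unfolding fd Mq by (simp add: vnorm_cong[OF md])
    \<comment> \<open>The second factor \<open>card J\<close>: the partial trace has that many
      terms.\<close>
    also have "\<dots> \<le> r * (\<Sum>a\<in>J. c * t)" using q r by (intro mult_left_mono sum_mono small) auto
    also have "\<dots> = (real (card J))\<^sup>2 * t" using c by (simp add: r_def power2_eq_square)
    finally show "(vnorm ?D (\<lambda>p. delta q p - f p q))\<^sup>2 \<le> (real (card J))\<^sup>2 * t"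
      using zero_le_power2[of "vnorm ?D (\<lambda>p. delta q p - f p q)"] by linarith
  next
    fix v :: "'j \<times> nat \<Rightarrow> complex"
    define y where "y a = kapp ?D f (\<lambda>q. v (a, q))" for a
    have "kapp (J \<times> ?D) m (\<lambda>(a, p). y a p) k = (\<Sum>a\<in>J. kapp ?D (ma a) (y a) k)" for k
      by (simp add: kapp_def ma_def sum_pairs)
    then have "vnorm Kl (kapp (J \<times> ?D) m (\<lambda>(a, p). y a p)) = vnorm Kl (\<lambda>k. \<Sum>a\<in>J. kapp ?D (ma a) (y a) k)"
      by (intro vnorm_cong)
    also have "\<dots> \<le> (\<Sum>a\<in>J. vnorm Kl (kapp ?D (ma a) (y a)))"
      using fin(1)
    proof (induction J rule: finite_induct)
      case empty
      then show ?case by (simp add: vnorm_def L2_set_0')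
    next
      case (insert a J)
      then show ?case
        using vnorm_triangle[of Kl "kapp ?D (ma a) (y a)" "\<lambda>k. \<Sum>a\<in>J. kapp ?D (ma a) (y a) k"] by simp
    qed
    finally have "(vnorm Kl (kapp (J \<times> ?D) m (\<lambda>(a, p). y a p)))\<^sup>2 \<le> (\<Sum>a\<in>J. vnorm Kl (kapp ?D (ma a) (y a)))\<^sup>2"
      by (intro power_mono) auto
    also have "\<dots> \<le> real (card J) * (\<Sum>a\<in>J. (vnorm Kl (kapp ?D (ma a) (y a)))\<^sup>2)"
      by (rule sum_square_le_card_sum_squares) simp
    \<comment> \<open>Adding the terms with \<open>a' \<noteq> a\<close> replaces the diagonal block
      of \<open>a\<close> by the full partial trace, the same operator for every
      \<open>a\<close>.\<close>
    also have "\<dots> \<le> real (card J) * (\<Sum>a\<in>J. \<Sum>a'\<in>J. (vnorm Kl (kapp ?D (ma a') (y a)))\<^sup>2)"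
      using fin(1) by (intro mult_left_mono sum_mono member_le_sum) auto
    also have "\<dots> = c * (\<Sum>a\<in>J. Re (vinner ?D (kapp ?D M (y a)) (y a)))"
      unfolding Mq using c by (simp add: r_def sum_distrib_left)
    also have "\<dots> \<le> c * (\<Sum>a\<in>J. (vnorm ?D (\<lambda>q. v (a, q)))\<^sup>2)"
    proof (intro mult_left_mono sum_mono)
      fix a
      show "Re (vinner ?D (kapp ?D M (y a)) (y a)) \<le> (vnorm ?D (\<lambda>q. v (a, q)))\<^sup>2"
        using rb(2)[of "\<lambda>q. v (a, q)"] psd[of "y a"] unfolding y_def by linarith
    qed (use c in auto)
    also have "(\<Sum>a\<in>J. (vnorm ?D (\<lambda>q. v (a, q)))\<^sup>2) = (vnorm (J \<times> ?D) v)\<^sup>2"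
      unfolding vnorm_sq by (simp add: sum_pairs)
    finally show "(vnorm Kl (kapp (J \<times> ?D) m (\<lambda>(a, p). kapp ?D f (\<lambda>q. v (a, q)) p)))\<^sup>2
       \<le> c * (vnorm (J \<times> ?D) v)\<^sup>2" unfolding y_def .
  qed
qed


section \<open>Kernels of iterates and the cut\<close>

definition krep :: "'k set \<Rightarrow> (('k \<Rightarrow> complex) \<Rightarrow> 'k \<Rightarrow> complex) \<Rightarrow> bool" where
  "krep K F \<longleftrightarrow> (\<exists>m. \<forall>v. \<forall>k\<in>K. F v k = kapp K m v k)"

lemma kapp_delta: "finite K \<Longrightarrow> l \<in> K \<Longrightarrow> kapp K m (delta l) k = m k l"
proof -
  assume "finite K" "l \<in> K"
  have "kapp K m (delta l) k = (\<Sum>j\<in>K. if j = l then m k l else 0)"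
    unfolding kapp_def delta_def by (intro sum.cong) auto
  then show ?thesis using \<open>finite K\<close> \<open>l \<in> K\<close> by simp
qed

text \<open>Operators here act on total functions. Having a kernel says that only the values on
  \<open>K\<close> enter, and linearly, so the images of point masses determine the
  operator.\<close>

lemma krep_kernel:
  assumes "krep K F" "finite K" "k \<in> K"
  shows "F v k = kapp K (\<lambda>k l. F (delta l) k) v k"
proof -
  obtain m where m: "\<And>v k. k \<in> K \<Longrightarrow> F v k = kapp K m v k" using assms(1) unfolding krep_def by blast
  have "kapp K m v k = kapp K (\<lambda>k l. F (delta l) k) v k"
    using m[OF assms(3)] unfolding kapp_def[of _ _ v]
    by (intro sum.cong) (simp_all add: kapp_delta assms(2))
  then show ?thesis using m[OF assms(3)] by simp
qed

lemma krep_id: "finite K \<Longrightarrow> krep K (\<lambda>v. v)"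
  unfolding krep_def
proof (intro exI allI ballI)
  fix v :: "'a \<Rightarrow> complex" and k assume "finite K" "k \<in> K"
  have "kapp K delta v k = (\<Sum>l\<in>K. if l = k then v k else 0)"
    unfolding kapp_def delta_def by (intro sum.cong) auto
  then show "v k = kapp K delta v k" using \<open>finite K\<close> \<open>k \<in> K\<close> by simp
qed

lemma krep_comp:
  assumes "krep K F" "krep K G" shows "krep K (\<lambda>v. F (G v))"
proof -
  obtain mF where F: "\<And>v k. k \<in> K \<Longrightarrow> F v k = kapp K mF v k" using assms(1) unfolding krep_def by blast
  obtain mG where G: "\<And>v k. k \<in> K \<Longrightarrow> G v k = kapp K mG v k" using assms(2) unfolding krep_def by blast
  have "F (G v) k = kapp K (\<lambda>k l. \<Sum>j\<in>K. mF k j * mG j l) v k" if "k \<in> K" for v k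
  proof -
    have "F (G v) k = (\<Sum>j\<in>K. mF k j * (\<Sum>l\<in>K. mG j l * v l))"
      unfolding F[OF that] unfolding kapp_def[of _ mF] by (intro sum.cong) (simp_all add: G kapp_def)
    also have "\<dots> = (\<Sum>j\<in>K. \<Sum>l\<in>K. mF k j * mG j l * v l)" by (simp add: sum_distrib_left mult.assoc)
    also have "\<dots> = (\<Sum>l\<in>K. \<Sum>j\<in>K. mF k j * mG j l * v l)" by (rule sum.swap)
    finally show ?thesis by (simp add: kapp_def sum_distrib_right)
  qed
  then show ?thesis unfolding krep_def by blast
qed

lemma krep_tapp:
  assumes lt: "local_tree d I s R len" shows "krep (J \<times> {..<d}) (tapp I J s C)"
proof -
  define m where "m = (\<lambda>(a, p) (b, q). \<Sum>i\<in>I. if q = s i p then C i a b else 0)"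
  have "tapp I J s C v k = kapp (J \<times> {..<d}) m v k" if kK: "k \<in> J \<times> {..<d}" for v k
  proof -
    obtain a p where k: "k = (a, p)" "a \<in> J" "p < d" using kK by auto
    have "kapp (J \<times> {..<d}) m v k = (\<Sum>b\<in>J. \<Sum>q<d. \<Sum>i\<in>I. if q = s i p then C i a b * v (b, s i p) else 0)"
      unfolding kapp_def k m_def sum_pairs by (auto simp: sum_distrib_right intro!: sum.cong)
    also have "\<dots> = (\<Sum>b\<in>J. \<Sum>i\<in>I. \<Sum>q<d. if q = s i p then C i a b * v (b, s i p) else 0)"
      by (intro sum.cong[OF refl] sum.swap)
    also have "\<dots> = (\<Sum>b\<in>J. \<Sum>i\<in>I. C i a b * v (b, s i p))"
      using lt k by (intro sum.cong[OF refl]) (auto simp: local_tree_def)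
    also have "\<dots> = tapp I J s C v k" unfolding tapp_def k by (simp add: sum.swap[of _ J I])
    finally show ?thesis by simp
  qed
  then show ?thesis unfolding krep_def by blast
qed

text \<open>Log-convexity of the moments of the positive operator \<open>T\<^sup>* T\<close>.\<close>

lemma vnorm_le_of_iterate:
  assumes adj: "\<And>v w. vinner K (T v) w = vinner K v (T' w)"
    and adj': "\<And>v w. vinner K (T' v) w = vinner K v (T w)"
    and w: "vnorm K w \<le> n" and B: "B > 0"
    and it: "vnorm K (((\<lambda>v. T' (T v)) ^^ (2 ^ k)) w) \<le> B ^ (2 * 2 ^ k) * n"
  shows "vnorm K (T w) \<le> B * n"
proof -
  define P where "P = (\<lambda>v. T' (T v))"
  have n: "n \<ge> 0" using w vnorm_nonneg order_trans by blast
  have sa: "vinner K (P v) u = vinner K v (P u)" for u v unfolding P_def by (simp add: adj adj')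
  have sam: "vinner K ((P ^^ m) v) u = vinner K v ((P ^^ m) u)" for u v m
  proof (induction m arbitrary: u)
    case (Suc m)
    have "vinner K ((P ^^ Suc m) v) u = vinner K v ((P ^^ m) (P u))" by (simp add: sa Suc)
    then show ?case by (simp add: funpow_swap1)
  qed simp
  have sq: "(vnorm K ((P ^^ m) w))\<^sup>2 \<le> n * vnorm K ((P ^^ (m + m)) w)" for m
  proof -
    have "complex_of_real ((vnorm K ((P ^^ m) w))\<^sup>2) = vinner K w ((P ^^ (m + m)) w)"
      unfolding vinner_self[symmetric] sam by (simp add: funpow_add)
    then have "(vnorm K ((P ^^ m) w))\<^sup>2 = cmod (vinner K w ((P ^^ (m + m)) w))"
      by (metis norm_of_real abs_of_nonneg zero_le_power2)
    also have "\<dots> \<le> n * vnorm K ((P ^^ (m + m)) w)"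
      by (rule order_trans[OF cmod_vinner_le]) (intro mult_right_mono w vnorm_nonneg)
    finally show ?thesis .
  qed
  have "vnorm K ((P ^^ (2 ^ j)) w) \<le> B ^ (2 * 2 ^ j) * n"
    if "vnorm K ((P ^^ (2 ^ k)) w) \<le> B ^ (2 * 2 ^ k) * n" "j \<le> k" for j
    using that(2)
  proof (induction j rule: inc_induct)
    case (step j)
    have "(vnorm K ((P ^^ (2 ^ j)) w))\<^sup>2 \<le> n * vnorm K ((P ^^ (2 ^ Suc j)) w)"
      using sq[of "2 ^ j"] by (simp add: mult_2)
    also have "\<dots> \<le> n * (B ^ (2 * 2 ^ Suc j) * n)" by (intro mult_left_mono step.IH n)
    also have "\<dots> = (B ^ (2 * 2 ^ j) * n)\<^sup>2" by (simp add: power_mult_distrib power2_eq_square mult_2 power_add)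
    finally show ?case using B n by (intro power2_le_imp_le[OF _ mult_nonneg_nonneg]) auto
  qed (use that in simp)
  from this[of 0] it have P1: "vnorm K (P w) \<le> B\<^sup>2 * n" by (simp add: P_def)
  have "complex_of_real ((vnorm K (T w))\<^sup>2) = vinner K w (P w)"
    unfolding vinner_self[symmetric] P_def adj ..
  then have "(vnorm K (T w))\<^sup>2 = cmod (vinner K w (P w))"
    by (metis norm_of_real abs_of_nonneg zero_le_power2)
  also have "\<dots> \<le> n * (B\<^sup>2 * n)"
    by (rule order_trans[OF cmod_vinner_le]) (intro mult_mono w P1 n vnorm_nonneg)
  also have "\<dots> = (B * n)\<^sup>2" by (simp add: power2_eq_square)
  finally show ?thesis using B n by (intro power2_le_imp_le[OF _ mult_nonneg_nonneg]) auto
qed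

lemma adj_coeff_adj_coeff: "adj_coeff (adj_coeff C) = C"
  by (simp add: adj_coeff_def fun_eq_iff)

text \<open>The moments are bounded on point masses only, not in norm. That bounds the columns of
  the kernel of \<open>P ^^ (2 ^ k)\<close> and so its partial trace; the resolvent cut turns this
  into a norm bound after compression, and log-convexity descends from the power to the operator
  itself.\<close>

lemma ex_cut:
  fixes J :: "'j set"
  assumes fin: "finite I" "finite J" and lt: "local_tree d I s R len"
    and col: "col_bound I J C \<alpha>" "\<alpha> \<ge> 0" and row: "row_bound I J C \<beta>" "\<beta> \<ge> 0"
    and R: "2 * 2 ^ k \<le> R" and B: "B > 0"
  obtains f where
    "\<And>v. vnorm (J \<times> {..<d}) (tapp I J s C (\<lambda>(a, p). kapp {..<d} f (\<lambda>q. v (a, q)) p)) \<le> B * vnorm (J \<times> {..<d}) v"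
    "\<And>x. vnorm {..<d} (kapp {..<d} f x) \<le> vnorm {..<d} x"
    "\<And>q. q < d \<Longrightarrow> (vnorm {..<d} (\<lambda>p. delta q p - f p q))\<^sup>2 \<le> (real (card J))\<^sup>2 * ((\<alpha> + \<beta>) / B) ^ (4 * 2 ^ k)"
proof -
  let ?KK = "J \<times> {..<d}" and ?K = "2 ^ k :: nat"
  define P where "P = (\<lambda>v. tapp I J s (adj_coeff C) (tapp I J s C v))"
  have finKK: "finite ?KK" using fin by simp
  have kP: "krep ?KK (P ^^ m)" for m
  proof (induction m)
    case 0
    then show ?case using krep_id[OF finKK] by (simp add: id_def)
  next
    case (Suc m)
    have "krep ?KK (\<lambda>v. P ((P ^^ m) v))"
      unfolding P_def by (intro krep_comp[OF krep_tapp[OF lt]] krep_comp[OF krep_tapp[OF lt]] Suc[unfolded P_def])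
    then show ?case by (simp add: o_def)
  qed
  define m where "m k l = (P ^^ ?K) (delta l) k" for k l
  have small: "(vnorm ?KK (\<lambda>k. m k (a, p)))\<^sup>2 \<le> B ^ (4 * ?K) * ((\<alpha> + \<beta>) / B) ^ (4 * ?K)"
    if "a \<in> J" "p < d" for a p
  proof -
    have "(vnorm ?KK (\<lambda>k. m k (a, p)))\<^sup>2 \<le> ((\<alpha> + \<beta>) ^ (2 * ?K))\<^sup>2"
      unfolding m_def P_def using vnorm_local_iterate[OF fin lt that(2) that(1) col row R]
      by (intro power_mono) auto
    also have "\<dots> = B ^ (4 * ?K) * ((\<alpha> + \<beta>) / B) ^ (4 * ?K)"
      using B by (simp add: power_divide flip: power_mult)
    finally show ?thesis .
  qed
  have "B ^ (4 * ?K) > 0" using B by simp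
  from partial_trace_cut[where m=m and d=d and t="((\<alpha> + \<beta>) / B) ^ (4 * ?K)", OF fin(2) finKK this small]
  obtain f where
    f1: "\<And>v. (vnorm ?KK (kapp ?KK m (\<lambda>(a, p). kapp {..<d} f (\<lambda>q. v (a, q)) p)))\<^sup>2 \<le> B ^ (4 * ?K) * (vnorm ?KK v)\<^sup>2"
    and f2: "\<And>x. vnorm {..<d} (kapp {..<d} f x) \<le> vnorm {..<d} x"
    and f3: "\<And>q. q < d \<Longrightarrow> (vnorm {..<d} (\<lambda>p. delta q p - f p q))\<^sup>2 \<le> (real (card J))\<^sup>2 * ((\<alpha> + \<beta>) / B) ^ (4 * ?K)"
    by blast
  show ?thesis
  proof (rule that[OF _ f2 f3])
    fix v :: "'j \<times> nat \<Rightarrow> complex"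
    define w where "w = (\<lambda>(a, p). kapp {..<d} f (\<lambda>q. v (a, q)) p)"
    have "(vnorm ?KK w)\<^sup>2 = (\<Sum>a\<in>J. (vnorm {..<d} (kapp {..<d} f (\<lambda>q. v (a, q))))\<^sup>2)"
      unfolding vnorm_sq w_def by (simp add: sum_pairs)
    also have "\<dots> \<le> (\<Sum>a\<in>J. (vnorm {..<d} (\<lambda>q. v (a, q)))\<^sup>2)"
      by (intro sum_mono power_mono f2) auto
    also have "\<dots> = (vnorm ?KK v)\<^sup>2" unfolding vnorm_sq by (simp add: sum_pairs)
    finally have nw: "vnorm ?KK w \<le> vnorm ?KK v" by (rule power2_le_imp_le) simp
    have "vnorm ?KK ((P ^^ ?K) w) = vnorm ?KK (kapp ?KK m w)"
      unfolding m_def by (intro vnorm_cong krep_kernel[OF kP finKK])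
    also have "\<dots> \<le> B ^ (2 * ?K) * vnorm ?KK v"
    proof (rule power2_le_imp_le)
      have "(B ^ (2 * ?K) * vnorm ?KK v)\<^sup>2 = B ^ (4 * ?K) * (vnorm ?KK v)\<^sup>2"
        by (simp add: power_mult_distrib flip: power_mult)
      then show "(vnorm ?KK (kapp ?KK m w))\<^sup>2 \<le> (B ^ (2 * ?K) * vnorm ?KK v)\<^sup>2"
        using f1[of v] unfolding w_def by simp
    qed (use B in auto)
    finally have it: "vnorm ?KK ((P ^^ ?K) w) \<le> B ^ (2 * ?K) * vnorm ?KK v" .
    have "vnorm ?KK (tapp I J s C w) \<le> B * vnorm ?KK v"
      using vnorm_le_of_iterate[where T="tapp I J s C" and T'="tapp I J s (adj_coeff C)", OF
          vinner_tapp[OF lt] vinner_tapp[OF lt, of J "adj_coeff C", unfolded adj_coeff_adj_coeff] nw B]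
        it unfolding P_def by blast
    then show "vnorm ?KK (tapp I J s C (\<lambda>(a, p). kapp {..<d} f (\<lambda>q. v (a, q)) p)) \<le> B * vnorm ?KK v"
      unfolding w_def .
  qed
qed

section \<open>Embezzling weights\<close>

definition hsum :: "nat \<Rightarrow> real" where "hsum n = (\<Sum>j<n. 1 / (real j + 1))"

lemma hsum_ge_ln: "ln (real n + 1) \<le> hsum n"
proof (induction n)
  case (Suc n)
  have "real n + 1 \<noteq> 0" by linarith
  then have "(real n + 1) * (1 + 1 / (real n + 1)) = real (Suc n) + 1" by (simp add: distrib_left)
  then have "ln (real (Suc n) + 1) = ln ((real n + 1) * (1 + 1 / (real n + 1)))" by simp
  also have "\<dots> = ln (real n + 1) + ln (1 + 1 / (real n + 1))"
    by (rule ln_mult_pos) (auto intro: add_nonneg_pos)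
  also have "ln (1 + 1 / (real n + 1)) \<le> 1 / (real n + 1)"
    by (intro ln_add_one_self_le_self) auto
  finally show ?case using Suc by (simp add: hsum_def)
qed (simp add: hsum_def)

lemma sum_inverse_squares_le: "(\<Sum>j<n. 1 / (real j + 1)\<^sup>2) \<le> 2"
proof -
  have "(\<Sum>j<Suc n. 1 / (real j + 1)\<^sup>2) \<le> 2 - 1 / (real n + 1)" for n
  proof (induction n)
    case (Suc n)
    have "1 / (real (Suc n) + 1)\<^sup>2 \<le> 1 / ((real n + 1) * (real (Suc n) + 1))"
      by (intro divide_left_mono) (auto simp: power2_eq_square mult_right_mono)
    also have "\<dots> = 1 / (real n + 1) - 1 / (real (Suc n) + 1)" by (simp add: divide_simps)
    finally show ?case using Suc by simp
  qed simp
  moreover have "(\<Sum>j<n. 1 / (real j + 1)\<^sup>2) \<le> (\<Sum>j<Suc n. 1 / (real j + 1)\<^sup>2)" by simp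
  ultimately show ?thesis using zero_le_divide_1_iff[of "real n + 1"] by (meson diff_le_eq le_add_same_cancel1 of_nat_0_le_iff order_trans add_nonneg_nonneg zero_le_one)
qed

text \<open>Each further block of \<open>K\<close> terms adds at most \<open>1\<close>. The bound is
  crude but independent of \<open>K\<close>, so it is negligible against \<open>hsum (M * K)\<close>
  as \<open>K\<close> grows.\<close>

lemma hsum_mult_le: "K > 0 \<Longrightarrow> hsum (M * K) \<le> hsum K + real M"
proof (induction M)
  case (Suc M)
  show ?case
  proof (cases "M = 0")
    case False
    have *: "(\<Sum>j<a + m. 1 / (real j + 1)) = (\<Sum>j<a. 1 / (real j + 1)) + (\<Sum>j<m. 1 / (real (a + j) + 1))" for a m
      by (induction m) simp_all
    have "(\<Sum>j<K. 1 / (real (M * K + j) + 1)) \<le> (\<Sum>j<K. 1 / real K)"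
    proof (intro sum_mono divide_left_mono)
      fix j
      have "K \<le> M * K" using False by simp
      then show "real K \<le> real (M * K + j) + 1" by linarith
      show "0 < (real (M * K + j) + 1) * real K" using Suc.prems by (intro mult_pos_pos) linarith+
    qed simp
    also have "\<dots> = 1" using Suc.prems by simp
    finally have "hsum (M * K + K) \<le> hsum (M * K) + 1" unfolding hsum_def * by simp
    then show ?thesis using Suc by (simp add: add.commute)
  qed simp
qed (simp add: hsum_def sum_nonneg)

text \<open>The mass \<open>coupling l j k\<close> is \<open>1 / l\<close> times the length of the intersection of
  \<open>[l\<^sup>2 j, l\<^sup>2 (j + 1)]\<close> and \<open>[k, k + 1]\<close>.\<close>

definition coupling :: "real \<Rightarrow> nat \<Rightarrow> nat \<Rightarrow> real" where
  "coupling l j k = ((min (l\<^sup>2 * (real j + 1)) (real k + 1) - min (l\<^sup>2 * (real j + 1)) (real k))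
     - (min (l\<^sup>2 * real j) (real k + 1) - min (l\<^sup>2 * real j) (real k))) / l"

lemma coupling_nonneg: assumes "l > 0" shows "coupling l j k \<ge> 0"
proof -
  have "0 \<le> (min b (x + 1) - min b x) - (min a (x + 1) - min a x)" if "a \<le> b" for a b x :: real
    using that by (auto simp: min_def)
  moreover have "l\<^sup>2 * real j \<le> l\<^sup>2 * (real j + 1)" by (intro mult_left_mono) auto
  ultimately show ?thesis using assms unfolding coupling_def by (intro divide_nonneg_pos)
qed

lemma coupling_eq_0: assumes "l\<^sup>2 * (real j + 1) \<le> real k" shows "coupling l j k = 0"
proof -
  have "l\<^sup>2 * real j \<le> l\<^sup>2 * (real j + 1)" by (intro mult_left_mono) auto
  then show ?thesis using assms by (simp add: coupling_def min_def)
qed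

lemma coupling_row_sum:
  "(\<Sum>k<n. coupling l j k) = (min (l\<^sup>2 * (real j + 1)) (real n) - min (l\<^sup>2 * real j) (real n)) / l"
proof -
  define g where "g k = min (l\<^sup>2 * (real j + 1)) (real k) - min (l\<^sup>2 * real j) (real k)" for k :: nat
  have "(\<Sum>k<n. coupling l j k) = (\<Sum>k<n. g (Suc k) - g k) / l"
    unfolding sum_divide_distrib by (intro sum.cong) (auto simp: coupling_def g_def algebra_simps)
  also have "(\<Sum>k<n. g (Suc k) - g k) = g n - g 0" by (rule sum_lessThan_telescope)
  also have "g 0 = 0" by (simp add: g_def min.absorb2)
  finally show ?thesis by (simp add: g_def)
qed

lemma coupling_col_sum:
  "(\<Sum>j<n. coupling l j k) = (min (l\<^sup>2 * real n) (real k + 1) - min (l\<^sup>2 * real n) (real k)) / l"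
proof -
  define g where "g j = min (l\<^sup>2 * real j) (real k + 1) - min (l\<^sup>2 * real j) (real k)" for j :: nat
  have "(\<Sum>j<n. coupling l j k) = (\<Sum>j<n. g (Suc j) - g j) / l"
    unfolding sum_divide_distrib by (intro sum.cong) (auto simp: coupling_def g_def algebra_simps)
  also have "(\<Sum>j<n. g (Suc j) - g j) = g n - g 0" by (rule sum_lessThan_telescope)
  finally show ?thesis by (simp add: g_def)
qed

text \<open>A source interval has length \<open>l^2\<close> and so mass at most \<open>l\<close>; in
  the column estimate below, a target interval has length \<open>1\<close> and so mass at most
  \<open>1 / l\<close>.\<close>

lemma coupling_row_sum_le: assumes "l > 0" shows "(\<Sum>k<n. coupling l j k) \<le> l"
proof -
  have "min b x - min a x \<le> b - a" if "a \<le> b" for a b x :: real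
    using that by (auto simp: min_def)
  from this[of "l\<^sup>2 * real j" "l\<^sup>2 * (real j + 1)" "real n"]
  have "min (l\<^sup>2 * (real j + 1)) (real n) - min (l\<^sup>2 * real j) (real n) \<le> l * l"
    by (simp add: distrib_left power2_eq_square)
  then show ?thesis unfolding coupling_row_sum using assms by (simp add: divide_le_eq)
qed

lemma coupling_col_sum_le: assumes "l > 0" shows "(\<Sum>j<n. coupling l j k) \<le> inverse l"
proof -
  have "min (l\<^sup>2 * real n) (real k + 1) - min (l\<^sup>2 * real n) (real k) \<le> 1" by (auto simp: min_def)
  then show ?thesis unfolding coupling_col_sum using assms by (simp add: inverse_eq_divide divide_right_mono)
qed

text \<open>For \<open>j < K\<close> the whole image interval lies below \<open>D\<close>, so row
  \<open>j\<close> has full mass \<open>l\<close>, carried by \<open>k\<close> with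
  \<open>k < l^2 (j + 1)\<close>; there \<open>1 / (k + 1)\<close> is at least
  \<open>1 / (l^2 (j + 1) + 1)\<close>. The losses are summable: at most \<open>2 / l^2\<close> from
  this estimate and \<open>M\<close> from the rows beyond \<open>K\<close>.\<close>

lemma coupling_overlap_ge:
  assumes l: "l > 0" and M: "l\<^sup>2 \<le> real M" "M > 0" and K: "K > 0"
  defines "D \<equiv> M * K"
  shows "hsum D - (real M + 2 / l\<^sup>2) \<le> (\<Sum>j<D. \<Sum>k<D. coupling l j k * sqrt (1 / (real j + 1) * (1 / (real k + 1))))"
proof -
  have row: "1 / (real j + 1) - 1 / l\<^sup>2 * (1 / (real j + 1)\<^sup>2) \<le> (\<Sum>k<D. coupling l j k * sqrt (1 / (real j + 1) * (1 / (real k + 1))))"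
    if j: "j < K" for j
  proof -
    define x where "x = 1 / (l\<^sup>2 * (real j + 1))"
    have x: "x > 0" using l by (simp add: x_def)
    define c where "c = sqrt (1 / (real j + 1) * (1 / (l\<^sup>2 * (real j + 1) + 1)))"
    have "l\<^sup>2 * (real j + 1) \<le> real M * real K" using j M by (intro mult_mono) auto
    then have D1: "l\<^sup>2 * (real j + 1) \<le> real D" by (simp add: D_def)
    have "l\<^sup>2 * real j \<le> l\<^sup>2 * (real j + 1)" by (intro mult_left_mono) auto
    with D1 have D2: "l\<^sup>2 * real j \<le> real D" by linarith
    then have sum: "(\<Sum>k<D. coupling l j k) = l"
      unfolding coupling_row_sum min.absorb1[OF D1] min.absorb1[OF D2] using l by (simp add: distrib_left power2_eq_square)
    have "l * c = 1 / (real j + 1) * sqrt (1 / (1 + x))"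
    proof -
      have "1 / (real j + 1) * (1 / (l\<^sup>2 * (real j + 1) + 1)) = (1 / (real j + 1))\<^sup>2 * (1 / l\<^sup>2) * (1 / (1 + x))"
      proof -
        define u where "u = l\<^sup>2 * (real j + 1)"
        have u: "u > 0" using l by (simp add: u_def)
        have xu: "x = 1 / u" by (simp add: x_def u_def)
        have "1 / (1 + x) = u * (1 / (u + 1))" unfolding xu using u by (simp add: divide_simps)
        moreover have "(1 / (real j + 1))\<^sup>2 * (1 / l\<^sup>2) * u = 1 / (real j + 1)"
          using l by (simp add: u_def power2_eq_square)
        ultimately show ?thesis unfolding u_def[symmetric] by (simp flip: mult.assoc)
      qed
      then show ?thesis using l unfolding c_def by (simp add: real_sqrt_mult real_sqrt_divide)
    qed
    moreover have "1 - x \<le> sqrt (1 / (1 + x))"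
    proof -
      have "1 - x \<le> 1 / (1 + x)" using x by (simp add: field_simps)
      also have "\<dots> \<le> sqrt (1 / (1 + x))" using x
        by (intro real_le_rsqrt) (simp add: power2_eq_square mult_left_le del: times_divide_eq_left times_divide_eq_right)
      finally show ?thesis .
    qed
    ultimately have "1 / (real j + 1) * (1 - x) \<le> l * c" by (simp add: mult_left_mono divide_right_mono)
    also have "\<dots> = (\<Sum>k<D. coupling l j k * c)" unfolding sum_distrib_right[symmetric] sum ..
    also have "\<dots> \<le> (\<Sum>k<D. coupling l j k * sqrt (1 / (real j + 1) * (1 / (real k + 1))))"
    proof (intro sum_mono)
      fix k
      show "coupling l j k * c \<le> coupling l j k * sqrt (1 / (real j + 1) * (1 / (real k + 1)))"
      proof (cases "l\<^sup>2 * (real j + 1) \<le> real k")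
        case True
        then show ?thesis by (simp add: coupling_eq_0)
      next
        case False
        have "c \<le> sqrt (1 / (real j + 1) * (1 / (real k + 1)))"
          unfolding c_def using False by (intro real_sqrt_le_mono mult_left_mono divide_left_mono) auto
        then show ?thesis using coupling_nonneg[OF l] by (intro mult_left_mono)
      qed
    qed
    finally show ?thesis by (simp add: x_def power2_eq_square algebra_simps)
  qed
  have "hsum D - (real M + 2 / l\<^sup>2) \<le> hsum K - 1 / l\<^sup>2 * 2"
    using hsum_mult_le[OF K, of M] by (simp add: D_def)
  also have "\<dots> \<le> hsum K - 1 / l\<^sup>2 * (\<Sum>j<K. 1 / (real j + 1)\<^sup>2)"
    by (intro diff_left_mono mult_left_mono sum_inverse_squares_le) auto
  also have "\<dots> = (\<Sum>j<K. 1 / (real j + 1) - 1 / l\<^sup>2 * (1 / (real j + 1)\<^sup>2))"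
    by (simp add: hsum_def sum_subtractf sum_distrib_left)
  also have "\<dots> \<le> (\<Sum>j<K. \<Sum>k<D. coupling l j k * sqrt (1 / (real j + 1) * (1 / (real k + 1))))"
    by (intro sum_mono row) simp
  also have "\<dots> \<le> (\<Sum>j<D. \<Sum>k<D. coupling l j k * sqrt (1 / (real j + 1) * (1 / (real k + 1))))"
    using M(2) by (intro sum_mono2 sum_nonneg mult_nonneg_nonneg coupling_nonneg l) (auto simp: D_def)
  finally show ?thesis .
qed

text \<open>The weights \<open>r j\<close>, proportional to \<open>1 / (j + 1)\<close>, are those of the embezzlement states:
  they are almost invariant under the rescaling \<open>j \<mapsto> \<lambda>\<^sup>2 j\<close> simultaneously for all \<open>\<lambda>\<close>.\<close>

lemma embezzling_coupling:
  fixes l :: "nat \<Rightarrow> real"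
  assumes l: "\<And>i. i < n \<Longrightarrow> l i > 0" and e: "e > (0::real)"
  shows "\<exists>(D::nat) (r::nat \<Rightarrow> real) (p::nat \<Rightarrow> nat \<Rightarrow> nat \<Rightarrow> real).
    D > 0 \<and> (\<forall>j. r j > 0) \<and> (\<Sum>j<D. r j) = 1 \<and>
    (\<forall>i<n. (\<forall>j k. p i j k \<ge> 0) \<and> (\<forall>j. (\<Sum>k<D. p i j k) \<le> l i) \<and>
      (\<forall>k. (\<Sum>j<D. p i j k) \<le> inverse (l i)) \<and>
      \<bar>(\<Sum>j<D. \<Sum>k<D. p i j k * sqrt (r j * r k)) - 1\<bar> \<le> e)"
proof -
  \<comment> \<open>\<open>M\<close> dominates every \<open>(l i)^2\<close> at once; the added
    \<open>1\<close> makes it positive.\<close>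
  obtain M :: nat where M: "1 + (\<Sum>i<n. (l i)\<^sup>2) \<le> real M" using real_arch_simple by blast
  have M0: "M > 0" using M sum_nonneg[of "{..<n}" "\<lambda>i. (l i)\<^sup>2"] by (cases M) auto
  have Mi: "(l i)\<^sup>2 \<le> real M" if "i < n" for i
    using M member_le_sum[of i "{..<n}" "\<lambda>i. (l i)\<^sup>2"] that by simp
  define c where "c = real M + (\<Sum>i<n. 2 / (l i)\<^sup>2)"
  have ci: "real M + 2 / (l i)\<^sup>2 \<le> c" if "i < n" for i
    unfolding c_def using member_le_sum[of i "{..<n}" "\<lambda>i. 2 / (l i)\<^sup>2"] that by simp
  \<comment> \<open>Large enough that \<open>hsum D \<ge> c / e\<close>: the total loss
    \<open>c\<close> does not depend on \<open>K\<close>, so it becomes at most a fraction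
    \<open>e\<close> of the whole.\<close>
  obtain K :: nat where K: "exp (c / e) \<le> real K" using real_arch_simple by blast
  have K0: "K > 0" using K exp_gt_zero[of "c / e"] by (cases K) auto
  define D where "D = M * K"
  have D0: "D > 0" using M0 K0 by (simp add: D_def)
  have "real K \<le> real D" using M0 mult_right_mono[of 1 "real M" "real K"] by (simp add: D_def)
  then have "c / e \<le> ln (real D + 1)" using K by (subst ln_ge_iff) auto
  then have H: "c / e \<le> hsum D" using hsum_ge_ln[of D] by simp
  have Hpos: "hsum D > 0" unfolding hsum_def using D0 by (intro sum_pos) (auto simp: lessThan_empty_iff)
  define r where "r j = 1 / (real j + 1) / hsum D" for j
  have rsum: "(\<Sum>j<D. r j) = 1" using Hpos unfolding r_def sum_divide_distrib[symmetric] hsum_def[symmetric] by simp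
  have rpos: "r j > 0" for j using Hpos by (simp add: r_def)
  have bd: "\<bar>(\<Sum>j<D. \<Sum>k<D. coupling (l i) j k * sqrt (r j * r k)) - 1\<bar> \<le> e" if i: "i < n" for i
  proof -
    have li: "l i > 0" by (rule l[OF i])
    have "(\<Sum>j<D. \<Sum>k<D. coupling (l i) j k * sqrt (r j * r k))
      \<le> (\<Sum>j<D. \<Sum>k<D. coupling (l i) j k * ((r j / l i + l i * r k) / 2))"
    proof (intro sum_mono mult_left_mono coupling_nonneg li)
      fix j k
      \<comment> \<open>Splitting with the weight \<open>l i\<close> before the arithmetic-geometric
        mean makes the marginals \<open>l i\<close> and \<open>1 / l i\<close> cancel, and the upper
        bound is exactly \<open>1\<close>.\<close>
      have "sqrt (r j * r k) = sqrt ((r j / l i) * (l i * r k))" using li by simp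
      also have "\<dots> \<le> (r j / l i + l i * r k) / 2"
        using li rpos[of j] rpos[of k] by (intro arith_geo_mean_sqrt) auto
      finally show "sqrt (r j * r k) \<le> (r j / l i + l i * r k) / 2" .
    qed
    also have "\<dots> = (\<Sum>j<D. (\<Sum>k<D. coupling (l i) j k) * (r j / l i)) / 2 + (\<Sum>j<D. \<Sum>k<D. coupling (l i) j k * (l i * r k)) / 2"
      by (simp add: add_divide_distrib distrib_left sum.distrib sum_distrib_right sum_divide_distrib)
    also have "(\<Sum>j<D. \<Sum>k<D. coupling (l i) j k * (l i * r k)) = (\<Sum>k<D. (\<Sum>j<D. coupling (l i) j k) * (l i * r k))"
      by (subst sum.swap) (simp add: sum_distrib_right)
    also have "(\<Sum>j<D. (\<Sum>k<D. coupling (l i) j k) * (r j / l i)) / 2 + (\<Sum>k<D. (\<Sum>j<D. coupling (l i) j k) * (l i * r k)) / 2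
      \<le> (\<Sum>j<D. l i * (r j / l i)) / 2 + (\<Sum>k<D. inverse (l i) * (l i * r k)) / 2"
      using li rpos by (intro add_mono divide_right_mono sum_mono mult_right_mono coupling_row_sum_le coupling_col_sum_le)
        (auto simp: less_imp_le)
    also have "\<dots> = 1" using li rsum by (simp flip: mult.assoc)
    finally have up: "(\<Sum>j<D. \<Sum>k<D. coupling (l i) j k * sqrt (r j * r k)) \<le> 1" .
    have "sqrt (r j * r k) = sqrt (1 / (real j + 1) * (1 / (real k + 1))) / hsum D" for j k
    proof -
      have "r j * r k = (1 / (real j + 1) * (1 / (real k + 1))) / (hsum D)\<^sup>2" by (simp add: r_def power2_eq_square)
      then show ?thesis using Hpos by (simp add: real_sqrt_divide real_sqrt_mult)
    qed
    then have eq: "(\<Sum>j<D. \<Sum>k<D. coupling (l i) j k * sqrt (r j * r k))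
      = (\<Sum>j<D. \<Sum>k<D. coupling (l i) j k * sqrt (1 / (real j + 1) * (1 / (real k + 1)))) / hsum D"
      by (simp add: sum_divide_distrib)
    have "hsum D - c \<le> (\<Sum>j<D. \<Sum>k<D. coupling (l i) j k * sqrt (1 / (real j + 1) * (1 / (real k + 1))))"
      using coupling_overlap_ge[OF li Mi[OF i] M0 K0] ci[OF i] unfolding D_def by linarith
    moreover have "(1 - e) * hsum D \<le> hsum D - c" using H e by (simp add: field_simps)
    ultimately have "1 - e \<le> (\<Sum>j<D. \<Sum>k<D. coupling (l i) j k * sqrt (r j * r k))"
      unfolding eq using Hpos by (simp add: le_divide_eq)
    with up e show ?thesis by simp
  qed
  show ?thesis
    by (intro exI[of _ D] exI[of _ r] exI[of _ "\<lambda>i. coupling (l i)"] conjI allI impI D0 rpos rsum bd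
        coupling_nonneg coupling_row_sum_le coupling_col_sum_le l)
qed

section \<open>Operator norms and completely bounded maps\<close>

lemma vnorm_reindex: "bij_betw h K' K \<Longrightarrow> vnorm K v = vnorm K' (\<lambda>k. v (h k))"
  unfolding vnorm_def L2_set_def by (simp add: sum.reindex_bij_betw[of h K' K "\<lambda>k. (cmod (v k))\<^sup>2"])

lemma kapp_reindex: "bij_betw h K' K \<Longrightarrow> kapp K M v l = kapp K' (\<lambda>l k. M l (h k)) (\<lambda>k. v (h k)) l"
  unfolding kapp_def by (rule sum.reindex_bij_betw[symmetric])

lemma bij_betw_div_mod: "bij_betw (\<lambda>p. (p div N, p mod N)) {..<n * N} ({..<n} \<times> {..<N::nat})"
proof (cases "N = 0")
  case False
  have "i * N + a < n * N" if "i < n" "a < N" for i a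
  proof -
    have "i * N + a < (i + 1) * N" using that by simp
    also have "\<dots> \<le> n * N" using that by (intro mult_le_mono1) auto
    finally show ?thesis .
  qed
  then show ?thesis
    by (intro bij_betw_byWitness[where f'="\<lambda>(i, a). i * N + a"])
      (use False in \<open>auto simp: less_mult_imp_div_less\<close>)
qed (simp add: bij_betw_def)

lemma vnorm_scale: "vnorm K (\<lambda>k. c * v k) = cmod c * vnorm K v"
  by (simp add: vnorm_def norm_mult L2_set_right_distrib)

lemma kapp_scale: "kapp K M (\<lambda>k. c * v k) = (\<lambda>l. c * kapp K M v l)"
  by (simp add: kapp_def sum_distrib_left mult_ac fun_eq_iff)

lemma vnorm_kapp_bounded:
  assumes "finite K" "finite L"
  obtains B where "B \<ge> 0" "\<And>v. vnorm L (kapp K M v) \<le> B * vnorm K v"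
proof (rule that[of "\<Sum>l\<in>L. vnorm K (\<lambda>k. cnj (M l k))"])
  fix v
  have "vnorm L (kapp K M v) \<le> (\<Sum>l\<in>L. cmod (kapp K M v l))"
    unfolding vnorm_def by (rule order_trans[OF L2_set_le_sum]) auto
  also have "\<dots> \<le> (\<Sum>l\<in>L. vnorm K (\<lambda>k. cnj (M l k)) * vnorm K v)"
  proof (rule sum_mono)
    fix l
    have "kapp K M v l = vinner K v (\<lambda>k. cnj (M l k))" by (simp add: kapp_def vinner_def mult.commute)
    then show "cmod (kapp K M v l) \<le> vnorm K (\<lambda>k. cnj (M l k)) * vnorm K v"
      using cmod_vinner_le[of K v "\<lambda>k. cnj (M l k)"] by (simp add: mult.commute)
  qed
  finally show "vnorm L (kapp K M v) \<le> (\<Sum>l\<in>L. vnorm K (\<lambda>k. cnj (M l k))) * vnorm K v"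
    by (simp add: sum_distrib_right)
qed (simp add: sum_nonneg)

lemma l2_norm_eq_vnorm: "l2_norm x = vnorm {..<dim_vec x} (\<lambda>i. x $ i)"
  by (simp add: l2_norm_def vnorm_def L2_set_def)

lemma l2_norm_mult_vec:
  assumes "M \<in> carrier_mat r c" "x \<in> carrier_vec c"
  shows "l2_norm (M *\<^sub>v x) = vnorm {..<r} (kapp {..<c} (\<lambda>i j. M $$ (i, j)) (\<lambda>i. x $ i))"
  unfolding l2_norm_eq_vnorm using assms
  by (auto simp: kapp_def scalar_prod_def atLeast0LessThan intro!: vnorm_cong)

lemma op_norm_leI:
  assumes M: "M \<in> carrier_mat r c" and K: "K \<ge> 0"
    and bd: "\<And>v. vnorm {..<r} (kapp {..<c} (\<lambda>i j. M $$ (i, j)) v) \<le> K * vnorm {..<c} v"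
  shows "op_norm M \<le> K"
  unfolding op_norm_def
proof (rule cSup_least)
  have "l2_norm (0\<^sub>v c) \<le> 1" by (simp add: l2_norm_def)
  then show "{l2_norm (M *\<^sub>v x) | x. x \<in> carrier_vec (dim_col M) \<and> l2_norm x \<le> 1} \<noteq> {}"
    using M zero_carrier_vec[of c] by blast
  fix t assume "t \<in> {l2_norm (M *\<^sub>v x) | x. x \<in> carrier_vec (dim_col M) \<and> l2_norm x \<le> 1}"
  then obtain x where x: "t = l2_norm (M *\<^sub>v x)" "x \<in> carrier_vec c" "l2_norm x \<le> 1" using M by auto
  have "t \<le> K * l2_norm x"
    unfolding x(1) l2_norm_mult_vec[OF M x(2)] using bd[of "\<lambda>i. x $ i"] x(2) by (simp add: l2_norm_eq_vnorm)
  then show "t \<le> K" using x(3) mult_left_mono[OF x(3) K] by simp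
qed

lemma vnorm_kapp_le_op_norm:
  assumes M: "M \<in> carrier_mat r c"
  shows "vnorm {..<r} (kapp {..<c} (\<lambda>i j. M $$ (i, j)) v) \<le> op_norm M * vnorm {..<c} v"
proof -
  obtain B where B: "B \<ge> 0" "\<And>v. vnorm {..<r} (kapp {..<c} (\<lambda>i j. M $$ (i, j)) v) \<le> B * vnorm {..<c} v"
    using vnorm_kapp_bounded[of "{..<c}" "{..<r}" "\<lambda>i j. M $$ (i, j)"] by blast
  have bdd: "bdd_above {l2_norm (M *\<^sub>v x) | x. x \<in> carrier_vec (dim_col M) \<and> l2_norm x \<le> 1}"
  proof (rule bdd_aboveI)
    fix t assume "t \<in> {l2_norm (M *\<^sub>v x) | x. x \<in> carrier_vec (dim_col M) \<and> l2_norm x \<le> 1}"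
    then obtain x where x: "t = l2_norm (M *\<^sub>v x)" "x \<in> carrier_vec c" "l2_norm x \<le> 1" using M by auto
    have "t \<le> B * l2_norm x"
      unfolding x(1) l2_norm_mult_vec[OF M x(2)] using B(2)[of "\<lambda>i. x $ i"] x(2) by (simp add: l2_norm_eq_vnorm)
    then show "t \<le> B" using mult_left_mono[OF x(3) B(1)] by simp
  qed
  show ?thesis
  proof (cases "vnorm {..<c} v = 0")
    case True
    then show ?thesis using B(2)[of v] by simp
  next
    case False
    then have pos: "vnorm {..<c} v > 0" by (simp add: less_le)
    define a where "a = complex_of_real (1 / vnorm {..<c} v)"
    have a: "cmod a = 1 / vnorm {..<c} v" unfolding a_def norm_of_real using pos by simp
    define x where "x = vec c (\<lambda>i. a * v i)"
    have x: "x \<in> carrier_vec c" by (simp add: x_def)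
    have "l2_norm x = vnorm {..<c} (\<lambda>i. a * v i)"
      unfolding l2_norm_eq_vnorm by (auto simp: x_def intro!: vnorm_cong)
    then have "l2_norm x \<le> 1" using pos by (simp add: vnorm_scale a)
    then have "l2_norm (M *\<^sub>v x) \<le> op_norm M"
      unfolding op_norm_def using x M by (intro cSup_upper[OF _ bdd]) auto
    moreover have "l2_norm (M *\<^sub>v x) = vnorm {..<r} (kapp {..<c} (\<lambda>i j. M $$ (i, j)) (\<lambda>i. a * v i))"
      unfolding l2_norm_mult_vec[OF M x] by (intro vnorm_cong) (auto simp: kapp_def x_def)
    ultimately show ?thesis using pos by (simp add: kapp_scale vnorm_scale a divide_le_eq mult.commute)
  qed
qed

lemma op_norm_nonneg: assumes M: "M \<in> carrier_mat r c" shows "op_norm M \<ge> 0"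
proof -
  have "l2_norm (0\<^sub>v c) \<le> 1" "l2_norm (M *\<^sub>v 0\<^sub>v c) = 0"
    using M by (simp_all add: l2_norm_def)
  obtain B where B: "B \<ge> 0" "\<And>v. vnorm {..<r} (kapp {..<c} (\<lambda>i j. M $$ (i, j)) v) \<le> B * vnorm {..<c} v"
    using vnorm_kapp_bounded[of "{..<c}" "{..<r}" "\<lambda>i j. M $$ (i, j)"] by blast
  show ?thesis
  proof (cases "c = 0")
    case True
    then have "{l2_norm (M *\<^sub>v x) | x. x \<in> carrier_vec (dim_col M) \<and> l2_norm x \<le> 1} = {0}"
      using M by (auto simp: l2_norm_def scalar_prod_def intro!: exI[of _ "0\<^sub>v 0"])
    then show ?thesis unfolding op_norm_def by simp
  next
    case False
    then have "vnorm {..<c} (delta 0) = 1" by (intro vnorm_delta) auto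
    then show ?thesis using vnorm_kapp_le_op_norm[OF M, of "delta 0"] vnorm_nonneg[of "{..<r}"]
      by (metis mult.right_neutral order_trans)
  qed
qed

lemma flatten_blocks_carrier: "X \<in> carrier_mat n n \<Longrightarrow> flatten_blocks N X \<in> carrier_mat (n * N) (n * N)"
  by (auto simp: flatten_blocks_def)

lemma vnorm_kapp_flatten:
  assumes X: "X \<in> carrier_mat n n"
  shows "vnorm {..<n * N} (kapp {..<n * N} (\<lambda>i j. flatten_blocks N X $$ (i, j)) (\<lambda>p. v (p div N, p mod N)))
    = vnorm ({..<n} \<times> {..<N}) (kapp ({..<n} \<times> {..<N}) (\<lambda>(i, a) (j, b). X $$ (i, j) $$ (a, b)) v)"
  unfolding vnorm_reindex[OF bij_betw_div_mod]
proof (rule vnorm_cong)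
  fix k assume "k \<in> {..<n * N}"
  then show "kapp {..<n * N} (\<lambda>i j. flatten_blocks N X $$ (i, j)) (\<lambda>p. v (p div N, p mod N)) k
    = kapp ({..<n} \<times> {..<N}) (\<lambda>(i, a) (j, b). X $$ (i, j) $$ (a, b)) v (k div N, k mod N)"
    unfolding kapp_reindex[OF bij_betw_div_mod, of n N] unfolding kapp_def
    using X by (intro sum.cong) (auto simp: flatten_blocks_def)
qed

lemma vnorm_kapp_le_block_norm:
  assumes X: "X \<in> carrier_mat n n"
  shows "vnorm ({..<n} \<times> {..<N}) (kapp ({..<n} \<times> {..<N}) (\<lambda>(i, a) (j, b). X $$ (i, j) $$ (a, b)) v)
    \<le> block_norm N X * vnorm ({..<n} \<times> {..<N}) v"
  using vnorm_kapp_le_op_norm[OF flatten_blocks_carrier[OF X, of N], of "\<lambda>p. v (p div N, p mod N)"]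
  unfolding vnorm_kapp_flatten[OF X] block_norm_def vnorm_reindex[OF bij_betw_div_mod, of n N v] .

lemma block_norm_leI:
  assumes X: "X \<in> carrier_mat n n" and K: "K \<ge> 0"
    and bd: "\<And>v. vnorm ({..<n} \<times> {..<N}) (kapp ({..<n} \<times> {..<N}) (\<lambda>(i, a) (j, b). X $$ (i, j) $$ (a, b)) v)
      \<le> K * vnorm ({..<n} \<times> {..<N}) v"
  shows "block_norm N X \<le> K"
  unfolding block_norm_def
proof (rule op_norm_leI[OF flatten_blocks_carrier[OF X] K])
  fix u :: "nat \<Rightarrow> complex"
  define v where "v = (\<lambda>(i, a). u (i * N + a))"
  have u: "u = (\<lambda>p. v (p div N, p mod N))" by (simp add: v_def fun_eq_iff)
  show "vnorm {..<n * N} (kapp {..<n * N} (\<lambda>i j. flatten_blocks N X $$ (i, j)) u) \<le> K * vnorm {..<n * N} u"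
    unfolding u vnorm_kapp_flatten[OF X] using bd[of v] unfolding vnorm_reindex[OF bij_betw_div_mod] .
qed

lemma block_norm_nonneg: "X \<in> carrier_mat n n \<Longrightarrow> block_norm N X \<ge> 0"
  unfolding block_norm_def by (rule op_norm_nonneg[OF flatten_blocks_carrier])

lemma block_norm_smult_le:
  assumes X: "X \<in> carrier_mat n n" "elements_mat X \<subseteq> carrier_mat N N" and t: "block_norm N X \<le> t" "t \<ge> 0"
  shows "block_norm N (map_mat (\<lambda>M. c \<cdot>\<^sub>m M) X) \<le> cmod c * t"
proof (rule block_norm_leI)
  show "map_mat (\<lambda>M. c \<cdot>\<^sub>m M) X \<in> carrier_mat n n" using X by simp
  fix v :: "nat \<times> nat \<Rightarrow> complex"
  have el: "X $$ (i, j) \<in> carrier_mat N N" if "i < n" "j < n" for i j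
    using X(2) elements_matI[OF X(1) that refl] by blast
  have "kapp ({..<n} \<times> {..<N}) (\<lambda>(i, a) (j, b). map_mat (\<lambda>M. c \<cdot>\<^sub>m M) X $$ (i, j) $$ (a, b)) v k
    = c * kapp ({..<n} \<times> {..<N}) (\<lambda>(i, a) (j, b). X $$ (i, j) $$ (a, b)) v k" if "k \<in> {..<n} \<times> {..<N}" for k
  proof -
    have "(c \<cdot>\<^sub>m X $$ (i, j)) $$ (a, b) = c * X $$ (i, j) $$ (a, b)" if "i < n" "j < n" "a < N" "b < N" for i j a b
      using el[of i j] that by auto
    then show ?thesis using X(1) that by (auto simp: kapp_def sum_distrib_left intro!: sum.cong)
  qed
  then have "vnorm ({..<n} \<times> {..<N}) (kapp ({..<n} \<times> {..<N}) (\<lambda>(i, a) (j, b). map_mat (\<lambda>M. c \<cdot>\<^sub>m M) X $$ (i, j) $$ (a, b)) v)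
    = cmod c * vnorm ({..<n} \<times> {..<N}) (kapp ({..<n} \<times> {..<N}) (\<lambda>(i, a) (j, b). X $$ (i, j) $$ (a, b)) v)"
    unfolding vnorm_scale[symmetric] by (rule vnorm_cong)
  also have "\<dots> \<le> cmod c * (t * vnorm ({..<n} \<times> {..<N}) v)"
    using t by (intro mult_left_mono order_trans[OF vnorm_kapp_le_block_norm[OF X(1)]] mult_right_mono) auto
  finally show "vnorm ({..<n} \<times> {..<N}) (kapp ({..<n} \<times> {..<N}) (\<lambda>(i, a) (j, b). map_mat (\<lambda>M. c \<cdot>\<^sub>m M) X $$ (i, j) $$ (a, b)) v)
    \<le> cmod c * t * vnorm ({..<n} \<times> {..<N}) v" by (simp add: mult.assoc)
qed (use t in auto)

lemma le_cb_norm: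
  assumes cb: "completely_bounded S p q f"
    and p: "\<And>n X. X \<in> carrier_mat n n \<Longrightarrow> elements_mat X \<subseteq> S \<Longrightarrow> p X \<ge> (0::real)"
    and X: "X \<in> carrier_mat n n" "elements_mat X \<subseteq> S" "p X \<le> 1"
  shows "q (map_mat f X) \<le> cb_norm S p q f"
proof -
  obtain K where K: "\<And>n X. X \<in> carrier_mat n n \<Longrightarrow> elements_mat X \<subseteq> S \<Longrightarrow> q (map_mat f X) \<le> K * p X"
    using cb unfolding completely_bounded_def by blast
  have "bdd_above {q (map_mat f X) | n X. X \<in> carrier_mat n n \<and> elements_mat X \<subseteq> S \<and> p X \<le> 1}"
  proof (rule bdd_aboveI)
    fix t assume "t \<in> {q (map_mat f X) | n X. X \<in> carrier_mat n n \<and> elements_mat X \<subseteq> S \<and> p X \<le> 1}"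
    then obtain n X where X: "t = q (map_mat f X)" "X \<in> carrier_mat n n" "elements_mat X \<subseteq> S" "p X \<le> 1" by auto
    have "t \<le> K * p X" unfolding X(1) by (rule K[OF X(2,3)])
    \<comment> \<open>The constant in \<open>completely_bounded\<close> has no prescribed
      sign.\<close>
    also have "\<dots> \<le> \<bar>K\<bar> * p X" by (intro mult_right_mono p[OF X(2,3)]) auto
    also have "\<dots> \<le> \<bar>K\<bar> * 1" using X(4) by (intro mult_left_mono) auto
    finally show "t \<le> \<bar>K\<bar>" by simp
  qed
  then show ?thesis unfolding cb_norm_def using X by (intro cSup_upper) auto
qed

text \<open>The \<open>0\<close> by \<open>0\<close> matrix has its entries in any \<open>S\<close>,
  so its image is a nonnegative member of the set whose supremum is taken.\<close>

lemma cb_norm_nonneg: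
  assumes cb: "completely_bounded S p q f"
    and p: "\<And>n X. X \<in> carrier_mat n n \<Longrightarrow> elements_mat X \<subseteq> S \<Longrightarrow> p X \<ge> (0::real)"
    and z: "Z \<in> carrier_mat 0 0" "p Z \<le> 1" "q (map_mat f Z) \<ge> 0"
  shows "cb_norm S p q f \<ge> 0"
proof -
  have "q (map_mat f Z) \<le> cb_norm S p q f"
    using z by (intro le_cb_norm[OF cb p, where n=0]) (auto simp: elements_mat_def)
  with z(3) show ?thesis by linarith
qed


section \<open>Matrix coordinates from exactness\<close>

lemma mat_norm_scaleR_le:
  assumes X: "X \<in> carrier_mat n n" and t: "mat_norm X \<le> t" "t > 0"
  shows "mat_norm (map_mat (scaleC (complex_of_real (1 / t))) X) \<le> 1"
proof -
  have "cmod (complex_of_real (1 / t)) = 1 / t" using t by (subst norm_of_real) simp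
  then show ?thesis using t by (simp only: mat_norm_scaleC[OF X]) (simp add: divide_simps)
qed

lemma map_mat_scale_elements:
  assumes "cvs.subspace G" "elements_mat X \<subseteq> G"
  shows "elements_mat (map_mat (scaleC c) X) \<subseteq> G"
  using assms by (auto intro: cvs.subspace_scale)

text \<open>\<open>X i\<close> is the matrix \<open>v (a i)\<close>, while \<open>s\<close> and
  \<open>t\<close> are the cb norms of \<open>v\<close> and its inverse. Amplifying \<open>v\<close>
  to the column of the \<open>sqrt (l i) a i\<close> and to the row of the
  \<open>a i / sqrt (l i)\<close> yields the two weighted estimates; amplifying the inverse carries
  a bound on \<open>\<Sum> Y_i \<otimes> X_i\<close> back to
  \<open>\<Sum> Y_i \<otimes> a_i\<close>.\<close>

lemma exact_with_coordinates:
  fixes E :: "'a::cstar_algebra set" and a :: "nat \<Rightarrow> 'a" and l :: "nat \<Rightarrow> real"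
  assumes E: "cvs.subspace E" "exact_with E C'" and a: "\<And>i. i < n \<Longrightarrow> a i \<in> E" and l: "\<And>i. i < n \<Longrightarrow> l i > 0"
  obtains N :: nat and X :: "nat \<Rightarrow> nat \<Rightarrow> nat \<Rightarrow> complex" and s t :: real
  where "s \<ge> 0" "t \<ge> 0" "s * t \<le> C'"
    "\<And>x. (\<Sum>i<n. l i * (\<Sum>\<alpha><N. (cmod (\<Sum>\<beta><N. X i \<alpha> \<beta> * x \<beta>))\<^sup>2))
      \<le> (s * sqrt (norm (\<Sum>i<n. l i *\<^sub>R (star (a i) * a i))))\<^sup>2 * (\<Sum>\<beta><N. (cmod (x \<beta>))\<^sup>2)"
    "\<And>x. (\<Sum>\<alpha><N. (cmod (\<Sum>i<n. \<Sum>\<beta><N. X i \<alpha> \<beta> * x i \<beta>))\<^sup>2)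
      \<le> (s * sqrt (norm (\<Sum>i<n. inverse (l i) *\<^sub>R (a i * star (a i)))))\<^sup>2 * (\<Sum>i<n. l i * (\<Sum>\<beta><N. (cmod (x i \<beta>))\<^sup>2))"
    "\<And>m Y K. K > 0 \<Longrightarrow>
      (\<And>v. vnorm ({..<m} \<times> {..<N}) (kapp ({..<m} \<times> {..<N}) (\<lambda>(P, \<alpha>) (Q, \<beta>). \<Sum>i<n. Y i P Q * X i \<alpha> \<beta>) v)
        \<le> K * vnorm ({..<m} \<times> {..<N}) v) \<Longrightarrow>
      mat_norm (mat m m (\<lambda>(P, Q). \<Sum>i<n. Y i P Q *\<^sub>C a i)) \<le> t * K"
proof -
  define G where "G = cvs.span (a ` {..<n})"
  have Gs: "cvs.subspace G" by (simp add: G_def cvs.subspace_span)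
  have aG: "a i \<in> G" if "i < n" for i using that by (auto simp: G_def intro: cvs.span_base)
  have "G \<subseteq> E" unfolding G_def using a E(1) by (intro cvs.span_minimal) auto
  then obtain N Gt v where Gt: "Gt \<subseteq> carrier_mat N N" and bij: "bij_betw v G Gt"
    and vadd: "\<And>x y. x \<in> G \<Longrightarrow> y \<in> G \<Longrightarrow> v (x + y) = v x + v y"
    and vsc: "\<And>x c. x \<in> G \<Longrightarrow> v (c *\<^sub>C x) = c \<cdot>\<^sub>m v x"
    and cb1: "completely_bounded G mat_norm (block_norm N) v"
    and cb2: "completely_bounded Gt (block_norm N) mat_norm (inv_into G v)"
    and C: "cb_norm G mat_norm (block_norm N) v * cb_norm Gt (block_norm N) mat_norm (inv_into G v) \<le> C'"
    using E(2) Gs unfolding exact_with_def G_def by (metis (no_types, lifting) finite_imageI finite_lessThan)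
  define s where "s = cb_norm G mat_norm (block_norm N) v"
  define t where "t = cb_norm Gt (block_norm N) mat_norm (inv_into G v)"
  have mn: "\<And>n X. X \<in> carrier_mat n n \<Longrightarrow> elements_mat X \<subseteq> G \<Longrightarrow> mat_norm X \<ge> 0" by (rule mat_norm_nonneg)
  have bn: "\<And>n X. X \<in> carrier_mat n n \<Longrightarrow> elements_mat X \<subseteq> Gt \<Longrightarrow> block_norm N X \<ge> 0" by (rule block_norm_nonneg)
  have s0: "s \<ge> 0" unfolding s_def
  proof (rule cb_norm_nonneg[OF cb1 mn, where Z="0\<^sub>m 0 0"])
    have "mat_norm (0\<^sub>m 0 0 :: 'a mat) = 0" by (rule cmn_zero[OF cstar_matrix_norm_mat_norm])
    then show "mat_norm (0\<^sub>m 0 0 :: 'a mat) \<le> 1" by simp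
    show "block_norm N (map_mat v (0\<^sub>m 0 0)) \<ge> 0" by (rule block_norm_nonneg[of _ 0]) simp
  qed simp_all
  have t0: "t \<ge> 0" unfolding t_def
  \<comment> \<open>The matrix has no entries, so \<open>undefined\<close> is never
    consulted.\<close>
  proof (rule cb_norm_nonneg[OF cb2 bn, where Z="mat 0 0 undefined"])
    have "block_norm N (mat 0 0 undefined) \<le> 0" by (rule block_norm_leI[of _ 0]) (auto simp: vnorm_def)
    then show "block_norm N (mat 0 0 undefined) \<le> 1" by simp
    show "mat_norm (map_mat (inv_into G v) (mat 0 0 undefined)) \<ge> 0" by (rule mat_norm_nonneg[of _ 0]) simp
  qed simp_all
  have vG: "v x \<in> carrier_mat N N" if "x \<in> G" for x
    using bij Gt that by (auto simp: bij_betw_def)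
  have vGt: "v x \<in> Gt" if "x \<in> G" for x using bij_betwE[OF bij] that by blast
  have iv: "inv_into G v (v x) = x" if "x \<in> G" for x
    using bij that by (simp add: bij_betw_def inv_into_f_f)
  have sq: "(cmod (complex_of_real (sqrt (l i)) * y))\<^sup>2 = l i * (cmod y)\<^sup>2" if "i < n" for i y
    using l[OF that] by (simp add: norm_mult power_mult_distrib)
  have up: "block_norm N (map_mat v X) \<le> s * r"
    if X: "X \<in> carrier_mat k k" "elements_mat X \<subseteq> G" and r: "mat_norm X \<le> r" for X k r
  proof -
    have r0: "r \<ge> 0" using mat_norm_nonneg[OF X(1)] r by simp
    have main: "block_norm N (map_mat v X) \<le> s * r" if "mat_norm X \<le> r" "r > 0" for r
    proof -
      define X' where "X' = map_mat (scaleC (complex_of_real (1 / r))) X"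
      have el: "X $$ (i, j) \<in> G" if "i < k" "j < k" for i j
        using X(2) elements_matI[OF X(1) that refl] by blast
      have "block_norm N (map_mat v X') \<le> s"
        unfolding s_def X'_def using X Gs that
        by (intro le_cb_norm[OF cb1 mn, where n=k] map_mat_scale_elements mat_norm_scaleR_le[of _ k]) auto
      then have "block_norm N (map_mat (\<lambda>M. complex_of_real r \<cdot>\<^sub>m M) (map_mat v X')) \<le> cmod (complex_of_real r) * s"
      proof (intro block_norm_smult_le[of _ k])
        have "elements_mat X' \<subseteq> G" unfolding X'_def by (rule map_mat_scale_elements[OF Gs X(2)])
        then show "elements_mat (map_mat v X') \<subseteq> carrier_mat N N" using vG by auto
      qed (use X s0 in \<open>auto simp: X'_def\<close>)
      moreover have "map_mat (\<lambda>M. complex_of_real r \<cdot>\<^sub>m M) (map_mat v X') = map_mat v X"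
      proof (rule eq_matI)
        fix i j assume "i < dim_row (map_mat v X)" "j < dim_col (map_mat v X)"
        then have ij: "i < k" "j < k" using X(1) by auto
        have "complex_of_real r \<cdot>\<^sub>m (complex_of_real (1 / r) \<cdot>\<^sub>m v (X $$ (i, j))) = v (X $$ (i, j))"
          using that by (intro eq_matI) auto
        then show "map_mat (\<lambda>M. complex_of_real r \<cdot>\<^sub>m M) (map_mat v X') $$ (i, j) = map_mat v X $$ (i, j)"
          using ij X(1) by (simp add: X'_def vsc[OF el[OF ij]])
      qed (use X(1) in \<open>auto simp: X'_def\<close>)
      ultimately show ?thesis using that by (simp add: mult.commute)
    qed
    show ?thesis
    proof (rule field_le_epsilon)
      fix e :: real assume e: "e > 0"
      \<comment> \<open>\<open>main\<close> divides by its bound, which may be \<open>0\<close>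
        here; it is applied to \<open>r + q\<close>, with \<open>q\<close> so small that
        \<open>s * q \<le> e\<close>.\<close>
      define q where "q = e / (s + 1)"
      have "s + 1 > 0" using s0 by simp
      then have q: "q > 0" "(s + 1) * q = e" using e by (auto simp: q_def)
      have "block_norm N (map_mat v X) \<le> s * (r + q)" using r r0 q(1) by (intro main) auto
      also have "\<dots> \<le> s * r + e" using q by (simp add: algebra_simps)
      finally show "block_norm N (map_mat v X) \<le> s * r + e" .
    qed
  qed
  define X where "X i \<alpha> \<beta> = v (a i) $$ (\<alpha>, \<beta>)" for i \<alpha> \<beta>
  have vsum: "(\<Sum>i\<in>S. c i *\<^sub>C a i) \<in> G \<and> v (\<Sum>i\<in>S. c i *\<^sub>C a i) = mat N N (\<lambda>(\<alpha>, \<beta>). \<Sum>i\<in>S. c i * X i \<alpha> \<beta>)"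
    if "finite S" "S \<subseteq> {..<n}" for c :: "nat \<Rightarrow> complex" and S
    using that
  proof (induction S rule: finite_induct)
    case empty
    have 0: "0 \<in> G" by (rule cvs.subspace_0[OF Gs])
    have v0: "v 0 = 0 \<cdot>\<^sub>m v 0" using vsc[OF 0, of 0] by simp
    have "v 0 $$ (i, j) = 0" if "i < N" "j < N" for i j
    proof -
      have "v 0 $$ (i, j) = (0 \<cdot>\<^sub>m v 0) $$ (i, j)" by (rule arg_cong[OF v0])
      also have "\<dots> = 0" using that vG[OF 0] by simp
      finally show ?thesis .
    qed
    then have "v 0 = mat N N (\<lambda>(\<alpha>, \<beta>). \<Sum>i\<in>{}. c i * X i \<alpha> \<beta>)"
      using vG[OF 0] by (intro eq_matI) auto
    then show ?case using 0 by (simp only: sum.empty)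
  next
    case (insert i S)
    have ca: "c i *\<^sub>C a i \<in> G" using insert.prems aG Gs by (auto intro: cvs.subspace_scale)
    have IH: "(\<Sum>i\<in>S. c i *\<^sub>C a i) \<in> G" "v (\<Sum>i\<in>S. c i *\<^sub>C a i) = mat N N (\<lambda>(\<alpha>, \<beta>). \<Sum>i\<in>S. c i * X i \<alpha> \<beta>)"
      using insert by auto
    have "v (c i *\<^sub>C a i + (\<Sum>i\<in>S. c i *\<^sub>C a i)) = c i \<cdot>\<^sub>m v (a i) + mat N N (\<lambda>(\<alpha>, \<beta>). \<Sum>i\<in>S. c i * X i \<alpha> \<beta>)"
      using insert.prems by (simp add: vadd[OF ca IH(1)] IH(2) vsc[OF aG])
    also have "\<dots> = mat N N (\<lambda>(\<alpha>, \<beta>). \<Sum>i\<in>insert i S. c i * X i \<alpha> \<beta>)"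
      using vG[OF aG[of i]] insert.prems insert.hyps by (intro eq_matI) (auto simp: X_def)
    finally show ?case using insert.hyps cvs.subspace_add[OF Gs ca IH(1)] by simp
  qed
  show ?thesis
  proof (rule that[where s=s and t=t and N=N and X=X])
    show "s \<ge> 0" "t \<ge> 0" "s * t \<le> C'" using s0 t0 C by (auto simp: s_def t_def)
  next
    fix m K and Y :: "nat \<Rightarrow> nat \<Rightarrow> nat \<Rightarrow> complex"
    assume K: "K > 0" and bd: "\<And>v. vnorm ({..<m} \<times> {..<N}) (kapp ({..<m} \<times> {..<N}) (\<lambda>(P, \<alpha>) (Q, \<beta>). \<Sum>i<n. Y i P Q * X i \<alpha> \<beta>) v)
        \<le> K * vnorm ({..<m} \<times> {..<N}) v"
    \<comment> \<open>Scaled to block norm at most \<open>1\<close>; its entries are values of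
      \<open>v\<close>, hence in \<open>Gt\<close>, where the inverse is defined.\<close>
    define Z where "Z = mat m m (\<lambda>(P, Q). complex_of_real (1 / K) \<cdot>\<^sub>m v (\<Sum>i<n. Y i P Q *\<^sub>C a i))"
    define W where "W = mat m m (\<lambda>(P, Q). \<Sum>i<n. Y i P Q *\<^sub>C a i)"
    have W: "W \<in> carrier_mat m m" by (simp add: W_def)
    have inG: "(\<Sum>i<n. Y i P Q *\<^sub>C a i) \<in> G" for P Q using vsum[of "{..<n}"] by simp
    have Zv: "Z = mat m m (\<lambda>(P, Q). v (complex_of_real (1 / K) *\<^sub>C (\<Sum>i<n. Y i P Q *\<^sub>C a i)))"
      unfolding Z_def by (intro eq_matI) (auto simp: vsc[OF inG])
    have Zel: "elements_mat Z \<subseteq> Gt"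
      using vGt[OF cvs.subspace_scale[OF Gs inG]] unfolding Zv by (auto simp: elements_mat_def)
    have "block_norm N Z \<le> 1"
    proof (rule block_norm_leI[of _ m])
      fix u
      have "kapp ({..<m} \<times> {..<N}) (\<lambda>(i, a) (j, b). Z $$ (i, j) $$ (a, b)) u k
        = complex_of_real (1 / K) * kapp ({..<m} \<times> {..<N}) (\<lambda>(P, \<alpha>) (Q, \<beta>). \<Sum>i<n. Y i P Q * X i \<alpha> \<beta>) u k"
        if "k \<in> {..<m} \<times> {..<N}" for k
        unfolding kapp_def sum_distrib_left[of "complex_of_real (1 / K)"]
        using that vsum[of "{..<n}"] by (intro sum.cong refl) (auto simp: Z_def)
      then have "vnorm ({..<m} \<times> {..<N}) (kapp ({..<m} \<times> {..<N}) (\<lambda>(i, a) (j, b). Z $$ (i, j) $$ (a, b)) u)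
        = cmod (complex_of_real (1 / K)) * vnorm ({..<m} \<times> {..<N}) (kapp ({..<m} \<times> {..<N}) (\<lambda>(P, \<alpha>) (Q, \<beta>). \<Sum>i<n. Y i P Q * X i \<alpha> \<beta>) u)"
        unfolding vnorm_scale[symmetric] by (rule vnorm_cong)
      also have "cmod (complex_of_real (1 / K)) = 1 / K" using K by (subst norm_of_real) simp
      also have "1 / K * vnorm ({..<m} \<times> {..<N}) (kapp ({..<m} \<times> {..<N}) (\<lambda>(P, \<alpha>) (Q, \<beta>). \<Sum>i<n. Y i P Q * X i \<alpha> \<beta>) u)
        \<le> 1 * vnorm ({..<m} \<times> {..<N}) u" using bd[of u] K by (simp add: divide_le_eq mult.commute)
      finally show "vnorm ({..<m} \<times> {..<N}) (kapp ({..<m} \<times> {..<N}) (\<lambda>(i, a) (j, b). Z $$ (i, j) $$ (a, b)) u)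
        \<le> 1 * vnorm ({..<m} \<times> {..<N}) u" .
    qed (auto simp: Z_def)
    then have "mat_norm (map_mat (inv_into G v) Z) \<le> t"
      unfolding t_def by (intro le_cb_norm[OF cb2 bn, where n=m] Zel) (auto simp: Z_def)
    also have "map_mat (inv_into G v) Z = map_mat (scaleC (complex_of_real (1 / K))) W"
      unfolding Zv W_def by (intro eq_matI) (auto simp: iv[OF cvs.subspace_scale[OF Gs inG]])
    also have "mat_norm \<dots> = cmod (complex_of_real (1 / K)) * mat_norm W" by (rule mat_norm_scaleC[OF W])
    also have "cmod (complex_of_real (1 / K)) = 1 / K" using K by (subst norm_of_real) simp
    finally show "mat_norm (mat m m (\<lambda>(P, Q). \<Sum>i<n. Y i P Q *\<^sub>C a i)) \<le> t * K"
      using K unfolding W_def[symmetric] by (simp add: divide_le_eq)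
  next
    fix x :: "nat \<Rightarrow> complex"
    define A where "A = sqrt (norm (\<Sum>i<n. l i *\<^sub>R (star (a i) * a i)))"
    show "(\<Sum>i<n. l i * (\<Sum>\<alpha><N. (cmod (\<Sum>\<beta><N. X i \<alpha> \<beta> * x \<beta>))\<^sup>2))
      \<le> (s * sqrt (norm (\<Sum>i<n. l i *\<^sub>R (star (a i) * a i))))\<^sup>2 * (\<Sum>\<beta><N. (cmod (x \<beta>))\<^sup>2)"
    proof (cases "n = 0")
      case False
      define M where "M = mat n n (\<lambda>(i, j). if j = 0 then sqrt (l i) *\<^sub>R a i else 0)"
      have M: "M \<in> carrier_mat n n" by (simp add: M_def)
      have 0: "0 \<in> G" by (rule cvs.subspace_0[OF Gs])
      have Mel: "elements_mat M \<subseteq> G"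
        using aG 0 cvs.subspace_scale[OF Gs, of _ "complex_of_real (sqrt (l i))" for i]
        by (auto simp: M_def elements_mat_def scaleC_of_real)
      have "mat_norm M = sqrt (norm (\<Sum>i<n. star (sqrt (l i) *\<^sub>R a i) * (sqrt (l i) *\<^sub>R a i)))"
        unfolding M_def using False by (intro mat_norm_column) simp
      also have "(\<Sum>i<n. star (sqrt (l i) *\<^sub>R a i) * (sqrt (l i) *\<^sub>R a i)) = (\<Sum>i<n. l i *\<^sub>R (star (a i) * a i))"
        using l by (intro sum.cong) (auto simp: star_scaleR less_imp_le)
      finally have mA: "mat_norm M = A" by (simp add: A_def)
      have bM: "block_norm N (map_mat v M) \<le> s * A" by (rule up[OF M Mel]) (simp add: mA)
      \<comment> \<open>Supported in the one nonzero column, so that the matrix sends it to the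
        family of the \<open>sqrt (l i) * X i x\<close>.\<close>
      define u where "u = (\<lambda>(j :: nat, \<beta> :: nat). if j = 0 then x \<beta> else 0)"
      have nu: "(vnorm ({..<n} \<times> {..<N}) u)\<^sup>2 = (\<Sum>\<beta><N. (cmod (x \<beta>))\<^sup>2)"
      proof -
        have "(vnorm ({..<n} \<times> {..<N}) u)\<^sup>2 = (\<Sum>j<n. if j = 0 then \<Sum>\<beta><N. (cmod (x \<beta>))\<^sup>2 else 0)"
          unfolding vnorm_sq sum_pairs u_def by (intro sum.cong) auto
        then show ?thesis using False by simp
      qed
      have app: "kapp ({..<n} \<times> {..<N}) (\<lambda>(i, a) (j, b). map_mat v M $$ (i, j) $$ (a, b)) u (i, \<alpha>)
        = complex_of_real (sqrt (l i)) * (\<Sum>\<beta><N. X i \<alpha> \<beta> * x \<beta>)" if i: "i < n" and \<alpha>: "\<alpha> < N" for i \<alpha>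
      proof -
        have v: "v (sqrt (l i) *\<^sub>R a i) $$ (\<alpha>, \<beta>) = complex_of_real (sqrt (l i)) * X i \<alpha> \<beta>" if "\<beta> < N" for \<beta>
          using vsc[OF aG[OF i], of "complex_of_real (sqrt (l i))"] vG[OF aG[OF i]] \<alpha> that
          by (simp add: scaleC_of_real X_def)
        have "kapp ({..<n} \<times> {..<N}) (\<lambda>(i, a) (j, b). map_mat v M $$ (i, j) $$ (a, b)) u (i, \<alpha>)
          = (\<Sum>j<n. if j = 0 then \<Sum>\<beta><N. v (sqrt (l i) *\<^sub>R a i) $$ (\<alpha>, \<beta>) * x \<beta> else 0)"
          unfolding kapp_def sum_pairs u_def using i by (intro sum.cong) (auto simp: M_def)
        also have "\<dots> = (\<Sum>\<beta><N. v (sqrt (l i) *\<^sub>R a i) $$ (\<alpha>, \<beta>) * x \<beta>)" using False by simp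
        finally show ?thesis by (simp add: v sum_distrib_left mult.assoc)
      qed
      have "(\<Sum>i<n. l i * (\<Sum>\<alpha><N. (cmod (\<Sum>\<beta><N. X i \<alpha> \<beta> * x \<beta>))\<^sup>2))
        = (vnorm ({..<n} \<times> {..<N}) (kapp ({..<n} \<times> {..<N}) (\<lambda>(i, a) (j, b). map_mat v M $$ (i, j) $$ (a, b)) u))\<^sup>2"
        unfolding vnorm_sq sum_pairs sum_distrib_left by (intro sum.cong refl) (simp add: app sq)
      also have "\<dots> \<le> ((s * A) * vnorm ({..<n} \<times> {..<N}) u)\<^sup>2"
        using M by (intro power_mono order_trans[OF vnorm_kapp_le_block_norm] mult_right_mono bM) auto
      finally show ?thesis unfolding A_def[symmetric] power_mult_distrib nu .
    qed simp
  next
    fix x :: "nat \<Rightarrow> nat \<Rightarrow> complex"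
    define A where "A = sqrt (norm (\<Sum>i<n. inverse (l i) *\<^sub>R (a i * star (a i))))"
    show "(\<Sum>\<alpha><N. (cmod (\<Sum>i<n. \<Sum>\<beta><N. X i \<alpha> \<beta> * x i \<beta>))\<^sup>2)
      \<le> (s * sqrt (norm (\<Sum>i<n. inverse (l i) *\<^sub>R (a i * star (a i)))))\<^sup>2 * (\<Sum>i<n. l i * (\<Sum>\<beta><N. (cmod (x i \<beta>))\<^sup>2))"
    proof (cases "n = 0")
      case False
      define r where "r i = 1 / sqrt (l i)" for i
      have rr: "r i * r i = inverse (l i)" "r i * sqrt (l i) = 1" if "i < n" for i
        using l[OF that] by (auto simp: r_def inverse_eq_divide)
      define M where "M = mat n n (\<lambda>(i, j). if i = 0 then r j *\<^sub>R a j else 0)"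
      have M: "M \<in> carrier_mat n n" by (simp add: M_def)
      have 0: "0 \<in> G" by (rule cvs.subspace_0[OF Gs])
      have Mel: "elements_mat M \<subseteq> G"
        using aG 0 cvs.subspace_scale[OF Gs, of _ "complex_of_real (r i)" for i]
        by (auto simp: M_def elements_mat_def scaleC_of_real)
      have "mat_norm M = sqrt (norm (\<Sum>i<n. (r i *\<^sub>R a i) * star (r i *\<^sub>R a i)))"
        unfolding M_def using False by (intro mat_norm_row) simp
      also have "(\<Sum>i<n. (r i *\<^sub>R a i) * star (r i *\<^sub>R a i)) = (\<Sum>i<n. inverse (l i) *\<^sub>R (a i * star (a i)))"
        by (intro sum.cong) (auto simp: star_scaleR rr)
      finally have mA: "mat_norm M = A" by (simp add: A_def)
      have bM: "block_norm N (map_mat v M) \<le> s * A" by (rule up[OF M Mel]) (simp add: mA)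
      \<comment> \<open>The factors \<open>sqrt (l j)\<close> cancel those of the row and reappear
        as the weights \<open>l j\<close> in the norm of \<open>u\<close>.\<close>
      define u where "u = (\<lambda>(j, \<beta>). complex_of_real (sqrt (l j)) * x j \<beta>)"
      have nu: "(vnorm ({..<n} \<times> {..<N}) u)\<^sup>2 = (\<Sum>i<n. l i * (\<Sum>\<beta><N. (cmod (x i \<beta>))\<^sup>2))"
        unfolding vnorm_sq sum_pairs sum_distrib_left by (intro sum.cong refl) (simp add: u_def sq)
      have app: "kapp ({..<n} \<times> {..<N}) (\<lambda>(i, a) (j, b). map_mat v M $$ (i, j) $$ (a, b)) u (0, \<alpha>)
        = (\<Sum>i<n. \<Sum>\<beta><N. X i \<alpha> \<beta> * x i \<beta>)" if \<alpha>: "\<alpha> < N" for \<alpha>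
      proof -
        have v: "v (r i *\<^sub>R a i) $$ (\<alpha>, \<beta>) * (complex_of_real (sqrt (l i)) * y) = X i \<alpha> \<beta> * y"
          if i: "i < n" and "\<beta> < N" for i \<beta> y
        proof -
          have "v (r i *\<^sub>R a i) $$ (\<alpha>, \<beta>) = complex_of_real (r i) * X i \<alpha> \<beta>"
            using vsc[OF aG[OF i], of "complex_of_real (r i)"] vG[OF aG[OF i]] \<alpha> that
            by (simp add: scaleC_of_real X_def)
          then have "v (r i *\<^sub>R a i) $$ (\<alpha>, \<beta>) * (complex_of_real (sqrt (l i)) * y)
            = complex_of_real (r i * sqrt (l i)) * (X i \<alpha> \<beta> * y)" by simp
          then show ?thesis unfolding rr(2)[OF i] by simp
        qed
        show ?thesis
          unfolding kapp_def sum_pairs u_def using False v by (intro sum.cong refl) (auto simp: M_def)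
      qed
      have "(\<Sum>\<alpha><N. (cmod (\<Sum>i<n. \<Sum>\<beta><N. X i \<alpha> \<beta> * x i \<beta>))\<^sup>2)
        = (\<Sum>\<alpha><N. (cmod (kapp ({..<n} \<times> {..<N}) (\<lambda>(i, a) (j, b). map_mat v M $$ (i, j) $$ (a, b)) u (0, \<alpha>)))\<^sup>2)"
        by (intro sum.cong refl) (simp add: app)
      also have "\<dots> \<le> (vnorm ({..<n} \<times> {..<N}) (kapp ({..<n} \<times> {..<N}) (\<lambda>(i, a) (j, b). map_mat v M $$ (i, j) $$ (a, b)) u))\<^sup>2"
        unfolding vnorm_sq sum_pairs using False
        by (intro member_le_sum[of 0 "{..<n}" "\<lambda>i. \<Sum>\<alpha><N. (cmod (kapp ({..<n} \<times> {..<N}) (\<lambda>(i, a) (j, b). map_mat v M $$ (i, j) $$ (a, b)) u (i, \<alpha>)))\<^sup>2"])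
          (auto intro: sum_nonneg)
      also have "\<dots> \<le> ((s * A) * vnorm ({..<n} \<times> {..<N}) u)\<^sup>2"
        using M by (intro power_mono order_trans[OF vnorm_kapp_le_block_norm] mult_right_mono bM) auto
      finally show ?thesis unfolding A_def[symmetric] power_mult_distrib nu .
    qed simp
  qed
qed

section \<open>Matrices over the dual and their pairing\<close>

lemma vnorm_le_by_vinner:
  assumes B: "B \<ge> 0" and le: "\<And>w. cmod (vinner K v w) \<le> B * vnorm K w"
  shows "vnorm K v \<le> B"
proof (cases "vnorm K v = 0")
  case False
  have "vnorm K v * vnorm K v = cmod (vinner K v v)" by (simp add: vinner_self power2_eq_square norm_mult)
  also have "\<dots> \<le> B * vnorm K v" by (rule le)
  finally show ?thesis using False by (simp add: less_le)
qed (use B in simp)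

text \<open>Bounded functionals are completely bounded, so the suprema defining the norms of matrices
  over the dual range over bounded sets.\<close>

lemma completely_bounded_functional_matrix:
  fixes \<Phi> :: "('b::cstar_algebra \<Rightarrow> complex) mat"
  assumes F: "cvs.subspace F" and \<Phi>: "\<Phi> \<in> carrier_mat m m" "elements_mat \<Phi> \<subseteq> dual_space F"
  shows "completely_bounded F mat_norm (block_norm m) (\<lambda>b. map_mat (\<lambda>\<phi>. \<phi> b) \<Phi>)"
proof -
  define \<phi> where "\<phi> i j = \<Phi> $$ (i, j)" for i j
  have \<phi>: "\<phi> i j \<in> dual_space F" if "i < m" "j < m" for i j
    using \<Phi>(2) elements_matI[OF \<Phi>(1) that refl] by (auto simp: \<phi>_def)
  have "\<exists>k. \<forall>x\<in>F. cmod (\<phi> i j x) \<le> k * norm x" if "i < m" "j < m" for i j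
    using \<phi>[OF that] unfolding dual_space_def by blast
  then obtain k where k: "\<And>i j x. i < m \<Longrightarrow> j < m \<Longrightarrow> x \<in> F \<Longrightarrow> cmod (\<phi> i j x) \<le> k i j * norm x" by metis
  define B where "B = (\<Sum>i<m. \<Sum>j<m. \<bar>k i j\<bar>)"
  have B: "B \<ge> 0" by (simp add: B_def sum_nonneg)
  have lin: "(\<Sum>s\<in>S. c s *\<^sub>C y s) \<in> F \<and> \<phi> i j (\<Sum>s\<in>S. c s *\<^sub>C y s) = (\<Sum>s\<in>S. c s * \<phi> i j (y s))"
    if "i < m" "j < m" "finite S" "\<And>s. s \<in> S \<Longrightarrow> y s \<in> F" for i j and S :: "(nat \<times> nat) set" and c y
    using that(3,4)
  proof (induction S rule: finite_induct)
    case empty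
    have 0: "0 \<in> F" by (rule cvs.subspace_0[OF F])
    have "\<phi> i j (0 *\<^sub>C 0) = 0 * \<phi> i j 0" using \<phi>[OF that(1,2)] 0 unfolding dual_space_def by blast
    then show ?case using 0 by simp
  next
    case (insert s S)
    have ys: "y s \<in> F" by (rule insert.prems) simp
    have cy: "c s *\<^sub>C y s \<in> F" by (rule cvs.subspace_scale[OF F ys])
    have IH: "(\<Sum>s\<in>S. c s *\<^sub>C y s) \<in> F" "\<phi> i j (\<Sum>s\<in>S. c s *\<^sub>C y s) = (\<Sum>s\<in>S. c s * \<phi> i j (y s))"
      using insert.IH[OF insert.prems] by simp_all
    have "\<phi> i j (c s *\<^sub>C y s + (\<Sum>s\<in>S. c s *\<^sub>C y s)) = \<phi> i j (c s *\<^sub>C y s) + \<phi> i j (\<Sum>s\<in>S. c s *\<^sub>C y s)"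
      using \<phi>[OF that(1,2)] cy IH(1) unfolding dual_space_def by blast
    also have "\<phi> i j (c s *\<^sub>C y s) = c s * \<phi> i j (y s)"
      using \<phi>[OF that(1,2)] ys unfolding dual_space_def by blast
    finally show ?case using insert.hyps cvs.subspace_add[OF F cy IH(1)] IH(2) by simp
  qed
  have "block_norm m (map_mat (\<lambda>b. map_mat (\<lambda>\<phi>. \<phi> b) \<Phi>) Y) \<le> B * mat_norm Y"
    if Y: "Y \<in> carrier_mat n n" "elements_mat Y \<subseteq> F" for n Y
  proof (rule block_norm_leI[of _ n])
    show "map_mat (\<lambda>b. map_mat (\<lambda>\<phi>. \<phi> b) \<Phi>) Y \<in> carrier_mat n n" using Y by simp
    show nn: "B * mat_norm Y \<ge> 0" using B mat_norm_nonneg[OF Y(1)] by simp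
    have YF: "Y $$ (i, j) \<in> F" if "i < n" "j < n" for i j
      using Y(2) elements_matI[OF Y(1) that refl] by blast
    fix v :: "nat \<times> nat \<Rightarrow> complex"
    let ?K = "{..<n} \<times> {..<m}"
    let ?T = "kapp ?K (\<lambda>(i, a) (j, b). map_mat (\<lambda>b. map_mat (\<lambda>\<phi>. \<phi> b) \<Phi>) Y $$ (i, j) $$ (a, b)) v"
    show "vnorm ?K ?T \<le> B * mat_norm Y * vnorm ?K v"
    proof (rule vnorm_le_by_vinner)
      show "0 \<le> B * mat_norm Y * vnorm ?K v" using nn by simp
      fix w :: "nat \<times> nat \<Rightarrow> complex"
      have "vinner ?K ?T w = (\<Sum>i<n. \<Sum>a<m. \<Sum>j<n. \<Sum>b<m. \<phi> a b (Y $$ (i, j)) * v (j, b) * cnj (w (i, a)))"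
        unfolding vinner_def kapp_def sum_pairs sum_distrib_right
        using Y \<Phi> by (intro sum.cong refl) (auto simp: \<phi>_def)
      also have "\<dots> = (\<Sum>a<m. \<Sum>i<n. \<Sum>b<m. \<Sum>j<n. \<phi> a b (Y $$ (i, j)) * v (j, b) * cnj (w (i, a)))"
        by (subst sum.swap) (intro sum.cong[OF refl] sum.swap)
      also have "\<dots> = (\<Sum>a<m. \<Sum>b<m. \<Sum>i<n. \<Sum>j<n. \<phi> a b (Y $$ (i, j)) * v (j, b) * cnj (w (i, a)))"
        by (intro sum.cong[OF refl] sum.swap)
      \<comment> \<open>Each functional is evaluated on one scalar compression of \<open>Y\<close>,
        whose norm is controlled by \<open>norm_scalar_compression_le\<close>.\<close>
      also have "\<dots> = (\<Sum>a<m. \<Sum>b<m. \<phi> a b (\<Sum>i<n. \<Sum>j<n. (cnj (w (i, a)) * v (j, b)) *\<^sub>C Y $$ (i, j)))"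
      proof (intro sum.cong[OF refl])
        fix a b assume ab: "a \<in> {..<m}" "b \<in> {..<m}"
        have "\<phi> a b (\<Sum>s\<in>{..<n} \<times> {..<n}. (cnj (w (fst s, a)) * v (snd s, b)) *\<^sub>C Y $$ s)
          = (\<Sum>s\<in>{..<n} \<times> {..<n}. (cnj (w (fst s, a)) * v (snd s, b)) * \<phi> a b (Y $$ s))"
          using lin[of a b "{..<n} \<times> {..<n}" "\<lambda>s. Y $$ s" "\<lambda>s. cnj (w (fst s, a)) * v (snd s, b)"] ab YF by auto
        then show "(\<Sum>i<n. \<Sum>j<n. \<phi> a b (Y $$ (i, j)) * v (j, b) * cnj (w (i, a)))
          = \<phi> a b (\<Sum>i<n. \<Sum>j<n. (cnj (w (i, a)) * v (j, b)) *\<^sub>C Y $$ (i, j))"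
          by (simp add: sum_pairs mult_ac)
      qed
      finally have eq: "vinner ?K ?T w = (\<Sum>a<m. \<Sum>b<m. \<phi> a b (\<Sum>i<n. \<Sum>j<n. (cnj (w (i, a)) * v (j, b)) *\<^sub>C Y $$ (i, j)))" .
      have "cmod (vinner ?K ?T w) \<le> (\<Sum>a<m. \<Sum>b<m. \<bar>k a b\<bar> * (mat_norm Y * vnorm ?K v * vnorm ?K w))"
        unfolding eq
      proof (intro order_trans[OF norm_sum] sum_mono)
        fix a b assume ab: "a \<in> {..<m}" "b \<in> {..<m}"
        let ?y = "\<Sum>i<n. \<Sum>j<n. (cnj (w (i, a)) * v (j, b)) *\<^sub>C Y $$ (i, j)"
        have yF: "?y \<in> F" using YF by (intro cvs.subspace_sum[OF F] cvs.subspace_scale[OF F]) auto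
        have sub: "sqrt (\<Sum>j<n. (cmod (u (j, b)))\<^sup>2) \<le> vnorm ?K u" if "b < m" for u b
        proof (rule real_le_lsqrt)
          show "(\<Sum>j<n. (cmod (u (j, b)))\<^sup>2) \<le> (vnorm ?K u)\<^sup>2"
            unfolding vnorm_sq sum_pairs using that by (intro sum_mono member_le_sum) auto
        qed (auto simp: sum_nonneg)
        have "cmod (\<phi> a b ?y) \<le> k a b * norm ?y" using k ab yF by auto
        also have "\<dots> \<le> \<bar>k a b\<bar> * norm ?y" by (intro mult_right_mono) auto
        also have "norm ?y \<le> mat_norm Y * sqrt (\<Sum>j<n. (cmod (v (j, b)))\<^sup>2) * sqrt (\<Sum>i<n. (cmod (w (i, a)))\<^sup>2)"
          by (rule norm_scalar_compression_le[OF Y(1)])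
        also have "\<dots> \<le> mat_norm Y * vnorm ?K v * vnorm ?K w"
          using ab mat_norm_nonneg[OF Y(1)] by (intro mult_mono mult_left_mono sub mult_nonneg_nonneg) (auto simp: sum_nonneg)
        finally show "cmod (\<phi> a b ?y) \<le> \<bar>k a b\<bar> * (mat_norm Y * vnorm ?K v * vnorm ?K w)"
          by (simp add: mult_left_mono)
      qed
      also have "\<dots> = B * mat_norm Y * vnorm ?K v * vnorm ?K w"
        by (simp add: B_def sum_distrib_right mult.assoc)
      finally show "cmod (vinner ?K ?T w) \<le> B * mat_norm Y * vnorm ?K v * vnorm ?K w" .
    qed
  qed
  then show ?thesis unfolding completely_bounded_def by blast
qed

lemma jcb_norm_nonneg:
  fixes E :: "'a::cstar_algebra set" and F :: "'b::cstar_algebra set"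
  assumes F: "cvs.subspace F" and U: "jointly_cb E F U"
  shows "jcb_norm E F U \<ge> 0"
  unfolding jcb_norm_def
proof (rule cb_norm_nonneg[where Z="0\<^sub>m 0 0"])
  show "completely_bounded E mat_norm (dual_mat_norm F) U" using U by (simp add: jointly_cb_def)
  show "mat_norm X \<ge> 0" if "X \<in> carrier_mat n n" for n and X :: "'a mat" by (rule mat_norm_nonneg[OF that])
  show "mat_norm (0\<^sub>m 0 0 :: 'a mat) \<le> 1" using cmn_zero[OF cstar_matrix_norm_mat_norm, of 0, where 'a='a] by simp
  show "dual_mat_norm F (map_mat U (0\<^sub>m 0 0)) \<ge> 0"
    unfolding dual_mat_norm_def
  proof (rule cb_norm_nonneg[where Z="0\<^sub>m 0 0"])
    show "completely_bounded F mat_norm (block_norm (dim_row (map_mat U (0\<^sub>m 0 0))))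
      (\<lambda>b. map_mat (\<lambda>\<phi>. \<phi> b) (map_mat U (0\<^sub>m 0 0)))"
      by (rule completely_bounded_functional_matrix[OF F]) (auto simp: elements_mat_def)
    show "mat_norm X \<ge> 0" if "X \<in> carrier_mat n n" for n and X :: "'b mat" by (rule mat_norm_nonneg[OF that])
    show "mat_norm (0\<^sub>m 0 0 :: 'b mat) \<le> 1" using cmn_zero[OF cstar_matrix_norm_mat_norm, of 0, where 'a='b] by simp
  qed (auto intro: block_norm_nonneg[of _ 0])
qed simp

text \<open>The sum is the quadratic form of the amplified matrix \<open>U (A_ij) (B_kl)\<close> at
  the unit vector \<open>\<Sum> \<xi>_P e_P \<otimes> e_P\<close>; on this diagonal vector both
  amplifications carry the same indices.\<close>

lemma jcb_pairing_le_one: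
  fixes A :: "'a::cstar_algebra mat" and B :: "'b::cstar_algebra mat"
  assumes F: "cvs.subspace F" and U: "jointly_cb E F U"
    and A: "A \<in> carrier_mat m m" "elements_mat A \<subseteq> E" "mat_norm A \<le> 1"
    and B: "B \<in> carrier_mat m m" "elements_mat B \<subseteq> F" "mat_norm B \<le> 1"
    and \<xi>: "(\<Sum>P<m. (\<xi> P)\<^sup>2) = (1::real)"
  shows "cmod (\<Sum>P<m. \<Sum>Q<m. complex_of_real (\<xi> P * \<xi> Q) * U (A $$ (P, Q)) (B $$ (P, Q))) \<le> jcb_norm E F U"
proof -
  define \<Phi> where "\<Phi> = map_mat U A"
  have \<Phi>: "\<Phi> \<in> carrier_mat m m" "elements_mat \<Phi> \<subseteq> dual_space F" "dim_row \<Phi> = m"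
    using A U by (auto simp: \<Phi>_def jointly_cb_def)
  have "completely_bounded E mat_norm (dual_mat_norm F) U" using U by (simp add: jointly_cb_def)
  then have 1: "dual_mat_norm F \<Phi> \<le> jcb_norm E F U"
    unfolding jcb_norm_def \<Phi>_def using A by (intro le_cb_norm mat_norm_nonneg) auto
  define X where "X = map_mat (\<lambda>b. map_mat (\<lambda>\<phi>. \<phi> b) \<Phi>) B"
  have X: "X \<in> carrier_mat m m" using B by (simp add: X_def)
  have 2: "block_norm m X \<le> dual_mat_norm F \<Phi>"
    unfolding dual_mat_norm_def \<Phi>(3) X_def using B
    by (intro le_cb_norm[OF completely_bounded_functional_matrix[OF F \<Phi>(1,2)]] mat_norm_nonneg) auto
  let ?K = "{..<m} \<times> {..<m}"
  define v where "v = (\<lambda>(P, a :: nat). if P = a then complex_of_real (\<xi> P) else 0)"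
  have "(vnorm ?K v)\<^sup>2 = (\<Sum>P<m. \<Sum>a<m. if a = P then (\<xi> P)\<^sup>2 else 0)"
    unfolding vnorm_sq sum_pairs v_def by (intro sum.cong) auto
  also have "\<dots> = 1\<^sup>2" using \<xi> by simp
  finally have v1: "vnorm ?K v = 1" by (simp only: power2_eq_iff_nonneg vnorm_nonneg zero_le_one)
  let ?T = "kapp ?K (\<lambda>(i, a) (j, b). X $$ (i, j) $$ (a, b)) v"
  have app: "?T (P, P) = (\<Sum>Q<m. complex_of_real (\<xi> Q) * U (A $$ (P, Q)) (B $$ (P, Q)))" if P: "P < m" for P
  proof -
    have "?T (P, P) = (\<Sum>Q<m. \<Sum>b<m. if b = Q then complex_of_real (\<xi> Q) * U (A $$ (P, Q)) (B $$ (P, Q)) else 0)"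
      unfolding kapp_def sum_pairs v_def using P A(1) B(1)
      by (intro sum.cong refl) (auto simp: X_def \<Phi>_def)
    then show ?thesis by simp
  qed
  have "vinner ?K ?T v = (\<Sum>P<m. \<Sum>a<m. if a = P then complex_of_real (\<xi> P) * ?T (P, P) else 0)"
    unfolding vinner_def sum_pairs v_def by (intro sum.cong refl) auto
  also have "\<dots> = (\<Sum>P<m. complex_of_real (\<xi> P) * ?T (P, P))" by simp
  also have "\<dots> = (\<Sum>P<m. \<Sum>Q<m. complex_of_real (\<xi> P * \<xi> Q) * U (A $$ (P, Q)) (B $$ (P, Q)))"
    by (intro sum.cong refl) (simp add: app sum_distrib_left mult.assoc)
  finally have "cmod (\<Sum>P<m. \<Sum>Q<m. complex_of_real (\<xi> P * \<xi> Q) * U (A $$ (P, Q)) (B $$ (P, Q))) = cmod (vinner ?K ?T v)" by simp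
  also have "\<dots> \<le> vnorm ?K ?T * vnorm ?K v" by (rule cmod_vinner_le)
  also have "\<dots> \<le> block_norm m X" using vnorm_kapp_le_block_norm[OF X, of m v] by (simp add: v1)
  finally show ?thesis using 1 2 by linarith
qed

lemma jcb_pairing_le:
  fixes A :: "'a::cstar_algebra mat" and B :: "'b::cstar_algebra mat"
  assumes E: "cvs.subspace E" and F: "cvs.subspace F" and U: "jointly_cb E F U"
    and A: "A \<in> carrier_mat m m" "elements_mat A \<subseteq> E" "mat_norm A \<le> x" "x > 0"
    and B: "B \<in> carrier_mat m m" "elements_mat B \<subseteq> F" "mat_norm B \<le> y" "y > 0"
    and \<xi>: "(\<Sum>P<m. (\<xi> P)\<^sup>2) = (1::real)"
  shows "cmod (\<Sum>P<m. \<Sum>Q<m. complex_of_real (\<xi> P * \<xi> Q) * U (A $$ (P, Q)) (B $$ (P, Q))) \<le> x * y * jcb_norm E F U"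
proof -
  define A' where "A' = map_mat (scaleC (complex_of_real (1 / x))) A"
  define B' where "B' = map_mat (scaleC (complex_of_real (1 / y))) B"
  let ?S = "\<Sum>P<m. \<Sum>Q<m. complex_of_real (\<xi> P * \<xi> Q) * U (A $$ (P, Q)) (B $$ (P, Q))"
  have AE: "A $$ (i, j) \<in> E" and BF: "B $$ (i, j) \<in> F" if "i < m" "j < m" for i j
    using A(2) B(2) elements_matI[OF A(1) that refl] elements_matI[OF B(1) that refl] by auto
  have "cmod (\<Sum>P<m. \<Sum>Q<m. complex_of_real (\<xi> P * \<xi> Q) * U (A' $$ (P, Q)) (B' $$ (P, Q))) \<le> jcb_norm E F U"
    using A B E F unfolding A'_def B'_def
    by (intro jcb_pairing_le_one[OF F U] \<xi> map_mat_scale_elements mat_norm_scaleR_le[of _ m]) auto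
  also have "(\<Sum>P<m. \<Sum>Q<m. complex_of_real (\<xi> P * \<xi> Q) * U (A' $$ (P, Q)) (B' $$ (P, Q)))
    = (complex_of_real (1 / x) * complex_of_real (1 / y)) * ?S"
    unfolding sum_distrib_left
  proof (intro sum.cong refl)
    fix P Q assume "P \<in> {..<m}" "Q \<in> {..<m}"
    then have PQ: "P < m" "Q < m" by auto
    have "U (A' $$ (P, Q)) (B' $$ (P, Q)) = complex_of_real (1 / x) * (complex_of_real (1 / y) * U (A $$ (P, Q)) (B $$ (P, Q)))"
      using U AE[OF PQ] BF[OF PQ] cvs.subspace_scale[OF F BF[OF PQ]] A(1) B(1) PQ
      unfolding A'_def B'_def jointly_cb_def bilinear_form_def by auto
    then show "complex_of_real (\<xi> P * \<xi> Q) * U (A' $$ (P, Q)) (B' $$ (P, Q))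
      = complex_of_real (1 / x) * complex_of_real (1 / y) * (complex_of_real (\<xi> P * \<xi> Q) * U (A $$ (P, Q)) (B $$ (P, Q)))"
      by (simp only: mult_ac)
  qed
  also have "cmod (complex_of_real (1 / x) * complex_of_real (1 / y) * ?S) = cmod ?S / (x * y)"
    using A(4) B(4) by (simp add: norm_mult norm_divide)
  finally show ?thesis using A(4) B(4) by (simp add: divide_le_eq mult_ac)
qed

section \<open>The pairing matrices\<close>

lemma cmod_sum_mult_le: "cmod (\<Sum>k\<in>K. u k * w k) \<le> vnorm K u * vnorm K w"
proof -
  have "(\<Sum>k\<in>K. u k * w k) = vinner K u (\<lambda>k. cnj (w k))" by (simp add: vinner_def)
  moreover have "vnorm K (\<lambda>k. cnj (w k)) = vnorm K w" by (simp add: vnorm_def)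
  ultimately show ?thesis using cmod_vinner_le[of K u "\<lambda>k. cnj (w k)"] by simp
qed

lemma vnorm_involution:
  assumes "local_tree d I s R len" "c \<in> I"
  shows "vnorm {..<d} (\<lambda>p. u (s c p)) = vnorm {..<d} u"
proof -
  have "(vnorm {..<d} (\<lambda>p. u (s c p)))\<^sup>2 = (vnorm {..<d} u)\<^sup>2"
    unfolding vnorm_sq by (rule sum_involution[OF assms])
  then show ?thesis by (simp only: power2_eq_iff_nonneg vnorm_nonneg)
qed

text \<open>For \<open>f\<close> and \<open>g\<close> the identity the double sum counts the points
  where \<open>s c\<close> and \<open>s c'\<close> agree: all \<open>d\<close> of them if
  \<open>c = c'\<close>, none otherwise. Replacing \<open>f\<close> and \<open>g\<close> by the
  identity costs \<open>\<eta>\<close> each in every column.\<close>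

lemma tracial_pairing:
  assumes lt: "local_tree d I s R len" and R: "R \<ge> 2" and c: "c \<in> I" "c' \<in> I"
    and f: "\<And>q. q < d \<Longrightarrow> vnorm {..<d} (\<lambda>p. delta q p - f p q) \<le> \<eta>"
    and g: "\<And>q. q < d \<Longrightarrow> vnorm {..<d} (\<lambda>p. delta q p - g p q) \<le> \<eta>"
    and g1: "\<And>q. q < d \<Longrightarrow> vnorm {..<d} (\<lambda>p. g p q) \<le> 1"
  shows "cmod ((\<Sum>p<d. \<Sum>q<d. f (s c p) q * g (s c' p) q) - (if c = c' then of_nat d else 0)) \<le> 2 * real d * \<eta>"
proof -
  have "(\<Sum>q<d. delta q (s c p) * delta q (s c' p)) = (if c = c' then 1 else 0 :: complex)" if p: "p < d" for p
  proof -
    have sp: "s c p < d" using lt c p by (auto simp: local_tree_def)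
    have "(\<Sum>q<d. delta q (s c p) * delta q (s c' p)) = (\<Sum>q<d. if q = s c p then (if s c p = s c' p then 1 else 0) else 0 :: complex)"
      by (intro sum.cong) (auto simp: delta_def)
    also have "\<dots> = (if s c p = s c' p then 1 else 0)" using sp by simp
    finally show ?thesis using local_tree_neq[OF lt R c _ p] by auto
  qed
  then have "(\<Sum>p<d. \<Sum>q<d. delta q (s c p) * delta q (s c' p)) = (if c = c' then of_nat d else 0 :: complex)" by simp
  then have "(\<Sum>p<d. \<Sum>q<d. f (s c p) q * g (s c' p) q) - (if c = c' then of_nat d else 0)
    = (\<Sum>p<d. \<Sum>q<d. f (s c p) q * g (s c' p) q - delta q (s c p) * delta q (s c' p))"
    by (simp add: sum_subtractf)
  also have "\<dots> = (\<Sum>q<d. \<Sum>p<d. f (s c p) q * g (s c' p) q - delta q (s c p) * delta q (s c' p))" by (rule sum.swap)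
  also have "cmod \<dots> \<le> (\<Sum>q<d. 2 * \<eta>)"
  proof (rule order_trans[OF norm_sum], rule sum_mono)
    fix q assume "q \<in> {..<d}"
    then have q: "q < d" by simp
    have "(\<Sum>p<d. f (s c p) q * g (s c' p) q - delta q (s c p) * delta q (s c' p))
      = - (\<Sum>p<d. (delta q (s c p) - f (s c p) q) * g (s c' p) q) - (\<Sum>p<d. delta q (s c p) * (delta q (s c' p) - g (s c' p) q))"
      by (simp add: algebra_simps sum_subtractf sum.distrib)
    then have "cmod (\<Sum>p<d. f (s c p) q * g (s c' p) q - delta q (s c p) * delta q (s c' p))
      \<le> cmod (\<Sum>p<d. (delta q (s c p) - f (s c p) q) * g (s c' p) q) + cmod (\<Sum>p<d. delta q (s c p) * (delta q (s c' p) - g (s c' p) q))"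
      using norm_triangle_ineq4[of "- (\<Sum>p<d. (delta q (s c p) - f (s c p) q) * g (s c' p) q)"] by simp
    also have "cmod (\<Sum>p<d. (delta q (s c p) - f (s c p) q) * g (s c' p) q)
      \<le> vnorm {..<d} (\<lambda>p. delta q (s c p) - f (s c p) q) * vnorm {..<d} (\<lambda>p. g (s c' p) q)"
      by (rule cmod_sum_mult_le)
    also have "\<dots> = vnorm {..<d} (\<lambda>p. delta q p - f p q) * vnorm {..<d} (\<lambda>p. g p q)"
      using vnorm_involution[OF lt c(1), of "\<lambda>p. delta q p - f p q"] vnorm_involution[OF lt c(2), of "\<lambda>p. g p q"] by simp
    also have "\<dots> \<le> \<eta> * 1" using f[OF q] g1[OF q] order_trans[OF vnorm_nonneg f[OF q]] by (intro mult_mono) auto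
    also have "cmod (\<Sum>p<d. delta q (s c p) * (delta q (s c' p) - g (s c' p) q))
      \<le> vnorm {..<d} (\<lambda>p. delta q (s c p)) * vnorm {..<d} (\<lambda>p. delta q (s c' p) - g (s c' p) q)"
      by (rule cmod_sum_mult_le)
    also have "\<dots> = vnorm {..<d} (delta q) * vnorm {..<d} (\<lambda>p. delta q p - g p q)"
      using vnorm_involution[OF lt c(1), of "delta q"] vnorm_involution[OF lt c(2), of "\<lambda>p. delta q p - g p q"] by simp
    also have "\<dots> \<le> 1 * \<eta>" using g[OF q] vnorm_delta[of "{..<d}" q] q by simp
    finally show "cmod (\<Sum>p<d. f (s c p) q * g (s c' p) q - delta q (s c p) * delta q (s c' p)) \<le> 2 * \<eta>" by simp
  qed
  finally show ?thesis by simp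
qed

section \<open>Coupled coefficients and the block matrices\<close>

definition coupled :: "(nat \<Rightarrow> nat \<Rightarrow> nat \<Rightarrow> complex) \<Rightarrow> (nat \<Rightarrow> nat \<Rightarrow> nat \<Rightarrow> real)
    \<Rightarrow> nat \<times> nat \<times> nat \<Rightarrow> nat \<times> nat \<Rightarrow> nat \<times> nat \<Rightarrow> complex" where
  "coupled X p = (\<lambda>(i, j, k) (\<alpha>, a) (\<beta>, b).
     if a = k \<and> b = j then complex_of_real (sqrt (p i j k)) * X i \<alpha> \<beta> else 0)"

lemma coupled_sum:
  assumes "j < D"
  shows "(\<Sum>b\<in>{..<N} \<times> {..<D}. coupled X p (i, j, k) (\<alpha>, a) b * x b)
    = (if a = k then complex_of_real (sqrt (p i j k)) * (\<Sum>\<beta><N. X i \<alpha> \<beta> * x (\<beta>, j)) else 0)"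
proof -
  have "(\<Sum>b\<in>{..<N} \<times> {..<D}. coupled X p (i, j, k) (\<alpha>, a) b * x b)
    = (\<Sum>\<beta><N. \<Sum>b<D. if b = j then (if a = k then complex_of_real (sqrt (p i j k)) * (X i \<alpha> \<beta> * x (\<beta>, j)) else 0) else 0)"
    unfolding sum_pairs by (intro sum.cong refl) (auto simp: coupled_def)
  then show ?thesis using assms by (simp add: sum_distrib_left)
qed

text \<open>Summing squares over the target level \<open>k\<close> produces
  \<open>\<Sum>_k p i j k \<le> l i\<close>, which is exactly the weight in the hypothesis on
  \<open>X\<close>; the levels \<open>j\<close> do not interact.\<close>

lemma col_bound_coupled:
  assumes p: "\<And>i j k. i < n \<Longrightarrow> p i j k \<ge> 0" and row: "\<And>i j. i < n \<Longrightarrow> (\<Sum>k<D. p i j k) \<le> l i"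
    and X: "\<And>x. (\<Sum>i<n. l i * (\<Sum>\<alpha><N. (cmod (\<Sum>\<beta><N. X i \<alpha> \<beta> * x \<beta>))\<^sup>2)) \<le> \<alpha>\<^sup>2 * (\<Sum>\<beta><N. (cmod (x \<beta>))\<^sup>2)"
  shows "col_bound ({..<n} \<times> {..<D} \<times> {..<D}) ({..<N} \<times> {..<D}) (coupled X p) \<alpha>"
  unfolding col_bound_def
proof
  fix x :: "nat \<times> nat \<Rightarrow> complex"
  define S where "S i j = (\<Sum>a<N. (cmod (\<Sum>\<beta><N. X i a \<beta> * x (\<beta>, j)))\<^sup>2)" for i j
  have inner: "(\<Sum>a\<in>{..<N} \<times> {..<D}. (cmod (\<Sum>b\<in>{..<N} \<times> {..<D}. coupled X p (i, j, k) a b * x b))\<^sup>2) = p i j k * S i j"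
    if "i < n" "j < D" "k < D" for i j k
  proof -
    have "(\<Sum>a\<in>{..<N} \<times> {..<D}. (cmod (\<Sum>b\<in>{..<N} \<times> {..<D}. coupled X p (i, j, k) a b * x b))\<^sup>2)
      = (\<Sum>a<N. \<Sum>a'<D. if a' = k then p i j k * (cmod (\<Sum>\<beta><N. X i a \<beta> * x (\<beta>, j)))\<^sup>2 else 0)"
      unfolding sum_pairs[of _ "{..<N}" "{..<D}"]
    proof (intro sum.cong refl)
      fix a a'
      show "(cmod (\<Sum>b<N. \<Sum>b'<D. coupled X p (i, j, k) (a, a') (b, b') * x (b, b')))\<^sup>2
        = (if a' = k then p i j k * (cmod (\<Sum>\<beta><N. X i a \<beta> * x (\<beta>, j)))\<^sup>2 else 0)"
        using coupled_sum[OF that(2), where N=N and x=x and X=X and p=p and i=i and k=k and \<alpha>=a and a=a'] p[OF that(1), of j k]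
        by (simp add: sum_pairs norm_mult power_mult_distrib)
    qed
    then show ?thesis using that by (simp add: S_def sum_distrib_left)
  qed
  have S0: "S i j \<ge> 0" for i j by (simp add: S_def sum_nonneg)
  have "(\<Sum>i\<in>{..<n} \<times> {..<D} \<times> {..<D}. \<Sum>a\<in>{..<N} \<times> {..<D}. (cmod (\<Sum>b\<in>{..<N} \<times> {..<D}. coupled X p i a b * x b))\<^sup>2)
    = (\<Sum>i<n. \<Sum>j<D. \<Sum>k<D. p i j k * S i j)"
    unfolding sum_pairs[of _ "{..<n}"] sum_pairs[of _ "{..<D}" "{..<D}"] by (intro sum.cong refl) (rule inner, auto)
  also have "\<dots> = (\<Sum>i<n. \<Sum>j<D. (\<Sum>k<D. p i j k) * S i j)" by (simp add: sum_distrib_right)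
  also have "\<dots> \<le> (\<Sum>i<n. \<Sum>j<D. l i * S i j)" by (intro sum_mono mult_right_mono row S0) auto
  also have "\<dots> = (\<Sum>j<D. \<Sum>i<n. l i * S i j)" by (rule sum.swap)
  also have "\<dots> \<le> (\<Sum>j<D. \<alpha>\<^sup>2 * (\<Sum>\<beta><N. (cmod (x (\<beta>, j)))\<^sup>2))"
    unfolding S_def by (intro sum_mono X)
  also have "\<dots> = \<alpha>\<^sup>2 * (\<Sum>b\<in>{..<N} \<times> {..<D}. (cmod (x b))\<^sup>2)"
    unfolding sum_pairs sum_distrib_left[symmetric] by (subst sum.swap) (rule refl)
  finally show "(\<Sum>i\<in>{..<n} \<times> {..<D} \<times> {..<D}. \<Sum>a\<in>{..<N} \<times> {..<D}. (cmod (\<Sum>b\<in>{..<N} \<times> {..<D}. coupled X p i a b * x b))\<^sup>2)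
    \<le> \<alpha>\<^sup>2 * (\<Sum>b\<in>{..<N} \<times> {..<D}. (cmod (x b))\<^sup>2)" .
qed

text \<open>Dually, the vector reaching level \<open>k\<close> is a combination over
  \<open>j\<close> with coefficients \<open>sqrt (p i j k)\<close>. Cauchy-Schwarz and
  \<open>\<Sum>_j p i j k \<le> 1 / l i\<close> cancel the weight \<open>l i\<close> in the
  hypothesis on \<open>X\<close>.\<close>

lemma row_bound_coupled:
  assumes p: "\<And>i j k. i < n \<Longrightarrow> p i j k \<ge> 0" and l: "\<And>i. i < n \<Longrightarrow> l i > (0::real)"
    and col: "\<And>i k. i < n \<Longrightarrow> (\<Sum>j<D. p i j k) \<le> inverse (l i)"
    and X: "\<And>x. (\<Sum>\<alpha><N. (cmod (\<Sum>i<n. \<Sum>\<beta><N. X i \<alpha> \<beta> * x i \<beta>))\<^sup>2)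
      \<le> \<beta>'\<^sup>2 * (\<Sum>i<n. l i * (\<Sum>\<beta><N. (cmod (x i \<beta>))\<^sup>2))"
  shows "row_bound ({..<n} \<times> {..<D} \<times> {..<D}) ({..<N} \<times> {..<D}) (coupled X p) \<beta>'"
  unfolding row_bound_def
proof
  fix x :: "nat \<times> nat \<times> nat \<Rightarrow> nat \<times> nat \<Rightarrow> complex"
  define y where "y k i \<beta> = (\<Sum>j<D. complex_of_real (sqrt (p i j k)) * x (i, j, k) (\<beta>, j))" for k i \<beta>
  have y: "l i * (cmod (y k i \<beta>))\<^sup>2 \<le> (\<Sum>j<D. (cmod (x (i, j, k) (\<beta>, j)))\<^sup>2)" if i: "i < n" for i k \<beta>
  proof -
    have "cmod (y k i \<beta>) \<le> vnorm {..<D} (\<lambda>j. complex_of_real (sqrt (p i j k))) * vnorm {..<D} (\<lambda>j. x (i, j, k) (\<beta>, j))"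
      unfolding y_def by (rule cmod_sum_mult_le)
    then have "(cmod (y k i \<beta>))\<^sup>2 \<le> (vnorm {..<D} (\<lambda>j. complex_of_real (sqrt (p i j k))))\<^sup>2 * (vnorm {..<D} (\<lambda>j. x (i, j, k) (\<beta>, j)))\<^sup>2"
      unfolding power_mult_distrib[symmetric] by (intro power_mono) auto
    also have "(vnorm {..<D} (\<lambda>j. complex_of_real (sqrt (p i j k))))\<^sup>2 = (\<Sum>j<D. p i j k)"
      unfolding vnorm_sq using p[OF i] by simp
    also have "(\<Sum>j<D. p i j k) * (vnorm {..<D} (\<lambda>j. x (i, j, k) (\<beta>, j)))\<^sup>2
      \<le> inverse (l i) * (vnorm {..<D} (\<lambda>j. x (i, j, k) (\<beta>, j)))\<^sup>2"
      by (intro mult_right_mono col i) auto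
    finally have "l i * (cmod (y k i \<beta>))\<^sup>2 \<le> l i * (inverse (l i) * (vnorm {..<D} (\<lambda>j. x (i, j, k) (\<beta>, j)))\<^sup>2)"
      using l[OF i] by (intro mult_left_mono) auto
    also have "\<dots> = (vnorm {..<D} (\<lambda>j. x (i, j, k) (\<beta>, j)))\<^sup>2" using l[OF i] by simp
    finally show ?thesis unfolding vnorm_sq .
  qed
  have inner: "(\<Sum>i\<in>{..<n} \<times> {..<D} \<times> {..<D}. \<Sum>b\<in>{..<N} \<times> {..<D}. coupled X p i (\<alpha>, a) b * x i b)
    = (\<Sum>i<n. \<Sum>\<beta><N. X i \<alpha> \<beta> * y a i \<beta>)" if "a < D" for \<alpha> a
  proof -
    have "(\<Sum>i\<in>{..<n} \<times> {..<D} \<times> {..<D}. \<Sum>b\<in>{..<N} \<times> {..<D}. coupled X p i (\<alpha>, a) b * x i b)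
      = (\<Sum>i<n. \<Sum>j<D. \<Sum>k<D. if k = a then complex_of_real (sqrt (p i j a)) * (\<Sum>\<beta><N. X i \<alpha> \<beta> * x (i, j, a) (\<beta>, j)) else 0)"
      unfolding sum_pairs[of _ "{..<n}"] sum_pairs[of _ "{..<D}" "{..<D}"]
      by (intro sum.cong refl) (auto simp: coupled_sum)
    also have "\<dots> = (\<Sum>i<n. \<Sum>j<D. \<Sum>\<beta><N. complex_of_real (sqrt (p i j a)) * (X i \<alpha> \<beta> * x (i, j, a) (\<beta>, j)))"
      using that by (simp add: sum_distrib_left)
    also have "\<dots> = (\<Sum>i<n. \<Sum>\<beta><N. \<Sum>j<D. complex_of_real (sqrt (p i j a)) * (X i \<alpha> \<beta> * x (i, j, a) (\<beta>, j)))"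
      by (intro sum.cong[OF refl] sum.swap)
    finally show ?thesis by (simp add: y_def sum_distrib_left mult_ac)
  qed
  have "(\<Sum>a\<in>{..<N} \<times> {..<D}. (cmod (\<Sum>i\<in>{..<n} \<times> {..<D} \<times> {..<D}. \<Sum>b\<in>{..<N} \<times> {..<D}. coupled X p i a b * x i b))\<^sup>2)
    = (\<Sum>\<alpha><N. \<Sum>a<D. (cmod (\<Sum>i<n. \<Sum>\<beta><N. X i \<alpha> \<beta> * y a i \<beta>))\<^sup>2)"
    by (subst sum_pairs) (intro sum.cong refl, simp add: inner)
  also have "\<dots> = (\<Sum>a<D. \<Sum>\<alpha><N. (cmod (\<Sum>i<n. \<Sum>\<beta><N. X i \<alpha> \<beta> * y a i \<beta>))\<^sup>2)" by (rule sum.swap)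
  also have "\<dots> \<le> (\<Sum>a<D. \<beta>'\<^sup>2 * (\<Sum>i<n. l i * (\<Sum>\<beta><N. (cmod (y a i \<beta>))\<^sup>2)))" by (intro sum_mono X)
  also have "\<dots> = \<beta>'\<^sup>2 * (\<Sum>a<D. \<Sum>i<n. \<Sum>\<beta><N. l i * (cmod (y a i \<beta>))\<^sup>2)" by (simp add: sum_distrib_left)
  also have "\<dots> \<le> \<beta>'\<^sup>2 * (\<Sum>a<D. \<Sum>i<n. \<Sum>\<beta><N. \<Sum>j<D. (cmod (x (i, j, a) (\<beta>, j)))\<^sup>2)"
    by (intro mult_left_mono sum_mono y) auto
  \<comment> \<open>The component with colour \<open>(i, j, k)\<close> is read at level
    \<open>j\<close> only; the remaining levels are added to reach the full norm.\<close>
  also have "\<dots> \<le> \<beta>'\<^sup>2 * (\<Sum>a<D. \<Sum>i<n. \<Sum>\<beta><N. \<Sum>j<D. \<Sum>b<D. (cmod (x (i, j, a) (\<beta>, b)))\<^sup>2)"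
    by (intro mult_left_mono sum_mono member_le_sum) auto
  also have "(\<Sum>a<D. \<Sum>i<n. \<Sum>\<beta><N. \<Sum>j<D. \<Sum>b<D. (cmod (x (i, j, a) (\<beta>, b)))\<^sup>2)
    = (\<Sum>i<n. \<Sum>a<D. \<Sum>\<beta><N. \<Sum>j<D. \<Sum>b<D. (cmod (x (i, j, a) (\<beta>, b)))\<^sup>2)" by (rule sum.swap)
  also have "\<dots> = (\<Sum>i<n. \<Sum>a<D. \<Sum>j<D. \<Sum>\<beta><N. \<Sum>b<D. (cmod (x (i, j, a) (\<beta>, b)))\<^sup>2)"
    by (intro sum.cong[OF refl] sum.swap)
  also have "\<dots> = (\<Sum>i<n. \<Sum>j<D. \<Sum>a<D. \<Sum>\<beta><N. \<Sum>b<D. (cmod (x (i, j, a) (\<beta>, b)))\<^sup>2)"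
    by (intro sum.cong[OF refl] sum.swap)
  also have "\<dots> = (\<Sum>i\<in>{..<n} \<times> {..<D} \<times> {..<D}. \<Sum>b\<in>{..<N} \<times> {..<D}. (cmod (x i b))\<^sup>2)"
    by (simp add: sum_pairs)
  finally show "(\<Sum>a\<in>{..<N} \<times> {..<D}. (cmod (\<Sum>i\<in>{..<n} \<times> {..<D} \<times> {..<D}. \<Sum>b\<in>{..<N} \<times> {..<D}. coupled X p i a b * x i b))\<^sup>2)
    \<le> \<beta>'\<^sup>2 * (\<Sum>i\<in>{..<n} \<times> {..<D} \<times> {..<D}. \<Sum>b\<in>{..<N} \<times> {..<D}. (cmod (x i b))\<^sup>2)" .
qed

text \<open>A \<open>D d\<close> by \<open>D d\<close> matrix in blocks of size \<open>d\<close>: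
  block \<open>(k, j)\<close> is \<open>sqrt (p i j k)\<close> times the permutation matrix of
  \<open>s (i, j, k)\<close> followed on the right by the cut \<open>f\<close>.\<close>

definition block_coeff :: "nat \<Rightarrow> (nat \<Rightarrow> nat \<Rightarrow> nat \<Rightarrow> real) \<Rightarrow> (nat \<times> nat \<times> nat \<Rightarrow> nat \<Rightarrow> nat)
    \<Rightarrow> (nat \<Rightarrow> nat \<Rightarrow> complex) \<Rightarrow> nat \<Rightarrow> nat \<Rightarrow> nat \<Rightarrow> complex" where
  "block_coeff d p s f i P Q = complex_of_real (sqrt (p i (Q div d) (P div d)))
     * f (s (i, Q div d, P div d) (P mod d)) (Q mod d)"

text \<open>The same operator with its tensor factors regrouped: the level \<open>k\<close> passes
  from the coefficient side to the side of the \<open>Y_i\<close>.\<close>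

lemma vnorm_block_coeff_le:
  assumes d: "d > 0"
    and f: "\<And>v. vnorm (({..<N} \<times> {..<D}) \<times> {..<d})
        (tapp ({..<n} \<times> {..<D} \<times> {..<D}) ({..<N} \<times> {..<D}) s (coupled X p) (\<lambda>(a, p). kapp {..<d} f (\<lambda>q. v (a, q)) p))
      \<le> B * vnorm (({..<N} \<times> {..<D}) \<times> {..<d}) v"
  shows "vnorm ({..<D * d} \<times> {..<N}) (kapp ({..<D * d} \<times> {..<N})
      (\<lambda>(P, \<alpha>) (Q, \<beta>). \<Sum>i<n. block_coeff d p s f i P Q * X i \<alpha> \<beta>) v) \<le> B * vnorm ({..<D * d} \<times> {..<N}) v"
proof -
  define g where "g = (\<lambda>(P :: nat, \<alpha> :: nat). ((\<alpha>, P div d), P mod d))"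
  have lt: "k * d + q < D * d" if "k < D" "q < d" for k q
  proof -
    have "k * d + q < (k + 1) * d" using that by simp
    also have "\<dots> \<le> D * d" using that by (intro mult_le_mono1) auto
    finally show ?thesis .
  qed
  have g: "bij_betw g ({..<D * d} \<times> {..<N}) (({..<N} \<times> {..<D}) \<times> {..<d})"
    by (rule bij_betw_byWitness[where f'="\<lambda>((\<alpha>, k), q). (k * d + q, \<alpha>)"])
      (use d lt in \<open>auto simp: g_def less_mult_imp_div_less\<close>)
  define v' where "v' = (\<lambda>((\<alpha>, k), q). v (k * d + q, \<alpha>))"
  have vv: "v (Q, \<beta>) = v' ((\<beta>, Q div d), Q mod d)" for Q \<beta> by (simp add: v'_def)
  define C where "C = tapp ({..<n} \<times> {..<D} \<times> {..<D}) ({..<N} \<times> {..<D}) s (coupled X p)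
    (\<lambda>(a, p). kapp {..<d} f (\<lambda>q. v' (a, q)) p)"
  have C: "C ((\<alpha>, k), q) = kapp ({..<D * d} \<times> {..<N})
      (\<lambda>(P, \<alpha>) (Q, \<beta>). \<Sum>i<n. block_coeff d p s f i P Q * X i \<alpha> \<beta>) v (k * d + q, \<alpha>)"
    if k: "k < D" and q: "q < d" for \<alpha> k q
  proof -
    have "C ((\<alpha>, k), q) = (\<Sum>i<n. \<Sum>j<D. \<Sum>k'<D. if k' = k then complex_of_real (sqrt (p i j k))
        * (\<Sum>\<beta><N. X i \<alpha> \<beta> * kapp {..<d} f (\<lambda>q. v' ((\<beta>, j), q)) (s (i, j, k) q)) else 0)"
      unfolding C_def tapp_def prod.case sum_pairs[of _ "{..<n}"] sum_pairs[of _ "{..<D}" "{..<D}"]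
      by (intro sum.cong refl) (auto simp: coupled_sum)
    also have "\<dots> = (\<Sum>i<n. \<Sum>j<D. complex_of_real (sqrt (p i j k))
        * (\<Sum>\<beta><N. X i \<alpha> \<beta> * (\<Sum>r<d. f (s (i, j, k) q) r * v' ((\<beta>, j), r))))"
      using k by (simp add: kapp_def)
    also have "\<dots> = (\<Sum>i<n. \<Sum>j<D. \<Sum>\<beta><N. \<Sum>r<d. complex_of_real (sqrt (p i j k)) * f (s (i, j, k) q) r * X i \<alpha> \<beta> * v' ((\<beta>, j), r))"
      by (simp add: sum_distrib_left mult_ac)
    also have "\<dots> = (\<Sum>i<n. \<Sum>j<D. \<Sum>r<d. \<Sum>\<beta><N. complex_of_real (sqrt (p i j k)) * f (s (i, j, k) q) r * X i \<alpha> \<beta> * v' ((\<beta>, j), r))"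
      by (intro sum.cong[OF refl] sum.swap)
    also have "\<dots> = (\<Sum>i<n. \<Sum>z\<in>{..<D} \<times> {..<d}. \<Sum>\<beta><N. complex_of_real (sqrt (p i (fst z) k)) * f (s (i, fst z, k) q) (snd z) * X i \<alpha> \<beta> * v' ((\<beta>, fst z), snd z))"
      by (simp add: sum_pairs)
    also have "\<dots> = (\<Sum>i<n. \<Sum>Q<D * d. \<Sum>\<beta><N. complex_of_real (sqrt (p i (Q div d) k)) * f (s (i, Q div d, k) q) (Q mod d) * X i \<alpha> \<beta> * v' ((\<beta>, Q div d), Q mod d))"
      by (subst sum.reindex_bij_betw[OF bij_betw_div_mod, symmetric]) simp
    also have "\<dots> = (\<Sum>Q<D * d. \<Sum>i<n. \<Sum>\<beta><N. complex_of_real (sqrt (p i (Q div d) k)) * f (s (i, Q div d, k) q) (Q mod d) * X i \<alpha> \<beta> * v' ((\<beta>, Q div d), Q mod d))"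
      by (rule sum.swap)
    also have "\<dots> = (\<Sum>Q<D * d. \<Sum>\<beta><N. \<Sum>i<n. complex_of_real (sqrt (p i (Q div d) k)) * f (s (i, Q div d, k) q) (Q mod d) * X i \<alpha> \<beta> * v' ((\<beta>, Q div d), Q mod d))"
      by (intro sum.cong[OF refl] sum.swap)
    also have "\<dots> = kapp ({..<D * d} \<times> {..<N})
      (\<lambda>(P, \<alpha>) (Q, \<beta>). \<Sum>i<n. block_coeff d p s f i P Q * X i \<alpha> \<beta>) v (k * d + q, \<alpha>)"
      unfolding kapp_def sum_pairs using q d by (simp add: block_coeff_def vv sum_distrib_right)
    finally show ?thesis .
  qed
  have "vnorm ({..<D * d} \<times> {..<N}) (kapp ({..<D * d} \<times> {..<N})
      (\<lambda>(P, \<alpha>) (Q, \<beta>). \<Sum>i<n. block_coeff d p s f i P Q * X i \<alpha> \<beta>) v) = vnorm (({..<N} \<times> {..<D}) \<times> {..<d}) C"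
    unfolding vnorm_reindex[OF g, of C]
  proof (rule vnorm_cong)
    fix z assume "z \<in> {..<D * d} \<times> {..<N}"
    then obtain P \<alpha> where z: "z = (P, \<alpha>)" "P < D * d" by auto
    then show "kapp ({..<D * d} \<times> {..<N}) (\<lambda>(P, \<alpha>) (Q, \<beta>). \<Sum>i<n. block_coeff d p s f i P Q * X i \<alpha> \<beta>) v z = C (g z)"
      using C[of "P div d" "P mod d" \<alpha>] d by (simp add: g_def less_mult_imp_div_less)
  qed
  also have "\<dots> \<le> B * vnorm (({..<N} \<times> {..<D}) \<times> {..<d}) v'" unfolding C_def by (rule f)
  also have "vnorm (({..<N} \<times> {..<D}) \<times> {..<d}) v' = vnorm ({..<D * d} \<times> {..<N}) v"
    unfolding vnorm_reindex[OF g, of v'] by (rule vnorm_cong) (auto simp: g_def vv)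
  finally show ?thesis .
qed

text \<open>Coupled coefficients turn the weights into plain row and column bounds, so one
  unweighted construction on colours \<open>(i, j, k)\<close> suffices. Distinct \<open>i\<close>
  give distinct colours, which makes the pairing nearly diagonal, while the embezzlement overlap
  makes its diagonal nearly \<open>1\<close>.\<close>

lemma ex_pairing_matrices:
  fixes l :: "nat \<Rightarrow> real" and N\<^sub>1 N\<^sub>2 :: nat and X\<^sub>1 X\<^sub>2 :: "nat \<Rightarrow> nat \<Rightarrow> nat \<Rightarrow> complex"
  assumes l: "\<And>i. i < n \<Longrightarrow> l i > 0" and e: "e > 0"
    and nn: "\<alpha>\<^sub>1 \<ge> 0" "\<beta>\<^sub>1 \<ge> 0" "\<alpha>\<^sub>2 \<ge> 0" "\<beta>\<^sub>2 \<ge> 0"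
    and X1: "\<And>x. (\<Sum>i<n. l i * (\<Sum>\<alpha><N\<^sub>1. (cmod (\<Sum>\<beta><N\<^sub>1. X\<^sub>1 i \<alpha> \<beta> * x \<beta>))\<^sup>2)) \<le> \<alpha>\<^sub>1\<^sup>2 * (\<Sum>\<beta><N\<^sub>1. (cmod (x \<beta>))\<^sup>2)"
      "\<And>x. (\<Sum>\<alpha><N\<^sub>1. (cmod (\<Sum>i<n. \<Sum>\<beta><N\<^sub>1. X\<^sub>1 i \<alpha> \<beta> * x i \<beta>))\<^sup>2)
        \<le> \<beta>\<^sub>1\<^sup>2 * (\<Sum>i<n. l i * (\<Sum>\<beta><N\<^sub>1. (cmod (x i \<beta>))\<^sup>2))"
    and X2: "\<And>x. (\<Sum>i<n. l i * (\<Sum>\<alpha><N\<^sub>2. (cmod (\<Sum>\<beta><N\<^sub>2. X\<^sub>2 i \<alpha> \<beta> * x \<beta>))\<^sup>2)) \<le> \<alpha>\<^sub>2\<^sup>2 * (\<Sum>\<beta><N\<^sub>2. (cmod (x \<beta>))\<^sup>2)"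
      "\<And>x. (\<Sum>\<alpha><N\<^sub>2. (cmod (\<Sum>i<n. \<Sum>\<beta><N\<^sub>2. X\<^sub>2 i \<alpha> \<beta> * x i \<beta>))\<^sup>2)
        \<le> \<beta>\<^sub>2\<^sup>2 * (\<Sum>i<n. l i * (\<Sum>\<beta><N\<^sub>2. (cmod (x i \<beta>))\<^sup>2))"
  obtains m :: nat and Y Z :: "nat \<Rightarrow> nat \<Rightarrow> nat \<Rightarrow> complex" and \<xi> :: "nat \<Rightarrow> real"
  where "(\<Sum>P<m. (\<xi> P)\<^sup>2) = 1"
    "\<And>v. vnorm ({..<m} \<times> {..<N\<^sub>1}) (kapp ({..<m} \<times> {..<N\<^sub>1}) (\<lambda>(P, \<alpha>) (Q, \<beta>). \<Sum>i<n. Y i P Q * X\<^sub>1 i \<alpha> \<beta>) v)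
      \<le> (\<alpha>\<^sub>1 + \<beta>\<^sub>1 + e) * vnorm ({..<m} \<times> {..<N\<^sub>1}) v"
    "\<And>v. vnorm ({..<m} \<times> {..<N\<^sub>2}) (kapp ({..<m} \<times> {..<N\<^sub>2}) (\<lambda>(P, \<alpha>) (Q, \<beta>). \<Sum>i<n. Z i P Q * X\<^sub>2 i \<alpha> \<beta>) v)
      \<le> (\<alpha>\<^sub>2 + \<beta>\<^sub>2 + e) * vnorm ({..<m} \<times> {..<N\<^sub>2}) v"
    "\<And>i i'. i < n \<Longrightarrow> i' < n \<Longrightarrow>
      cmod ((\<Sum>P<m. \<Sum>Q<m. complex_of_real (\<xi> P * \<xi> Q) * (Y i P Q * Z i' P Q)) - (if i = i' then 1 else 0)) \<le> 2 * e"
proof -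
  have "\<exists>(D::nat) (r::nat \<Rightarrow> real) (p::nat \<Rightarrow> nat \<Rightarrow> nat \<Rightarrow> real). D > 0 \<and> (\<forall>j. r j > 0) \<and> (\<Sum>j<D. r j) = 1 \<and>
    (\<forall>i<n. (\<forall>j k. p i j k \<ge> 0) \<and> (\<forall>j. (\<Sum>k<D. p i j k) \<le> l i) \<and>
      (\<forall>k. (\<Sum>j<D. p i j k) \<le> inverse (l i)) \<and>
      \<bar>(\<Sum>j<D. \<Sum>k<D. p i j k * sqrt (r j * r k)) - 1\<bar> \<le> e)"
    using l e by (rule embezzling_coupling)
  then obtain D :: nat and r :: "nat \<Rightarrow> real" and p :: "nat \<Rightarrow> nat \<Rightarrow> nat \<Rightarrow> real" where P: "D > 0 \<and> (\<forall>j. r j > 0) \<and> (\<Sum>j<D. r j) = 1 \<and>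
    (\<forall>i<n. (\<forall>j k. p i j k \<ge> 0) \<and> (\<forall>j. (\<Sum>k<D. p i j k) \<le> l i) \<and>
      (\<forall>k. (\<Sum>j<D. p i j k) \<le> inverse (l i)) \<and>
      \<bar>(\<Sum>j<D. \<Sum>k<D. p i j k * sqrt (r j * r k)) - 1\<bar> \<le> e)" by blast
  have D: "D > 0" and r: "\<And>j. r j > 0" "(\<Sum>j<D. r j) = 1"
    and p: "\<And>i j k. i < n \<Longrightarrow> p i j k \<ge> 0"
    and row: "\<And>i j. i < n \<Longrightarrow> (\<Sum>k<D. p i j k) \<le> l i"
    and col: "\<And>i k. i < n \<Longrightarrow> (\<Sum>j<D. p i j k) \<le> inverse (l i)"
    and ov: "\<And>i. i < n \<Longrightarrow> \<bar>(\<Sum>j<D. \<Sum>k<D. p i j k * sqrt (r j * r k)) - 1\<bar> \<le> e"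
    using P by simp_all
  define I where "I = {..<n} \<times> {..<D} \<times> {..<D}"
  define J1 where "J1 = {..<N\<^sub>1} \<times> {..<D}"
  define J2 where "J2 = {..<N\<^sub>2} \<times> {..<D}"
  have fin: "finite I" "finite J1" "finite J2" by (auto simp: I_def J1_def J2_def)
  have cb1: "col_bound I J1 (coupled X\<^sub>1 p) \<alpha>\<^sub>1" "row_bound I J1 (coupled X\<^sub>1 p) \<beta>\<^sub>1"
    unfolding I_def J1_def
    by (rule col_bound_coupled[OF p row X1(1)], assumption+) (rule row_bound_coupled[OF p l col X1(2)], assumption+)
  have cb2: "col_bound I J2 (coupled X\<^sub>2 p) \<alpha>\<^sub>2" "row_bound I J2 (coupled X\<^sub>2 p) \<beta>\<^sub>2"
    unfolding I_def J2_def
    by (rule col_bound_coupled[OF p row X2(1)], assumption+) (rule row_bound_coupled[OF p l col X2(2)], assumption+)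
  define B1 where "B1 = \<alpha>\<^sub>1 + \<beta>\<^sub>1 + e"
  define B2 where "B2 = \<alpha>\<^sub>2 + \<beta>\<^sub>2 + e"
  have B: "B1 > 0" "B2 > 0" using nn e by (auto simp: B1_def B2_def)
  \<comment> \<open>The total weight by which the errors of the cut are multiplied in the pairing of
    \<open>i\<close> with \<open>i'\<close>. It is known before the graph is chosen, so
    \<open>\<eta>\<close> can be taken small relative to it.\<close>
  define W where "W i i' = (\<Sum>k<D. \<Sum>j<D. sqrt (r k * r j) * (sqrt (p i j k) * sqrt (p i' j k)))" for i i'
  have W0: "W i i' \<ge> 0" if "i < n" "i' < n" for i i'
    unfolding W_def using that p r(1) by (intro sum_nonneg mult_nonneg_nonneg) (auto simp: less_imp_le)
  define \<eta> where "\<eta> = e / (2 * (1 + (\<Sum>i<n. \<Sum>i'<n. W i i')))"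
  have sW: "(\<Sum>i<n. \<Sum>i'<n. W i i') \<ge> 0" by (intro sum_nonneg W0) auto
  have \<eta>0: "\<eta> > 0" unfolding \<eta>_def using e sW by (intro divide_pos_pos) auto
  have W\<eta>: "2 * \<eta> * W i i' \<le> e" if "i < n" "i' < n" for i i'
  proof -
    have "W i i' \<le> (\<Sum>i'<n. W i i')" using that W0 by (intro member_le_sum) auto
    also have "\<dots> \<le> (\<Sum>i<n. \<Sum>i'<n. W i i')"
      using that W0 by (intro member_le_sum[of i "{..<n}" "\<lambda>i. \<Sum>i'<n. W i i'"]) (auto intro!: sum_nonneg)
    finally have "2 * \<eta> * W i i' \<le> 2 * \<eta> * (1 + (\<Sum>i<n. \<Sum>i'<n. W i i'))" using \<eta>0 by (intro mult_left_mono) auto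
    also have "\<dots> = e"
    proof -
      have "2 * (e / (2 * w)) * w = e" if "w \<noteq> 0" for w :: real using that by simp
      moreover have "1 + (\<Sum>i<n. \<Sum>i'<n. W i i') \<noteq> 0" using sW by linarith
      ultimately show ?thesis unfolding \<eta>_def by blast
    qed
    finally show ?thesis .
  qed
  have small: "\<exists>k0. \<forall>k\<ge>k0. c * q ^ (4 * 2 ^ k) \<le> \<eta>\<^sup>2" if q: "0 \<le> q" "q < 1" and c: "c \<ge> 0" for c q :: real
  proof -
    obtain k0 where k0: "q ^ k0 < \<eta>\<^sup>2 / (c + 1)"
      using real_arch_pow_inv[of "\<eta>\<^sup>2 / (c + 1)" q] q c \<eta>0 by (auto simp: divide_pos_pos)
    show ?thesis
    proof (intro exI allI impI)
      fix k assume k: "k0 \<le> k"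
      have "k0 \<le> 4 * 2 ^ k" using less_exp[of k] k by linarith
      then have "q ^ (4 * 2 ^ k) \<le> q ^ k0" using q by (intro power_decreasing) auto
      then have "c * q ^ (4 * 2 ^ k) \<le> c * (\<eta>\<^sup>2 / (c + 1))" using k0 c by (intro mult_left_mono) auto
      also have "\<dots> \<le> \<eta>\<^sup>2" using c by (simp add: divide_le_eq algebra_simps)
      finally show "c * q ^ (4 * 2 ^ k) \<le> \<eta>\<^sup>2" .
    qed
  qed
  have q1: "0 \<le> (\<alpha>\<^sub>1 + \<beta>\<^sub>1) / B1" "(\<alpha>\<^sub>1 + \<beta>\<^sub>1) / B1 < 1" using nn e B by (auto simp: B1_def)
  have q2: "0 \<le> (\<alpha>\<^sub>2 + \<beta>\<^sub>2) / B2" "(\<alpha>\<^sub>2 + \<beta>\<^sub>2) / B2 < 1" using nn e B by (auto simp: B2_def)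
  obtain k1 where k1: "\<And>k. k \<ge> k1 \<Longrightarrow> (real (card J1))\<^sup>2 * ((\<alpha>\<^sub>1 + \<beta>\<^sub>1) / B1) ^ (4 * 2 ^ k) \<le> \<eta>\<^sup>2"
    using small[OF q1, of "(real (card J1))\<^sup>2"] by auto
  obtain k2 where k2: "\<And>k. k \<ge> k2 \<Longrightarrow> (real (card J2))\<^sup>2 * ((\<alpha>\<^sub>2 + \<beta>\<^sub>2) / B2) ^ (4 * 2 ^ k) \<le> \<eta>\<^sup>2"
    using small[OF q2, of "(real (card J2))\<^sup>2"] by auto
  \<comment> \<open>One graph must serve both cuts, because the pairing compares the same
    involutions in \<open>Y\<close> and \<open>Z\<close>.\<close>
  define k where "k = max k1 k2"
  define R where "R = (2 * 2 ^ k :: nat)"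
  have R: "2 * 2 ^ k \<le> R" "R \<ge> 2" by (auto simp: R_def)
  from ex_local_tree[OF fin(1), of R]
  obtain d s len where d: "d > 0" and lt: "local_tree d I s R len" by blast
  from ex_cut[OF fin(1,2) lt cb1(1) nn(1) cb1(2) nn(2) R(1) B(1)]
  obtain f where f1: "\<And>v. vnorm (J1 \<times> {..<d}) (tapp I J1 s (coupled X\<^sub>1 p) (\<lambda>(a, p). kapp {..<d} f (\<lambda>q. v (a, q)) p)) \<le> B1 * vnorm (J1 \<times> {..<d}) v"
    and "\<And>x. vnorm {..<d} (kapp {..<d} f x) \<le> vnorm {..<d} x"
    and f3: "\<And>q. q < d \<Longrightarrow> (vnorm {..<d} (\<lambda>p. delta q p - f p q))\<^sup>2 \<le> (real (card J1))\<^sup>2 * ((\<alpha>\<^sub>1 + \<beta>\<^sub>1) / B1) ^ (4 * 2 ^ k)"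
    by blast
  from ex_cut[OF fin(1,3) lt cb2(1) nn(3) cb2(2) nn(4) R(1) B(2)]
  obtain g where g1: "\<And>v. vnorm (J2 \<times> {..<d}) (tapp I J2 s (coupled X\<^sub>2 p) (\<lambda>(a, p). kapp {..<d} g (\<lambda>q. v (a, q)) p)) \<le> B2 * vnorm (J2 \<times> {..<d}) v"
    and g2: "\<And>x. vnorm {..<d} (kapp {..<d} g x) \<le> vnorm {..<d} x"
    and g3: "\<And>q. q < d \<Longrightarrow> (vnorm {..<d} (\<lambda>p. delta q p - g p q))\<^sup>2 \<le> (real (card J2))\<^sup>2 * ((\<alpha>\<^sub>2 + \<beta>\<^sub>2) / B2) ^ (4 * 2 ^ k)"
    by blast
  have f\<eta>: "vnorm {..<d} (\<lambda>p. delta q p - f p q) \<le> \<eta>" if "q < d" for q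
    by (rule power2_le_imp_le[OF order_trans[OF f3[OF that] k1[of k]]]) (use \<eta>0 in \<open>auto simp: k_def\<close>)
  have g\<eta>: "vnorm {..<d} (\<lambda>p. delta q p - g p q) \<le> \<eta>" if "q < d" for q
    by (rule power2_le_imp_le[OF order_trans[OF g3[OF that] k2[of k]]]) (use \<eta>0 in \<open>auto simp: k_def\<close>)
  have gc: "vnorm {..<d} (\<lambda>p. g p q) \<le> 1" if "q < d" for q
    using g2[of "delta q"] that vnorm_delta[of "{..<d}" q] vnorm_cong[of "{..<d}" "kapp {..<d} g (delta q)" "\<lambda>p. g p q"]
    by (simp add: kapp_delta)
  define m where "m = D * d"
  \<comment> \<open>The embezzlement vector on the levels, tensored with the normalised trace vector
    on the \<open>d\<close> points.\<close>
  define \<xi> where "\<xi> P = sqrt (r (P div d) / real d)" for P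
  define Y where "Y = block_coeff d p s f"
  define Z where "Z = block_coeff d p s g"
  have \<xi>\<xi>: "\<xi> P * \<xi> Q = sqrt (r (P div d) * r (Q div d)) / real d" for P Q
    using r(1) by (simp add: \<xi>_def real_sqrt_mult real_sqrt_divide)
  show ?thesis
  proof (rule that[where m=m and Y=Y and Z=Z and \<xi>=\<xi>])
    have "(\<Sum>P<m. (\<xi> P)\<^sup>2) = (\<Sum>P<m. r (P div d) / real d)"
      unfolding \<xi>_def using r(1) by (intro sum.cong refl) (simp add: less_imp_le)
    also have "\<dots> = (\<Sum>z\<in>{..<D} \<times> {..<d}. r (fst z) / real d)"
      unfolding m_def by (subst sum.reindex_bij_betw[OF bij_betw_div_mod, symmetric]) simp
    also have "\<dots> = 1" using r(2) d by (simp add: sum_pairs)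
    finally show "(\<Sum>P<m. (\<xi> P)\<^sup>2) = 1" .
    show "vnorm ({..<m} \<times> {..<N\<^sub>1}) (kapp ({..<m} \<times> {..<N\<^sub>1}) (\<lambda>(P, \<alpha>) (Q, \<beta>). \<Sum>i<n. Y i P Q * X\<^sub>1 i \<alpha> \<beta>) v)
      \<le> (\<alpha>\<^sub>1 + \<beta>\<^sub>1 + e) * vnorm ({..<m} \<times> {..<N\<^sub>1}) v" for v
      unfolding m_def Y_def B1_def[symmetric] using f1 unfolding I_def J1_def by (rule vnorm_block_coeff_le[OF d])
    show "vnorm ({..<m} \<times> {..<N\<^sub>2}) (kapp ({..<m} \<times> {..<N\<^sub>2}) (\<lambda>(P, \<alpha>) (Q, \<beta>). \<Sum>i<n. Z i P Q * X\<^sub>2 i \<alpha> \<beta>) v)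
      \<le> (\<alpha>\<^sub>2 + \<beta>\<^sub>2 + e) * vnorm ({..<m} \<times> {..<N\<^sub>2}) v" for v
      unfolding m_def Z_def B2_def[symmetric] using g1 unfolding I_def J2_def by (rule vnorm_block_coeff_le[OF d])
    fix i i' assume i: "i < n" "i' < n"
    define h where "h j k = (\<Sum>x<d. \<Sum>q<d. f (s (i, j, k) x) q * g (s (i', j, k) x) q)" for j k
    define c where "c k j = sqrt (r k * r j) * (sqrt (p i j k) * sqrt (p i' j k))" for k j
    have c0: "c k j \<ge> 0" for k j unfolding c_def using i p r(1) by (intro mult_nonneg_nonneg) (auto simp: less_imp_le)
    have hb: "cmod (h j k / of_nat d - (if i = i' then 1 else 0)) \<le> 2 * \<eta>" if "j < D" "k < D" for j k
    proof -
      have "(i, j, k) \<in> I" "(i', j, k) \<in> I" using i that by (auto simp: I_def)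
      from tracial_pairing[OF lt R(2) this f\<eta> g\<eta> gc]
      have "cmod (h j k - (if i = i' then of_nat d else 0)) \<le> 2 * real d * \<eta>" by (simp add: h_def)
      moreover have "h j k / of_nat d - (if i = i' then 1 else 0) = (h j k - (if i = i' then of_nat d else 0)) / of_nat d"
        using d by (simp add: diff_divide_distrib)
      ultimately show ?thesis using d by (simp add: norm_divide divide_le_eq mult_ac)
    qed
    have "(\<Sum>P<m. \<Sum>Q<m. complex_of_real (\<xi> P * \<xi> Q) * (Y i P Q * Z i' P Q))
      = (\<Sum>z\<in>{..<D} \<times> {..<d}. \<Sum>w\<in>{..<D} \<times> {..<d}. complex_of_real (c (fst z) (fst w) / real d)
          * (f (s (i, fst w, fst z) (snd z)) (snd w) * g (s (i', fst w, fst z) (snd z)) (snd w)))"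
      unfolding m_def sum.reindex_bij_betw[OF bij_betw_div_mod, symmetric, where N=d and n=D]
      by (intro sum.cong refl) (simp add: \<xi>\<xi> Y_def Z_def block_coeff_def c_def)
    also have "\<dots> = (\<Sum>k<D. \<Sum>x<d. \<Sum>j<D. \<Sum>q<d. complex_of_real (c k j / real d)
          * (f (s (i, j, k) x) q * g (s (i', j, k) x) q))"
      by (simp add: sum_pairs)
    also have "\<dots> = (\<Sum>k<D. \<Sum>j<D. \<Sum>x<d. \<Sum>q<d. complex_of_real (c k j / real d)
          * (f (s (i, j, k) x) q * g (s (i', j, k) x) q))"
      by (intro sum.cong[OF refl] sum.swap)
    also have "\<dots> = (\<Sum>k<D. \<Sum>j<D. complex_of_real (c k j) * (h j k / of_nat d))"
      by (simp add: h_def sum_distrib_left sum_divide_distrib)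
    finally have S: "(\<Sum>P<m. \<Sum>Q<m. complex_of_real (\<xi> P * \<xi> Q) * (Y i P Q * Z i' P Q))
      = (\<Sum>k<D. \<Sum>j<D. complex_of_real (c k j) * (h j k / of_nat d))" .
    define t where "t = (if i = i' then 1 else 0 :: complex)"
    have ht: "cmod (h j k / of_nat d - t) \<le> 2 * \<eta>" if "j < D" "k < D" for j k
      using hb[OF that] by (simp add: t_def)
    have Wc: "W i i' = (\<Sum>k<D. \<Sum>j<D. c k j)" by (simp add: W_def c_def)
    \<comment> \<open>The first part is the error of the cut. In the second, \<open>t = 0\<close>
      off the diagonal, so the overlap needs to be near \<open>1\<close> only for
      \<open>i = i'\<close>.\<close>
    have eq: "(\<Sum>k<D. \<Sum>j<D. complex_of_real (c k j) * (h j k / of_nat d)) - t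
      = (\<Sum>k<D. \<Sum>j<D. complex_of_real (c k j) * (h j k / of_nat d - t)) + (complex_of_real (W i i') - 1) * t"
      by (simp add: Wc sum_subtractf sum_distrib_right right_diff_distrib left_diff_distrib)
    have "cmod (\<Sum>k<D. \<Sum>j<D. complex_of_real (c k j) * (h j k / of_nat d - t)) \<le> (\<Sum>k<D. \<Sum>j<D. c k j * (2 * \<eta>))"
    proof (rule order_trans[OF norm_sum], rule sum_mono, rule order_trans[OF norm_sum], rule sum_mono)
      fix k j assume "k \<in> {..<D}" "j \<in> {..<D}"
      then show "cmod (complex_of_real (c k j) * (h j k / of_nat d - t)) \<le> c k j * (2 * \<eta>)"
        unfolding norm_mult norm_of_real abs_of_nonneg[OF c0] using ht by (intro mult_left_mono c0) auto
    qed
    also have "\<dots> = 2 * \<eta> * W i i'" by (simp add: Wc sum_distrib_left mult_ac)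
    also have "\<dots> \<le> e" by (rule W\<eta>[OF i])
    finally have 1: "cmod (\<Sum>k<D. \<Sum>j<D. complex_of_real (c k j) * (h j k / of_nat d - t)) \<le> e" .
    have 2: "cmod ((complex_of_real (W i i') - 1) * t) \<le> e"
    proof (cases "i = i'")
      case True
      have "W i i' = (\<Sum>k<D. \<Sum>j<D. p i j k * sqrt (r j * r k))"
        unfolding W_def True using p[OF i(2)] by (intro sum.cong refl) (simp add: mult.commute)
      also have "\<dots> = (\<Sum>j<D. \<Sum>k<D. p i j k * sqrt (r j * r k))" by (rule sum.swap)
      finally have We: "\<bar>W i i' - 1\<bar> \<le> e" using ov[OF i(1)] by simp
      have W1: "complex_of_real (W i i') - 1 = complex_of_real (W i i' - 1)" by simp
      have t1: "t = 1" using True by (simp add: t_def)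
      show ?thesis unfolding t1 W1 mult_1_right norm_of_real by (rule We)
    qed (use e in \<open>simp add: t_def\<close>)
    show "cmod ((\<Sum>P<m. \<Sum>Q<m. complex_of_real (\<xi> P * \<xi> Q) * (Y i P Q * Z i' P Q)) - (if i = i' then 1 else 0)) \<le> 2 * e"
      unfolding S t_def[symmetric] eq by (rule order_trans[OF norm_triangle_ineq]) (use 1 2 in linarith)
  qed
qed

section \<open>The inequality\<close>

lemma bilinear_form_sum:
  assumes E: "cvs.subspace E" and F: "cvs.subspace F" and U: "bilinear_form E F U"
    and fin: "finite S" "finite T" and a: "\<And>i. i \<in> S \<Longrightarrow> a i \<in> E" and b: "\<And>j. j \<in> T \<Longrightarrow> b j \<in> F"
  shows "U (\<Sum>i\<in>S. c i *\<^sub>C a i) (\<Sum>j\<in>T. d j *\<^sub>C b j) = (\<Sum>i\<in>S. \<Sum>j\<in>T. c i * d j * U (a i) (b j))"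
proof -
  have left: "U (\<Sum>i\<in>S. c i *\<^sub>C a i) y = (\<Sum>i\<in>S. c i * U (a i) y)" if y: "y \<in> F" for y
    using fin(1) a
  proof (induction S rule: finite_induct)
    case empty
    have "0 \<in> E" by (rule cvs.subspace_0[OF E])
    then have "U (0 *\<^sub>C 0) y = 0 * U 0 y" using U y unfolding bilinear_form_def by blast
    then show ?case by simp
  next
    case (insert i S)
    have aE: "a i \<in> E" by (rule insert.prems) simp
    have ca: "c i *\<^sub>C a i \<in> E" by (rule cvs.subspace_scale[OF E aE])
    have sS: "(\<Sum>i\<in>S. c i *\<^sub>C a i) \<in> E"
      by (intro cvs.subspace_sum[OF E] cvs.subspace_scale[OF E] insert.prems) simp
    have "U (c i *\<^sub>C a i + (\<Sum>i\<in>S. c i *\<^sub>C a i)) y = U (c i *\<^sub>C a i) y + U (\<Sum>i\<in>S. c i *\<^sub>C a i) y"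
      using U ca sS y unfolding bilinear_form_def by blast
    also have "U (c i *\<^sub>C a i) y = c i * U (a i) y"
      using U aE y unfolding bilinear_form_def by blast
    finally show ?case using insert.hyps insert.IH insert.prems by simp
  qed
  have right: "U x (\<Sum>j\<in>T. d j *\<^sub>C b j) = (\<Sum>j\<in>T. d j * U x (b j))" if x: "x \<in> E" for x
    using fin(2) b
  proof (induction T rule: finite_induct)
    case empty
    have "0 \<in> F" by (rule cvs.subspace_0[OF F])
    then have "U x (0 *\<^sub>C 0) = 0 * U x 0" using U x unfolding bilinear_form_def by blast
    then show ?case by simp
  next
    case (insert j T)
    have bF: "b j \<in> F" by (rule insert.prems) simp
    have db: "d j *\<^sub>C b j \<in> F" by (rule cvs.subspace_scale[OF F bF])
    have sT: "(\<Sum>j\<in>T. d j *\<^sub>C b j) \<in> F"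
      by (intro cvs.subspace_sum[OF F] cvs.subspace_scale[OF F] insert.prems) simp
    have "U x (d j *\<^sub>C b j + (\<Sum>j\<in>T. d j *\<^sub>C b j)) = U x (d j *\<^sub>C b j) + U x (\<Sum>j\<in>T. d j *\<^sub>C b j)"
      using U db sT x unfolding bilinear_form_def by blast
    also have "U x (d j *\<^sub>C b j) = d j * U x (b j)"
      using U bF x unfolding bilinear_form_def by blast
    finally show ?case using insert.hyps insert.IH insert.prems by simp
  qed
  have "(\<Sum>j\<in>T. d j *\<^sub>C b j) \<in> F" by (intro cvs.subspace_sum[OF F] cvs.subspace_scale[OF F] b)
  then have "U (\<Sum>i\<in>S. c i *\<^sub>C a i) (\<Sum>j\<in>T. d j *\<^sub>C b j) = (\<Sum>i\<in>S. c i * U (a i) (\<Sum>j\<in>T. d j *\<^sub>C b j))"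
    by (rule left)
  also have "\<dots> = (\<Sum>i\<in>S. c i * (\<Sum>j\<in>T. d j * U (a i) (b j)))"
    using right a by (intro sum.cong refl) simp
  finally show ?thesis by (simp add: sum_distrib_left mult.assoc)
qed

text \<open>Pairing \<open>\<Sum> a_i \<otimes> Y_i\<close> with
  \<open>\<Sum> b_i \<otimes> Z_i\<close> through \<open>U\<close> yields
  \<open>\<Sum> \<kappa>_{ii'} U (a_i) (b_{i'})\<close> with \<open>\<kappa>\<close> close to the
  identity matrix, and the left side is bounded by the product of the two matrix norms.\<close>

lemma jcb_bound_exact_with:
  fixes E :: "'a::cstar_algebra set" and F :: "'b::cstar_algebra set"
    and a :: "nat \<Rightarrow> 'a" and b :: "nat \<Rightarrow> 'b" and l :: "nat \<Rightarrow> real"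
  assumes E: "cvs.subspace E" and F: "cvs.subspace F" and U: "jointly_cb E F U"
    and ex: "exact_with E C\<^sub>1" "exact_with F C\<^sub>2"
    and a: "\<And>i. i < n \<Longrightarrow> a i \<in> E" and b: "\<And>i. i < n \<Longrightarrow> b i \<in> F" and l: "\<And>i. i < n \<Longrightarrow> l i > 0"
  shows "cmod (\<Sum>i<n. U (a i) (b i)) \<le> C\<^sub>1 * C\<^sub>2 * jcb_norm E F U *
     (sqrt (norm (\<Sum>i<n. l i *\<^sub>R (star (a i) * a i))) + sqrt (norm (\<Sum>i<n. inverse (l i) *\<^sub>R (a i * star (a i))))) *
     (sqrt (norm (\<Sum>i<n. l i *\<^sub>R (star (b i) * b i))) + sqrt (norm (\<Sum>i<n. inverse (l i) *\<^sub>R (b i * star (b i)))))"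
proof -
  define A1 where "A1 = sqrt (norm (\<Sum>i<n. l i *\<^sub>R (star (a i) * a i)))"
  define B1 where "B1 = sqrt (norm (\<Sum>i<n. inverse (l i) *\<^sub>R (a i * star (a i))))"
  define A2 where "A2 = sqrt (norm (\<Sum>i<n. l i *\<^sub>R (star (b i) * b i)))"
  define B2 where "B2 = sqrt (norm (\<Sum>i<n. inverse (l i) *\<^sub>R (b i * star (b i))))"
  have AB: "A1 \<ge> 0" "B1 \<ge> 0" "A2 \<ge> 0" "B2 \<ge> 0" by (simp_all add: A1_def B1_def A2_def B2_def)
  show ?thesis
  proof (rule exact_with_coordinates[OF E ex(1), of n a l, folded A1_def B1_def])
    show "a i \<in> E" "l i > 0" if "i < n" for i using a l that by auto
    fix N1 :: nat and X1 :: "nat \<Rightarrow> nat \<Rightarrow> nat \<Rightarrow> complex" and s1 t1 :: real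
    assume st1: "s1 \<ge> 0" "t1 \<ge> 0" "s1 * t1 \<le> C\<^sub>1"
      and col1: "\<And>x. (\<Sum>i<n. l i * (\<Sum>\<alpha><N1. (cmod (\<Sum>\<beta><N1. X1 i \<alpha> \<beta> * x \<beta>))\<^sup>2)) \<le> (s1 * A1)\<^sup>2 * (\<Sum>\<beta><N1. (cmod (x \<beta>))\<^sup>2)"
      and row1: "\<And>x. (\<Sum>\<alpha><N1. (cmod (\<Sum>i<n. \<Sum>\<beta><N1. X1 i \<alpha> \<beta> * x i \<beta>))\<^sup>2) \<le> (s1 * B1)\<^sup>2 * (\<Sum>i<n. l i * (\<Sum>\<beta><N1. (cmod (x i \<beta>))\<^sup>2))"
      and inv1: "\<And>m Y K. K > 0 \<Longrightarrow>
        (\<And>v. vnorm ({..<m} \<times> {..<N1}) (kapp ({..<m} \<times> {..<N1}) (\<lambda>(P, \<alpha>) (Q, \<beta>). \<Sum>i<n. Y i P Q * X1 i \<alpha> \<beta>) v)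
          \<le> K * vnorm ({..<m} \<times> {..<N1}) v) \<Longrightarrow> mat_norm (mat m m (\<lambda>(P, Q). \<Sum>i<n. Y i P Q *\<^sub>C a i)) \<le> t1 * K"
    show ?thesis
    proof (rule exact_with_coordinates[OF F ex(2), of n b l, folded A2_def B2_def])
      show "b i \<in> F" "l i > 0" if "i < n" for i using b l that by auto
      fix N2 :: nat and X2 :: "nat \<Rightarrow> nat \<Rightarrow> nat \<Rightarrow> complex" and s2 t2 :: real
      assume st2: "s2 \<ge> 0" "t2 \<ge> 0" "s2 * t2 \<le> C\<^sub>2"
        and col2: "\<And>x. (\<Sum>i<n. l i * (\<Sum>\<alpha><N2. (cmod (\<Sum>\<beta><N2. X2 i \<alpha> \<beta> * x \<beta>))\<^sup>2)) \<le> (s2 * A2)\<^sup>2 * (\<Sum>\<beta><N2. (cmod (x \<beta>))\<^sup>2)"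
        and row2: "\<And>x. (\<Sum>\<alpha><N2. (cmod (\<Sum>i<n. \<Sum>\<beta><N2. X2 i \<alpha> \<beta> * x i \<beta>))\<^sup>2) \<le> (s2 * B2)\<^sup>2 * (\<Sum>i<n. l i * (\<Sum>\<beta><N2. (cmod (x i \<beta>))\<^sup>2))"
        and inv2: "\<And>m Y K. K > 0 \<Longrightarrow>
          (\<And>v. vnorm ({..<m} \<times> {..<N2}) (kapp ({..<m} \<times> {..<N2}) (\<lambda>(P, \<alpha>) (Q, \<beta>). \<Sum>i<n. Y i P Q * X2 i \<alpha> \<beta>) v)
            \<le> K * vnorm ({..<m} \<times> {..<N2}) v) \<Longrightarrow> mat_norm (mat m m (\<lambda>(P, Q). \<Sum>i<n. Y i P Q *\<^sub>C b i)) \<le> t2 * K"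
      define j where "j = jcb_norm E F U"
      have j: "j \<ge> 0" unfolding j_def by (rule jcb_norm_nonneg[OF F U])
      \<comment> \<open>It depends on the data alone, so the defect \<open>2 * e * V\<close> of the
        pairing vanishes with \<open>e\<close>.\<close>
      define V where "V = (\<Sum>i<n. \<Sum>i'<n. cmod (U (a i) (b i')))"
      have bil: "bilinear_form E F U" using U by (simp add: jointly_cb_def)
      \<comment> \<open>\<open>t1\<close> and \<open>t2\<close> may be \<open>0\<close> while
        \<open>jcb_pairing_le\<close> asks for positive bounds; adding \<open>e\<close> avoids this
        and disappears in the limit.\<close>
      have main: "cmod (\<Sum>i<n. U (a i) (b i)) \<le> ((t1 + e) * (s1 * A1 + s1 * B1 + e)) * ((t2 + e) * (s2 * A2 + s2 * B2 + e)) * j + 2 * e * V"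
        if e: "e > 0" for e
      proof -
        have nn: "s1 * A1 \<ge> 0" "s1 * B1 \<ge> 0" "s2 * A2 \<ge> 0" "s2 * B2 \<ge> 0" using st1 st2 AB by auto
        show ?thesis
        proof (rule ex_pairing_matrices[OF l e nn col1 row1 col2 row2])
          show "i < n" if "i < n" for i by (rule that)
          fix m :: nat and Y Z :: "nat \<Rightarrow> nat \<Rightarrow> nat \<Rightarrow> complex" and \<xi> :: "nat \<Rightarrow> real"
          assume \<xi>: "(\<Sum>P<m. (\<xi> P)\<^sup>2) = 1"
            and Y: "\<And>v. vnorm ({..<m} \<times> {..<N1}) (kapp ({..<m} \<times> {..<N1}) (\<lambda>(P, \<alpha>) (Q, \<beta>). \<Sum>i<n. Y i P Q * X1 i \<alpha> \<beta>) v)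
              \<le> (s1 * A1 + s1 * B1 + e) * vnorm ({..<m} \<times> {..<N1}) v"
            and Z: "\<And>v. vnorm ({..<m} \<times> {..<N2}) (kapp ({..<m} \<times> {..<N2}) (\<lambda>(P, \<alpha>) (Q, \<beta>). \<Sum>i<n. Z i P Q * X2 i \<alpha> \<beta>) v)
              \<le> (s2 * A2 + s2 * B2 + e) * vnorm ({..<m} \<times> {..<N2}) v"
            and \<kappa>: "\<And>i i'. i < n \<Longrightarrow> i' < n \<Longrightarrow>
              cmod ((\<Sum>P<m. \<Sum>Q<m. complex_of_real (\<xi> P * \<xi> Q) * (Y i P Q * Z i' P Q)) - (if i = i' then 1 else 0)) \<le> 2 * e"
          define K1 where "K1 = s1 * A1 + s1 * B1 + e"
          define K2 where "K2 = s2 * A2 + s2 * B2 + e"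
          have K: "K1 > 0" "K2 > 0" using nn e by (auto simp: K1_def K2_def)
          define A where "A = mat m m (\<lambda>(P, Q). \<Sum>i<n. Y i P Q *\<^sub>C a i)"
          define B where "B = mat m m (\<lambda>(P, Q). \<Sum>i<n. Z i P Q *\<^sub>C b i)"
          have A: "A \<in> carrier_mat m m" "elements_mat A \<subseteq> E"
            using a by (auto simp: A_def elements_mat_def intro!: cvs.subspace_sum[OF E] cvs.subspace_scale[OF E])
          have B: "B \<in> carrier_mat m m" "elements_mat B \<subseteq> F"
            using b by (auto simp: B_def elements_mat_def intro!: cvs.subspace_sum[OF F] cvs.subspace_scale[OF F])
          have "mat_norm A \<le> t1 * K1" unfolding A_def by (rule inv1[OF K(1) Y[folded K1_def]])
          also have "\<dots> \<le> (t1 + e) * K1" using K e by (intro mult_right_mono) auto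
          finally have nA: "mat_norm A \<le> (t1 + e) * K1" .
          have "mat_norm B \<le> t2 * K2" unfolding B_def by (rule inv2[OF K(2) Z[folded K2_def]])
          also have "\<dots> \<le> (t2 + e) * K2" using K e by (intro mult_right_mono) auto
          finally have nB: "mat_norm B \<le> (t2 + e) * K2" .
          define \<kappa>' where "\<kappa>' i i' = (\<Sum>P<m. \<Sum>Q<m. complex_of_real (\<xi> P * \<xi> Q) * (Y i P Q * Z i' P Q))" for i i'
          define S where "S = (\<Sum>P<m. \<Sum>Q<m. complex_of_real (\<xi> P * \<xi> Q) * U (A $$ (P, Q)) (B $$ (P, Q)))"
          have "cmod S \<le> ((t1 + e) * K1) * ((t2 + e) * K2) * j"
            unfolding S_def j_def using st1 st2 K e
            by (intro jcb_pairing_le[OF E F U A nA _ B nB _ \<xi>] mult_pos_pos add_nonneg_pos) auto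
          moreover have "S = (\<Sum>i<n. \<Sum>i'<n. \<kappa>' i i' * U (a i) (b i'))"
          proof -
            have "S = (\<Sum>P<m. \<Sum>Q<m. \<Sum>i<n. \<Sum>i'<n. complex_of_real (\<xi> P * \<xi> Q) * (Y i P Q * Z i' P Q) * U (a i) (b i'))"
              unfolding S_def
            proof (intro sum.cong refl)
              fix P Q assume PQ: "P \<in> {..<m}" "Q \<in> {..<m}"
              have "U (A $$ (P, Q)) (B $$ (P, Q)) = (\<Sum>i<n. \<Sum>i'<n. Y i P Q * Z i' P Q * U (a i) (b i'))"
                using PQ a b bilinear_form_sum[OF E F bil, of "{..<n}" "{..<n}" a b "\<lambda>i. Y i P Q" "\<lambda>i. Z i P Q"]
                by (simp add: A_def B_def)
              then show "complex_of_real (\<xi> P * \<xi> Q) * U (A $$ (P, Q)) (B $$ (P, Q))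
                = (\<Sum>i<n. \<Sum>i'<n. complex_of_real (\<xi> P * \<xi> Q) * (Y i P Q * Z i' P Q) * U (a i) (b i'))"
                by (simp add: sum_distrib_left mult.assoc)
            qed
            also have "\<dots> = (\<Sum>P<m. \<Sum>i<n. \<Sum>Q<m. \<Sum>i'<n. complex_of_real (\<xi> P * \<xi> Q) * (Y i P Q * Z i' P Q) * U (a i) (b i'))"
              by (intro sum.cong[OF refl] sum.swap)
            also have "\<dots> = (\<Sum>i<n. \<Sum>P<m. \<Sum>Q<m. \<Sum>i'<n. complex_of_real (\<xi> P * \<xi> Q) * (Y i P Q * Z i' P Q) * U (a i) (b i'))"
              by (rule sum.swap)
            also have "\<dots> = (\<Sum>i<n. \<Sum>P<m. \<Sum>i'<n. \<Sum>Q<m. complex_of_real (\<xi> P * \<xi> Q) * (Y i P Q * Z i' P Q) * U (a i) (b i'))"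
              by (intro sum.cong[OF refl] sum.swap)
            also have "\<dots> = (\<Sum>i<n. \<Sum>i'<n. \<Sum>P<m. \<Sum>Q<m. complex_of_real (\<xi> P * \<xi> Q) * (Y i P Q * Z i' P Q) * U (a i) (b i'))"
              by (intro sum.cong[OF refl] sum.swap)
            finally show ?thesis by (simp add: \<kappa>'_def sum_distrib_right)
          qed
          moreover have "(\<Sum>i<n. U (a i) (b i))
            = (\<Sum>i<n. \<Sum>i'<n. \<kappa>' i i' * U (a i) (b i')) - (\<Sum>i<n. \<Sum>i'<n. (\<kappa>' i i' - (if i = i' then 1 else 0)) * U (a i) (b i'))"
          proof -
            have "(\<Sum>i<n. \<Sum>i'<n. \<kappa>' i i' * U (a i) (b i')) - (\<Sum>i<n. \<Sum>i'<n. (\<kappa>' i i' - (if i = i' then 1 else 0)) * U (a i) (b i'))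
              = (\<Sum>i<n. \<Sum>i'<n. if i' = i then U (a i) (b i) else 0)"
              unfolding sum_subtractf[symmetric] by (intro sum.cong refl) (auto simp: algebra_simps)
            then show ?thesis by simp
          qed
          moreover have "cmod (\<Sum>i<n. \<Sum>i'<n. (\<kappa>' i i' - (if i = i' then 1 else 0)) * U (a i) (b i')) \<le> 2 * e * V"
            unfolding V_def sum_distrib_left
          proof (rule order_trans[OF norm_sum], rule sum_mono, rule order_trans[OF norm_sum], rule sum_mono)
            fix i i' assume "i \<in> {..<n}" "i' \<in> {..<n}"
            then show "cmod ((\<kappa>' i i' - (if i = i' then 1 else 0)) * U (a i) (b i')) \<le> 2 * e * cmod (U (a i) (b i'))"
              unfolding norm_mult \<kappa>'_def by (intro mult_right_mono \<kappa>) auto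
          qed
          ultimately show ?thesis unfolding K1_def K2_def
            using norm_triangle_ineq4[of S "\<Sum>i<n. \<Sum>i'<n. (\<kappa>' i i' - (if i = i' then 1 else 0)) * U (a i) (b i')"] by simp
        qed
      qed
      have lim: "((\<lambda>e. ((t1 + e) * (s1 * A1 + s1 * B1 + e)) * ((t2 + e) * (s2 * A2 + s2 * B2 + e)) * j + 2 * e * V)
        \<longlongrightarrow> ((t1 + 0) * (s1 * A1 + s1 * B1 + 0)) * ((t2 + 0) * (s2 * A2 + s2 * B2 + 0)) * j + 2 * 0 * V) (at_right 0)"
        by (intro tendsto_intros)
      have "cmod (\<Sum>i<n. U (a i) (b i)) \<le> ((t1 + 0) * (s1 * A1 + s1 * B1 + 0)) * ((t2 + 0) * (s2 * A2 + s2 * B2 + 0)) * j + 2 * 0 * V"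
        by (rule tendsto_lowerbound[OF lim]) (auto intro!: eventually_mono[OF eventually_at_right_less[of 0]] main)
      also have "\<dots> = (s1 * t1) * (s2 * t2) * (j * (A1 + B1) * (A2 + B2))" by (simp add: algebra_simps)
      also have "\<dots> \<le> C\<^sub>1 * C\<^sub>2 * (j * (A1 + B1) * (A2 + B2))"
      proof (intro mult_right_mono mult_mono)
        show "0 \<le> C\<^sub>1" using st1 by (meson mult_nonneg_nonneg order_trans)
      qed (use st1 st2 j AB in auto)
      finally show ?thesis unfolding A1_def B1_def A2_def B2_def j_def by (simp add: mult.assoc)
    qed
  qed
qed

lemma exact_with_nonneg:
  assumes "cvs.subspace E" "exact_with E C'" shows "C' \<ge> 0"
proof -
  obtain s t :: real where "s \<ge> 0" "t \<ge> 0" "s * t \<le> C'"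
    by (rule exact_with_coordinates[OF assms, of 0]) auto
  then show ?thesis by (meson mult_nonneg_nonneg order_trans)
qed

lemma exact_with_near_ex_const:
  assumes "exact E" "e > 0"
  obtains C' where "exact_with E C'" "C' \<le> ex_const E + e"
proof -
  have "{C'. exact_with E C'} \<noteq> {}" using assms(1) by (auto simp: exact_def)
  moreover have "Inf {C'. exact_with E C'} < ex_const E + e" using assms(2) by (simp add: ex_const_def)
  ultimately have "\<exists>C'\<in>{C'. exact_with E C'}. C' < ex_const E + e" by (rule cInf_lessD)
  then obtain C' where "exact_with E C'" "C' < ex_const E + e" by auto
  then show ?thesis by (intro that[of C']) auto
qed

lemma ex_const_nonneg:
  assumes "cvs.subspace E" "exact E" shows "ex_const E \<ge> 0"
  unfolding ex_const_def
proof (rule cInf_greatest)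
  show "{C'. exact_with E C'} \<noteq> {}" using assms(2) by (auto simp: exact_def)
  show "0 \<le> C'" if "C' \<in> {C'. exact_with E C'}" for C' using exact_with_nonneg[OF assms(1)] that by auto
qed

theorem theorem0p3:
  fixes E :: "'a::cstar_algebra set" and F :: "'b::cstar_algebra set"
    and U :: "'a \<Rightarrow> 'b \<Rightarrow> complex" and C :: real
  assumes "cvs.subspace E" and "cvs.subspace F"
    and "exact E" and "exact F"
    and "C = ex_const E * ex_const F"
    and "jointly_cb E F U"
  shows "(\<forall>(n::nat) (a :: nat \<Rightarrow> 'a) (b :: nat \<Rightarrow> 'b) (l :: nat \<Rightarrow> real).
            (\<forall>i<n. a i \<in> E \<and> b i \<in> F \<and> l i > 0) \<longrightarrow>
            cmod (\<Sum>i<n. U (a i) (b i)) \<le> C * jcb_norm E F U *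
              (sqrt (norm (\<Sum>i<n. l i *\<^sub>R (star (a i) * a i)))
                + sqrt (norm (\<Sum>i<n. inverse (l i) *\<^sub>R (a i * star (a i))))) *
              (sqrt (norm (\<Sum>i<n. l i *\<^sub>R (star (b i) * b i)))
                + sqrt (norm (\<Sum>i<n. inverse (l i) *\<^sub>R (b i * star (b i)))))) \<and>
         (\<forall>(n::nat) (a :: nat \<Rightarrow> 'a) (b :: nat \<Rightarrow> 'b).
            (\<forall>i<n. a i \<in> E \<and> b i \<in> F) \<longrightarrow>
            cmod (\<Sum>i<n. U (a i) (b i)) \<le> 2 * C * jcb_norm E F U *
              (sqrt (norm (\<Sum>i<n. a i * star (a i))) * sqrt (norm (\<Sum>i<n. star (b i) * b i))
                + sqrt (norm (\<Sum>i<n. star (a i) * a i)) * sqrt (norm (\<Sum>i<n. b i * star (b i)))))"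
proof -
  have first: "cmod (\<Sum>i<n. U (a i) (b i)) \<le> C * jcb_norm E F U *
      (sqrt (norm (\<Sum>i<n. l i *\<^sub>R (star (a i) * a i))) + sqrt (norm (\<Sum>i<n. inverse (l i) *\<^sub>R (a i * star (a i))))) *
      (sqrt (norm (\<Sum>i<n. l i *\<^sub>R (star (b i) * b i))) + sqrt (norm (\<Sum>i<n. inverse (l i) *\<^sub>R (b i * star (b i)))))"
    (is "?S \<le> C * ?j * ?P * ?Q")
    if "\<forall>i<n. a i \<in> E \<and> b i \<in> F \<and> l i > 0" for n :: nat and a :: "nat \<Rightarrow> 'a" and b :: "nat \<Rightarrow> 'b" and l :: "nat \<Rightarrow> real"
  proof -
    \<comment> \<open>The constants \<open>ex_const\<close> are infima that may not be attained, so
      they are approached by admissible constants.\<close>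
    have lim: "((\<lambda>e. (ex_const E + e) * (ex_const F + e) * ?j * ?P * ?Q)
      \<longlongrightarrow> (ex_const E + 0) * (ex_const F + 0) * ?j * ?P * ?Q) (at_right 0)"
      by (intro tendsto_intros)
    have "?S \<le> (ex_const E + e) * (ex_const F + e) * ?j * ?P * ?Q" if e: "e > 0" for e
    proof -
      obtain C1 where C1: "exact_with E C1" "C1 \<le> ex_const E + e" by (rule exact_with_near_ex_const[OF assms(3) e])
      obtain C2 where C2: "exact_with F C2" "C2 \<le> ex_const F + e" by (rule exact_with_near_ex_const[OF assms(4) e])
      have S: "?S \<le> C1 * C2 * ?j * ?P * ?Q"
        using \<open>\<forall>i<n. a i \<in> E \<and> b i \<in> F \<and> l i > 0\<close>
        by (intro jcb_bound_exact_with assms C1 C2) auto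
      have "C1 * C2 \<le> (ex_const E + e) * (ex_const F + e)"
        using exact_with_nonneg[OF assms(1) C1(1)] exact_with_nonneg[OF assms(2) C2(1)] C1 C2 by (intro mult_mono) auto
      then have "C1 * C2 * ?j * ?P * ?Q \<le> (ex_const E + e) * (ex_const F + e) * ?j * ?P * ?Q"
        using jcb_norm_nonneg[OF assms(2,6)] by (intro mult_right_mono) auto
      with S show ?thesis by linarith
    qed
    then have "?S \<le> (ex_const E + 0) * (ex_const F + 0) * ?j * ?P * ?Q"
      by (intro tendsto_lowerbound[OF lim]) (auto intro!: eventually_mono[OF eventually_at_right_less[of 0]])
    then show ?thesis by (simp add: assms(5))
  qed
  have second: "cmod (\<Sum>i<n. U (a i) (b i)) \<le> 2 * C * jcb_norm E F U *
      (sqrt (norm (\<Sum>i<n. a i * star (a i))) * sqrt (norm (\<Sum>i<n. star (b i) * b i))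
        + sqrt (norm (\<Sum>i<n. star (a i) * a i)) * sqrt (norm (\<Sum>i<n. b i * star (b i))))"
    if ab: "\<forall>i<n. a i \<in> E \<and> b i \<in> F" for n :: nat and a :: "nat \<Rightarrow> 'a" and b :: "nat \<Rightarrow> 'b"
  proof -
    define a1 a2 where "a1 = sqrt (norm (\<Sum>i<n. star (a i) * a i))" and "a2 = sqrt (norm (\<Sum>i<n. a i * star (a i)))"
    define b1 b2 where "b1 = sqrt (norm (\<Sum>i<n. star (b i) * b i))" and "b2 = sqrt (norm (\<Sum>i<n. b i * star (b i)))"
    have nn: "a1 \<ge> 0" "a2 \<ge> 0" "b1 \<ge> 0" "b2 \<ge> 0" by (simp_all add: a1_def a2_def b1_def b2_def)
    define c where "c = C * jcb_norm E F U"
    have c: "c \<ge> 0" unfolding c_def assms(5)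
      by (intro mult_nonneg_nonneg ex_const_nonneg jcb_norm_nonneg assms)
    define S where "S = cmod (\<Sum>i<n. U (a i) (b i))"
    \<comment> \<open>Constant weights \<open>t\<close>: the mixed products do not depend on
      \<open>t\<close>, and only \<open>t u + w / t\<close> is left to minimise.\<close>
    have scaled: "S \<le> c * (t * (a1 * b1) + a2 * b2 / t + a1 * b2 + a2 * b1)" if t: "t > 0" for t
    proof -
      define r where "r = sqrt t"
      have r: "r > 0" "r * r = t" using t by (auto simp: r_def)
      have n1: "sqrt (norm (\<Sum>i<n. t *\<^sub>R x i)) = r * sqrt (norm (\<Sum>i<n. x i))" for x :: "nat \<Rightarrow> 'a"
        using t by (simp add: r_def real_sqrt_mult flip: scaleR_sum_right)
      have n2: "sqrt (norm (\<Sum>i<n. inverse t *\<^sub>R x i)) = sqrt (norm (\<Sum>i<n. x i)) / r" for x :: "nat \<Rightarrow> 'a"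
        using t by (simp add: r_def real_sqrt_mult real_sqrt_inverse divide_inverse mult.commute flip: scaleR_sum_right)
      have n1': "sqrt (norm (\<Sum>i<n. t *\<^sub>R x i)) = r * sqrt (norm (\<Sum>i<n. x i))" for x :: "nat \<Rightarrow> 'b"
        using t by (simp add: r_def real_sqrt_mult flip: scaleR_sum_right)
      have n2': "sqrt (norm (\<Sum>i<n. inverse t *\<^sub>R x i)) = sqrt (norm (\<Sum>i<n. x i)) / r" for x :: "nat \<Rightarrow> 'b"
        using t by (simp add: r_def real_sqrt_mult real_sqrt_inverse divide_inverse mult.commute flip: scaleR_sum_right)
      have "S \<le> c * (r * a1 + a2 / r) * (r * b1 + b2 / r)"
        using first[of n a b "\<lambda>_. t"] ab t unfolding n1 n2 n1' n2' S_def c_def a1_def a2_def b1_def b2_def by simp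
      also have "\<dots> = c * (r * r * (a1 * b1) + a2 * b2 / (r * r) + a1 * b2 + a2 * b1)"
        using r(1) by (simp add: field_simps)
      finally show ?thesis unfolding r(2) .
    qed
    define u where "u = a1 * b1"
    define w where "w = a2 * b2"
    have uw: "u \<ge> 0" "w \<ge> 0" using nn by (auto simp: u_def w_def)
    have lim: "((\<lambda>e. c * (2 * sqrt ((u + e) * (w + e)) + a1 * b2 + a2 * b1))
      \<longlongrightarrow> c * (2 * sqrt ((u + 0) * (w + 0)) + a1 * b2 + a2 * b1)) (at_right 0)"
      by (intro tendsto_intros)
    have "S \<le> c * (2 * sqrt ((u + e) * (w + e)) + a1 * b2 + a2 * b1)" if e: "e > 0" for e
    proof -
      define x y where "x = sqrt (u + e)" and "y = sqrt (w + e)"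
      have xy: "x > 0" "y > 0" "x * x = u + e" "y * y = w + e" using uw e by (auto simp: x_def y_def)
      have "y / x * u + w / (y / x) \<le> y / x * (x * x) + (y * y) / (y / x)"
        using xy e by (intro add_mono mult_left_mono divide_right_mono) auto
      also have "\<dots> = 2 * (x * y)" using xy(1,2) by (simp add: field_simps)
      also have "\<dots> = 2 * sqrt ((u + e) * (w + e))" by (simp add: x_def y_def real_sqrt_mult)
      finally have "c * (y / x * u + w / (y / x) + a1 * b2 + a2 * b1) \<le> c * (2 * sqrt ((u + e) * (w + e)) + a1 * b2 + a2 * b1)"
        using c by (intro mult_left_mono) auto
      then show ?thesis using scaled[of "y / x"] xy by (simp add: u_def w_def)
    qed
    then have "S \<le> c * (2 * sqrt ((u + 0) * (w + 0)) + a1 * b2 + a2 * b1)"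
      by (intro tendsto_lowerbound[OF lim]) (auto intro!: eventually_mono[OF eventually_at_right_less[of 0]])
    also have "\<dots> \<le> c * (2 * (a1 * b2 + a2 * b1))"
    proof (intro mult_left_mono c)
      \<comment> \<open>Regrouping the same four factors into the mixed products and using the
        arithmetic-geometric mean again counts each mixed product once more: the origin of the
        factor \<open>2\<close>.\<close>
      have "sqrt (u * w) = sqrt ((a1 * b2) * (a2 * b1))" by (simp add: u_def w_def mult_ac)
      also have "\<dots> \<le> (a1 * b2 + a2 * b1) / 2" using nn by (intro arith_geo_mean_sqrt) auto
      finally show "2 * sqrt ((u + 0) * (w + 0)) + a1 * b2 + a2 * b1 \<le> 2 * (a1 * b2 + a2 * b1)" by simp
    qed
    finally show ?thesis unfolding S_def c_def a1_def a2_def b1_def b2_def by (simp add: algebra_simps)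
  qed
  show ?thesis using first second by blast
qed

end
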